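(* Let $0<r<1$. (1) Let $f\in H^2(\mathbb{D})$, $f\ne0$. Then $f$ is $H^2(\mathbb{D})$-outer if and only if $f$ (restricted to $A_r$) is free outer in $\mathscr{H}^2(A_r)$. (2) Analogously, let $f\in H^2(\mathbb{D}_0)$, $f\neq 0$. Then $f$ is $H^2(\mathbb{D}_0)$-outer if and only if $f$ (restricted to $A_r$) is free outer in $\mathscr{H}^2(A_r)$.
   Context: $\mathbb{D}$ is the open unit disk, $\mathbb{D}_0=\{|z|>r\}\cup\{\infty\}$, $A_r=\{z\in\mathbb{C}:r<|z|<1\}$. $H^2(\mathbb{D})$ is the Hardy space; $H^2(\mathbb{D})$-outer means outer in the classical sense. $H^2(\mathbb{D}_0)$ is the Hardy space over $\mathbb{D}_0$, consisting of functions $\sum_{n\le0}c_nz^n$ with norm squared $\sum_{n\le0}r^{2n}|c_n|^2<\infty$; $f$ is $H^2(\mathbb{D}_0)$-outer if $f(z)=g(r/z)$ with $g$ an $H^2(\mathbb{D})$-outer function. $\mathscr{H}^2(A_r)$ is the reproducing kernel Hilbert space on $A_r$ with kernel $k_r(\lambda,\mu)=\frac{1-r^2}{(1-\lambda\bar\mu)(1-r^2/(\lambda\bar\mu))}$; it consists of the holomorphic functions $f=\sum_{n\in\mathbb{Z}}c_nz^n$ on $A_r$ with $\|f\|^2_{\mathscr{H}^2(A_r)}=\sum_{n<0}r^{2n}|c_n|^2+\sum_{n\ge0}|c_n|^2<\infty$. $\mathrm{Mult}(\mathscr{H}^2(A_r))$ is the algebra of functions $\phi:A_r\to\mathbb{C}$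 with $\phi f\in\mathscr{H}^2(A_r)$ for all $f\in\mathscr{H}^2(A_r)$ (as a set it is $H^\infty(A_r)$). For $f\in\mathscr{H}^2(A_r)$ let $P_f(\phi)=\langle\phi f,f\rangle$ for $\phi\in\mathrm{Mult}(\mathscr{H}^2(A_r))$, and $\mathcal{E}_f=\{g\in\mathscr{H}^2(A_r):P_g=P_f\}$. $f$ is free outer in $\mathscr{H}^2(A_r)$ if $|f(z_0)|=\sup\{|g(z_0)|:g\in\mathcal{E}_f\}$ for a fixed point $z_0\in A_r$; it is known (Aleman, Hartz, McCarthy, Richter) that this property does not depend on the choice of $z_0$ (it holds for one $z_0\in A_r$ iff it holds for all). *)

theory Defs
  imports "HOL-Complex_Analysis.Complex_Analysis"
begin

definition annulus :: "real \<Rightarrow> complex set" where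
  "annulus r = {z. r < cmod z \<and> cmod z < 1}"

(* Functions on a domain are modelled as total functions complex => complex. All notions below
   only look at the values on the domain in question, so passing from a larger domain to a
   smaller one (restriction) needs no operation. *)

definition hardy_disk :: "(complex \<Rightarrow> complex) set" where
  "hardy_disk = {f. f holomorphic_on ball 0 1 \<and>
     summable (\<lambda>n. (cmod ((deriv ^^ n) f 0 / fact n))\<^sup>2)}"

(* The classical outer functions: unimodular multiples of
   exp (1/(2 pi) * integral of (e^(it) + z) / (e^(it) - z) * log (phi t) over 0..2 pi),
   where phi is positive and measurable with integrable logarithm. (Necessarily phi is then
   almost everywhere the modulus of the radial boundary values of f.) *)
definition outer_disk :: "(complex \<Rightarrow> complex) \<Rightarrow> bool" where
  "outer_disk f \<longleftrightarrow> f \<in> hardy_disk \<and>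
     (\<exists>(\<alpha>::complex) (\<phi>::real \<Rightarrow> real).
        cmod \<alpha> = 1 \<and>
        \<phi> \<in> borel_measurable lborel \<and> (\<forall>t. 0 < \<phi> t) \<and>
        set_integrable lborel {0..2*pi} (\<lambda>t. ln (\<phi> t)) \<and>
        (\<forall>z\<in>ball 0 1. f z = \<alpha> * exp (1 / (2 * of_real pi) *
           (LINT t:{0..2*pi}|lborel. (cis t + z) / (cis t - z) * of_real (ln (\<phi> t))))))"

(* The domain is {|z| > r} together with infinity. The value at infinity is the coefficient of
   z^0, hence determined by the values on {|z| > r}; functions are represented by the latter. *)
definition hardy_ext :: "real \<Rightarrow> (complex \<Rightarrow> complex) set" where
  "hardy_ext r = {f. \<exists>c :: int \<Rightarrow> complex.
     (\<forall>z. r < cmod z \<longrightarrow> ((\<lambda>n. c n * z powi n) has_sum f z) {..0}) \<and>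
     (\<lambda>n. r powi (2 * n) * (cmod (c n))\<^sup>2) summable_on {..0}}"

definition outer_ext :: "real \<Rightarrow> (complex \<Rightarrow> complex) \<Rightarrow> bool" where
  "outer_ext r f \<longleftrightarrow> (\<exists>g. outer_disk g \<and> (\<forall>z. r < cmod z \<longrightarrow> f z = g (of_real r / z)))"

definition is_laurent :: "real \<Rightarrow> (complex \<Rightarrow> complex) \<Rightarrow> (int \<Rightarrow> complex) \<Rightarrow> bool" where
  "is_laurent r f c \<longleftrightarrow> (\<forall>z\<in>annulus r. ((\<lambda>n. c n * z powi n) has_sum f z) UNIV)"

(* For 0 < r < 1 a Laurent expansion on the annulus is unique, so THE picks it out for every
   holomorphic f. *)
definition laurent_coeffs :: "real \<Rightarrow> (complex \<Rightarrow> complex) \<Rightarrow> int \<Rightarrow> complex" where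
  "laurent_coeffs r f = (THE c. is_laurent r f c)"

definition weight :: "real \<Rightarrow> int \<Rightarrow> real" where
  "weight r n = (if n < 0 then r powi (2 * n) else 1)"

definition H2_annulus :: "real \<Rightarrow> (complex \<Rightarrow> complex) set" where
  "H2_annulus r = {f. f holomorphic_on annulus r \<and>
     (\<exists>c. is_laurent r f c \<and> (\<lambda>n. weight r n * (cmod (c n))\<^sup>2) summable_on UNIV)}"

(* The polarization of the weighted norm; its reproducing kernel is
   (1 - r^2) / ((1 - l * cnj m) * (1 - r^2 / (l * cnj m))). *)
definition H2_inner :: "real \<Rightarrow> (complex \<Rightarrow> complex) \<Rightarrow> (complex \<Rightarrow> complex) \<Rightarrow> complex" where
  "H2_inner r f g =
     (\<Sum>\<^sub>\<infinity>n. of_real (weight r n) * laurent_coeffs r f n * cnj (laurent_coeffs r g n))"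

definition Mult :: "real \<Rightarrow> (complex \<Rightarrow> complex) set" where
  "Mult r = {\<phi>. \<forall>f\<in>H2_annulus r. (\<lambda>z. \<phi> z * f z) \<in> H2_annulus r}"

definition Pfun :: "real \<Rightarrow> (complex \<Rightarrow> complex) \<Rightarrow> (complex \<Rightarrow> complex) \<Rightarrow> complex" where
  "Pfun r f \<phi> = H2_inner r (\<lambda>z. \<phi> z * f z) f"

definition Eset :: "real \<Rightarrow> (complex \<Rightarrow> complex) \<Rightarrow> (complex \<Rightarrow> complex) set" where
  "Eset r f = {g \<in> H2_annulus r. \<forall>\<phi>\<in>Mult r. Pfun r g \<phi> = Pfun r f \<phi>}"

(* The set under the supremum contains cmod (f z0) and is bounded, since all members of Eset r f
   have the same norm (take phi = 1) and point evaluations are bounded. *)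
definition free_outer :: "real \<Rightarrow> complex \<Rightarrow> (complex \<Rightarrow> complex) \<Rightarrow> bool" where
  "free_outer r z\<^sub>0 f \<longleftrightarrow>
     f \<in> H2_annulus r \<and> cmod (f z\<^sub>0) = (SUP g\<in>Eset r f. cmod (g z\<^sub>0))"

end

theory Submission
  imports Defs "HOL-Library.Poly_Mapping"
begin

text \<open>Let \<open>f\<close> be outer in the Hardy space of the disk and let \<open>g\<close> induce the same functional \<open>P\<close>. The kernel
  \<open>k\<^sub>r\<close> makes multiplication by \<open>(z, r / z)\<close>, divided by \<open>(1 + r\<^sup>2)\<^sup>1\<^sup>/\<^sup>2\<close>, a row contraction. Iterating the row
  inequality along a random walk that drifts upwards bounds the norm of \<open>m g\<close> for Laurent polynomials \<open>m\<close> by an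
  expression in \<open>P\<close> alone, that is, by an integral against \<open>cmod f\<^sup>2\<close> over the unit circle: if \<open>m\<close> is the mean of a
  random Laurent polynomial \<open>X\<close> adapted to the walk, then the square of the norm of \<open>m g\<close> is at most the expected
  integral of \<open>cmod (X f)\<^sup>2\<close>. Let \<open>X\<close> collect the terms \<open>cnj w\<^sup>k z\<^sup>k\<close> over all levels \<open>k\<close> visited by the walk,
  multiplied by a polynomial \<open>q\<close>. The mean is \<open>q\<close> times the kernel at \<open>w\<close>, because a level \<open>k < 0\<close> is visited
  with probability \<open>r\<^sup>-\<^sup>2\<^sup>k\<close>, and as \<open>q f\<close> tends to \<open>1\<close> the bound tends to \<open>k\<^sub>r(w, w)\<close>. The point evaluation estimate
  at \<open>w\<close> becomes \<open>cmod (g w) \<le> cmod (f w)\<close>.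

  Conversely, let \<open>F\<close> be the outer function with the boundary modulus of \<open>f\<close>. It dominates \<open>f\<close> and has at most the
  norm of \<open>f\<close>, so \<open>F\<close> belongs to the set over which the supremum is taken. If \<open>f\<close> is free outer then \<open>f / F\<close> attains
  its maximal modulus \<open>1\<close> at \<open>w\<close> and is constant. The second part follows by the isometry \<open>f(z) \<mapsto> f(r / z)\<close>.\<close>

section \<open>Pairs of Hermitian forms inducing the same functional\<close>

text \<open>The functional fixes the inner products of x g with g for Laurent polynomials x, but not
  those of x g with y g, because multiplication by z is not isometric on the annulus space. So only
  cross terms with constants are known exactly, and the walk is arranged so that no others are
  needed: the constant term at the present level is split off by an identity, and the rest is handed
  to the two neighbouring levels by the row inequality. The up probability
  \<open>p = 1 / (1 + r^2)\<close> is the normalization of the row: with x =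
  \<open>l * cnj m\<close> the reciprocal of the kernel is (1 + r^2 - x - r^2 / x) / (1 - r^2). It
  gives a down step r^2 times the probability of an up step, the source of all factors
  \<open>r ^ (2 * k)\<close> below. In the converse direction radial limits are avoided: the
  boundary modulus is the almost everywhere limit of the moduli of a fast subsequence of the Taylor
  polynomials. For polynomials the bound by the Poisson integral of the logarithm comes from the
  maximum principle, and it survives the limit.\<close>

locale herm_form =
  fixes C :: "complex \<Rightarrow> 'a::comm_ring_1" and A :: "'a \<Rightarrow> 'a \<Rightarrow> complex"
  assumes C_add: "C (a + b) = C a + C b" and C_mult: "C (a * b) = C a * C b" and C_1: "C 1 = 1"
    and form_add: "A (x + y) w = A x w + A y w"
    and form_scale: "A (C c * x) w = c * A x w"
    and form_herm: "A w x = cnj (A x w)"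
    and form_pos: "0 \<le> Re (A x x)"
begin

definition q :: "'a \<Rightarrow> real" where "q x = Re (A x x)"

lemma form_add_right: "A w (x + y) = A w x + A w y"
  by (metis form_add form_herm complex_cnj_add)

lemma form_scale_right: "A w (C c * x) = cnj c * A w x"
  by (metis form_scale form_herm complex_cnj_mult)

lemma q_nonneg: "0 \<le> q x" by (simp add: q_def form_pos)

lemma Re_form_commute: "Re (A x y) = Re (A y x)"
  by (metis form_herm complex_cnj(1) complex.collapse cnj.simps(1))

lemma q_add: "q (x + y) = q x + q y + 2 * Re (A x y)"
  using Re_form_commute[of x y] by (simp add: q_def form_add form_add_right)

lemma form_self_real: "A x x = of_real (q x)"
  using form_herm[of x x] by (simp add: q_def complex_eq_iff)

lemma q_scale: "q (C c * x) = (cmod c)\<^sup>2 * q x"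
proof -
  have "A (C c * x) (C c * x) = (c * cnj c) * of_real (q x)"
    by (simp add: form_scale form_scale_right mult.assoc del: form_self_real) (simp add: form_self_real)
  also have "\<dots> = of_real ((cmod c)\<^sup>2 * q x)"
    by (simp only: of_real_mult complex_norm_square)
  finally show ?thesis by (simp add: q_def)
qed

lemma Cauchy_Schwarz: "(Re (A x y))\<^sup>2 \<le> q x * q y"
proof -
  have *: "0 \<le> q x + 2 * t * Re (A x y) + t\<^sup>2 * q y" for t :: real
  proof -
    have "0 \<le> q (x + C (of_real t) * y)" by (rule q_nonneg)
    also have "\<dots> = q x + 2 * t * Re (A x y) + t\<^sup>2 * q y"
      by (simp add: q_add q_scale form_scale_right)
    finally show ?thesis .
  qed
  show ?thesis
  proof (cases "q y = 0")
    case True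
    have "Re (A x y) = 0"
    proof (rule ccontr)
      assume "Re (A x y) \<noteq> 0"
      \<comment> \<open>This \<open>t\<close> makes the right-hand side of \<open>*\<close> equal to
        -1.\<close>
      then show False using *[of "- (q x + 1) / (2 * Re (A x y))"] True
        by (simp add: field_simps)
    qed
    then show ?thesis by (simp add: True)
  next
    case False
    then have pos: "q y > 0" using q_nonneg[of y] by simp
    have "0 \<le> (q x + 2 * (- Re (A x y) / q y) * Re (A x y) + (- Re (A x y) / q y)\<^sup>2 * q y) * q y"
      using *[of "- Re (A x y) / q y"] pos by simp
    also have "\<dots> = q x * q y - (Re (A x y))\<^sup>2"
      using pos by (simp add: field_simps power2_eq_square)
    finally show ?thesis by simp
  qed
qed

lemma Re_form_le: "\<bar>Re (A x y)\<bar> \<le> sqrt (q x) * sqrt (q y)"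
  using real_sqrt_le_mono[OF Cauchy_Schwarz[of x y]] by (simp add: real_sqrt_mult)

lemma sqrt_q_triangle: "sqrt (q (x + y)) \<le> sqrt (q x) + sqrt (q y)"
proof (rule real_le_lsqrt)
  show "q (x + y) \<le> (sqrt (q x) + sqrt (q y))\<^sup>2"
    using Re_form_le[of x y] by (simp add: q_add power2_sum q_nonneg)
qed (simp add: q_nonneg)

lemma C_0: "C 0 = 0"
  using C_add[of 0 0] by simp

lemma form_zero: "A 0 w = 0" "A w 0 = 0"
  using form_scale[of 0 0 w] form_herm[of w 0] by (simp_all add: C_0)

lemma q_0: "q 0 = 0"
  by (simp add: q_def form_zero)



end

text \<open>In the application \<open>A x y\<close> is the inner product of x g and y g in the
  annulus space, and \<open>M x y\<close> that of x f and y f in unweighted l2, where multiplication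
  by \<open>z\<close> is isometric. The hypothesis \<open>row\<close> is the row contraction with
  its entries rescaled by \<open>p\<close> and \<open>(1 - p) / r\<close>, which turns the bound
  into an average over the two steps of the walk.\<close>

locale form_pair = A: herm_form C A + M: herm_form C M
  for C :: "complex \<Rightarrow> 'a::comm_ring_1" and A M :: "'a \<Rightarrow> 'a \<Rightarrow> complex" +
  fixes z zi :: 'a and r p :: real
  assumes r: "0 < r" "r < 1" and p_def: "p = 1 / (1 + r\<^sup>2)"
    and zzi: "z * zi = 1"
    and M_shift: "M (z * x) (z * y) = M x y"
    and state_eq: "A x 1 = M x 1"
    and row: "A.q (C (of_real p) * z * u + C (of_real (1 - p)) * zi * v) \<le> p * A.q u + (1 - p) * A.q v"
    and z_contr: "A.q (z * x) \<le> A.q x"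
    and zi_bound: "r\<^sup>2 * A.q (zi * x) \<le> A.q x"
begin

text \<open>\<open>pol R\<close> consists of the polynomials in \<open>z\<close> whose coefficients have moduli summing to at
  most \<open>R\<close>.\<close>

inductive pol :: "real \<Rightarrow> 'a \<Rightarrow> bool" where
  pol_0: "0 \<le> R \<Longrightarrow> pol R 0"
| pol_Suc: "pol R \<eta> \<Longrightarrow> pol (R + cmod c) (C c + z * \<eta>)"

lemma pol_nonneg: "pol R \<eta> \<Longrightarrow> 0 \<le> R"
  by (induction rule: pol.induct) auto

lemma pol_mono: "pol R \<eta> \<Longrightarrow> R \<le> R' \<Longrightarrow> pol R' \<eta>"
proof (induction arbitrary: R' rule: pol.induct)
  case (pol_Suc R \<eta> c)
  then have "pol ((R' - cmod c) + cmod c) (C c + z * \<eta>)"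
    by (intro pol.pol_Suc) auto
  then show ?case by simp
qed (auto intro: pol.intros)

lemma pol_mult_z: "pol R \<eta> \<Longrightarrow> pol R (z * \<eta>)"
  using pol_Suc[of R \<eta> 0] by (simp add: A.C_0)

lemma pol_scale: "pol R \<eta> \<Longrightarrow> pol (cmod c * R) (C c * \<eta>)"
proof (induction rule: pol.induct)
  case (pol_Suc R \<eta> d)
  have "pol (cmod c * R + cmod (c * d)) (C (c * d) + z * (C c * \<eta>))"
    by (rule pol.pol_Suc) fact
  then show ?case by (simp add: A.C_mult algebra_simps norm_mult)
qed (auto intro: pol.intros)

lemma pol_add: "pol R \<eta> \<Longrightarrow> pol R' \<eta>' \<Longrightarrow> pol (R + R') (\<eta> + \<eta>')"
proof (induction arbitrary: R' \<eta>' rule: pol.induct)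
  case (pol_0 R)
  then show ?case by (auto elim: pol_mono)
next
  case (pol_Suc R \<eta> c)
  show ?case using pol_Suc.prems
  proof (cases rule: pol.cases)
    case pol_0
    then show ?thesis using pol.pol_Suc[OF pol_Suc.hyps, of c] by (auto elim: pol_mono)
  next
    case (pol_Suc R2 \<eta>2 c2)
    then have "pol ((R + R2) + cmod (c + c2)) (C (c + c2) + z * (\<eta> + \<eta>2))"
      using pol_Suc.IH by (intro pol.pol_Suc) auto
    then have "pol ((R + cmod c) + (R2 + cmod c2)) (C (c + c2) + z * (\<eta> + \<eta>2))"
      by (rule pol_mono) (use norm_triangle_ineq[of c c2] in simp)
    then show ?thesis using pol_Suc by (simp add: A.C_add algebra_simps)
  qed
qed

lemma M_q_z: "M.q (z * x) = M.q x"
  by (simp add: M.q_def M_shift)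

lemma M_shift_pow: "M (z ^ k * x) (z ^ k * y) = M x y"
  by (induction k) (simp_all add: M_shift mult.assoc)

lemma z_zi_pow: "z ^ k * zi ^ k = 1"
  by (metis power_mult_distrib zzi power_one)

lemma M_move: "M x (z ^ k * y) = M (zi ^ k * x) y"
proof -
  have "M x (z ^ k * y) = M (z ^ k * (zi ^ k * x)) (z ^ k * y)"
    by (simp add: z_zi_pow flip: mult.assoc)
  then show ?thesis by (simp add: M_shift_pow)
qed

lemma A_M_const: "A x (C c) = M x (C c)"
  using A.form_scale_right[of x c 1] M.form_scale_right[of x c 1] by (simp add: state_eq)

lemma A_M_q_const: "A.q (C c) = M.q (C c)"
  by (simp add: A.q_def M.q_def A_M_const)

text \<open>Peel off the constant coefficient: its cross term with the rest is the same for both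
  forms by \<open>state_eq\<close>, and multiplication by \<open>z\<close> contracts for
  \<open>A\<close> but is isometric for \<open>M\<close>. Cross terms between higher powers are
  never compared.\<close>

lemma pol_contr: "pol R \<eta> \<Longrightarrow> A.q \<eta> \<le> M.q \<eta>"
proof (induction rule: pol.induct)
  case (pol_Suc R \<eta> c)
  have "A.q (C c + z * \<eta>) = A.q (C c) + A.q (z * \<eta>) + 2 * Re (A (C c) (z * \<eta>))"
    by (rule A.q_add)
  also have "\<dots> \<le> M.q (C c) + M.q (z * \<eta>) + 2 * Re (M (C c) (z * \<eta>))"
    using z_contr[of \<eta>] pol_Suc.IH
    by (subst (1) A.Re_form_commute, subst (1) M.Re_form_commute) (simp add: A_M_const A_M_q_const M_q_z)
  finally show ?case by (simp add: M.q_add)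
qed (simp add: A.q_0 M.q_0)

lemma pol_M_bound: "pol R \<eta> \<Longrightarrow> sqrt (M.q \<eta>) \<le> R * sqrt (M.q 1)"
proof (induction rule: pol.induct)
  case (pol_Suc R \<eta> c)
  have "sqrt (M.q (C c + z * \<eta>)) \<le> sqrt (M.q (C c)) + sqrt (M.q (z * \<eta>))"
    by (rule M.sqrt_q_triangle)
  also have "\<dots> \<le> cmod c * sqrt (M.q 1) + R * sqrt (M.q 1)"
    using pol_Suc.IH M.q_scale[of c 1] by (simp add: M_q_z real_sqrt_mult)
  finally show ?case by (simp add: algebra_simps)
qed (simp add: M.q_0 M.q_nonneg)

text \<open>Consider the random walk on the integers with steps \<open>1\<close> and \<open>-1\<close> of probabilities \<open>p\<close> and
  \<open>1 - p\<close>, and Laurent polynomials \<open>X\<close> obtained by adding \<open>c z\<^sup>k\<close> at times at which the walk is at \<open>k\<close>.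
  The predicate is satisfied by the mean \<open>m\<close> and the expectation \<open>a\<close> of \<open>M X X\<close>; its right hand side is
  then the expectation of \<open>M (\<eta> + X) (\<eta> + X)\<close>. Polynomials \<open>\<eta>\<close> may be added at time \<open>0\<close> since
  the walk almost surely visits all positive integers.\<close>

definition adm :: "'a \<Rightarrow> real \<Rightarrow> bool" where
  "adm m a \<longleftrightarrow> (\<forall>R \<eta>. pol R \<eta> \<longrightarrow> A.q (\<eta> + m) \<le> M.q \<eta> + 2 * Re (M m \<eta>) + a)"

text \<open>The case of a walk that adds \<open>\<xi>\<close> at time 0 and nothing later.\<close>

lemma adm_pol: assumes "pol R \<xi>" shows "adm \<xi> (M.q \<xi>)"
  unfolding adm_def
proof (intro allI impI)
  fix R' \<eta> assume "pol R' \<eta>"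
  then have "A.q (\<eta> + \<xi>) \<le> M.q (\<eta> + \<xi>)" by (rule pol_contr[OF pol_add[OF _ assms]])
  then show "A.q (\<eta> + \<xi>) \<le> M.q \<eta> + 2 * Re (M \<xi> \<eta>) + M.q \<xi>"
    by (simp add: M.q_add M.Re_form_commute[of \<xi>])
qed

lemma adm_scale: assumes "adm m a" "c \<noteq> 0" shows "adm (C c * m) ((cmod c)\<^sup>2 * a)"
  unfolding adm_def
proof (intro allI impI)
  fix R \<eta> assume \<eta>: "pol R \<eta>"
  define \<eta>' where "\<eta>' = C (1 / c) * \<eta>"
  have eq: "\<eta> = C c * \<eta>'"
    using assms(2) A.C_mult[of c "1 / c"] by (simp add: \<eta>'_def A.C_1 flip: mult.assoc)
  have "A.q (\<eta> + C c * m) = (cmod c)\<^sup>2 * A.q (\<eta>' + m)"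
    by (simp add: eq A.q_scale flip: distrib_left)
  also have "\<dots> \<le> (cmod c)\<^sup>2 * (M.q \<eta>' + 2 * Re (M m \<eta>') + a)"
    using assms(1) pol_scale[OF \<eta>, of "1 / c"]
    by (intro mult_left_mono) (auto simp: adm_def \<eta>'_def)
  also have "\<dots> = M.q \<eta> + 2 * Re (M (C c * m) \<eta>) + (cmod c)\<^sup>2 * a"
  proof -
    have "M (C c * m) \<eta> = of_real ((cmod c)\<^sup>2) * M m \<eta>'"
      by (simp only: eq M.form_scale M.form_scale_right complex_norm_square mult.assoc)
        (simp only: mult.left_commute)
    then have "Re (M (C c * m) \<eta>) = (cmod c)\<^sup>2 * Re (M m \<eta>')" by simp
    then show ?thesis unfolding eq M.q_scale by (simp add: distrib_left)
  qed
  finally show "A.q (\<eta> + C c * m) \<le> M.q \<eta> + 2 * Re (M (C c * m) \<eta>) + (cmod c)\<^sup>2 * a" .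
qed

text \<open>The defect in the inequality of \<open>adm\<close> if the contribution \<open>m\<close> only arises once the walk has
  descended by \<open>k\<close>, which happens with probability \<open>r\<^sup>2\<^sup>k\<close>.\<close>

definition gap :: "'a \<Rightarrow> real \<Rightarrow> nat \<Rightarrow> 'a \<Rightarrow> real" where
  "gap m a k \<xi> = M.q \<xi> + 2 * r ^ (2 * k) * Re (M m (z ^ k * \<xi>)) + r ^ (2 * k) * a
     - A.q (\<xi> + C (of_real (r ^ (2 * k))) * (zi ^ k * m))"

lemma p_bounds: "0 < p" "p < 1" "p * r\<^sup>2 = 1 - p"
proof -
  have *: "1 < 1 + r\<^sup>2" using r by simp
  have **: "0 < 1 + r\<^sup>2" by (rule less_trans[OF zero_less_one *])
  from * ** show "0 < p" "p < 1" unfolding p_def by (simp_all only: divide_less_eq_1_pos zero_less_divide_1_iff)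
  from * have "1 + r\<^sup>2 \<noteq> 0" by linarith
  then show "p * r\<^sup>2 = 1 - p" unfolding p_def by (simp add: field_simps)
qed

text \<open>As a function of the distance k still to descend, \<open>r ^ (2 * k)\<close> is harmonic
  along the walk; a step up, of probability \<open>p\<close>, increases the distance.\<close>

lemma p_power: "p * r ^ (2 * Suc (Suc k)) + (1 - p) * r ^ (2 * k) = r ^ (2 * Suc k)"
proof -
  have "p * r ^ (2 * Suc (Suc k)) + (1 - p) * r ^ (2 * k) = r ^ (2 * k) * (p * r\<^sup>2 * r\<^sup>2 + (1 - p))"
    by (simp add: power2_eq_square algebra_simps)
  also have "p * r\<^sup>2 * r\<^sup>2 + (1 - p) = r\<^sup>2"
    by (simp add: p_bounds(3) flip: mult.assoc) (use p_bounds(3) in \<open>simp add: algebra_simps\<close>)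
  finally show ?thesis by (simp add: power2_eq_square)
qed

text \<open>One step of the walk. The constant \<open>c\<close> stays at the present level. The
  remainder \<open>z * \<Phi>\<close> is \<open>z\<close> times \<open>\<Phi>\<close> and also
  \<open>zi\<close> times \<open>z * (z * \<Phi>)\<close>, so it reads \<open>\<Phi>\<close> after a
  step up and \<open>z * (z * \<Phi>)\<close> after a step down. Averaging both readings lets
  \<open>row\<close> bound the norm of the average by the average of the norms.\<close>

lemma gap_superharmonic:
  "gap m a (Suc k) (C c + z * \<Phi>) \<ge> p * gap m a (Suc (Suc k)) \<Phi> + (1 - p) * gap m a k (z * (z * \<Phi>))"
proof -
  define R where "R k = C (of_real (r ^ (2 * k)))" for k
  define u where "u = \<Phi> + R (Suc (Suc k)) * (zi ^ Suc (Suc k) * m)"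
  define v where "v = z * (z * \<Phi>) + R k * (zi ^ k * m)"
  define x where "x = C (of_real p) * z * u + C (of_real (1 - p)) * zi * v"
  have CC: "C (of_real p) * z * \<Phi> + C (of_real (1 - p)) * zi * (z * (z * \<Phi>)) = z * \<Phi>"
  proof -
    have "C (of_real (1 - p)) * zi * (z * (z * \<Phi>)) = C (of_real (1 - p)) * (z * \<Phi>)"
      by (metis (no_types, lifting) mult.assoc mult.commute mult_1 zzi)
    moreover have "C (of_real p) + C (of_real (1 - p)) = 1"
      by (metis A.C_1 A.C_add add.commute diff_add_cancel of_real_1 of_real_add)
    ultimately show ?thesis by (metis (no_types, lifting) distrib_right mult.assoc mult_1)
  qed
  have RR: "C (of_real p) * z * (R (Suc (Suc k)) * (zi ^ Suc (Suc k) * m))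
        + C (of_real (1 - p)) * zi * (R k * (zi ^ k * m)) = R (Suc k) * (zi ^ Suc k * m)"
  proof -
    have 1: "z * zi ^ Suc (Suc k) = zi ^ Suc k"
      by (metis mult.assoc mult_1 power_Suc zzi)
    have "C (of_real p) * R (Suc (Suc k)) + C (of_real (1 - p)) * R k = R (Suc k)"
      unfolding R_def p_power[of k, symmetric] by (simp only: A.C_mult A.C_add of_real_add of_real_mult)
    moreover have "C (of_real p) * z * (R (Suc (Suc k)) * (zi ^ Suc (Suc k) * m))
        + C (of_real (1 - p)) * zi * (R k * (zi ^ k * m))
        = C (of_real p) * R (Suc (Suc k)) * (z * zi ^ Suc (Suc k)) * m
          + C (of_real (1 - p)) * R k * zi ^ Suc k * m"
      by (simp add: mult_ac)
    ultimately show ?thesis unfolding 1 by (metis (no_types, lifting) distrib_right mult.assoc)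
  qed
  have x_eq: "x = z * \<Phi> + R (Suc k) * (zi ^ Suc k * m)"
  proof -
    have "x = (C (of_real p) * z * \<Phi> + C (of_real (1 - p)) * zi * (z * (z * \<Phi>)))
      + (C (of_real p) * z * (R (Suc (Suc k)) * (zi ^ Suc (Suc k) * m))
        + C (of_real (1 - p)) * zi * (R k * (zi ^ k * m)))"
      by (simp only: x_def u_def v_def distrib_left add_ac)
    then show ?thesis by (simp only: CC RR)
  qed
  have row': "A.q x \<le> p * A.q u + (1 - p) * A.q v"
    unfolding x_def by (rule row)
  \<comment> \<open>The constant enters exactly, through \<open>A_M_const\<close> and
    \<open>A_M_q_const\<close>; the only inequality of this step is \<open>row'\<close>.\<close>
  have Aq: "A.q ((C c + z * \<Phi>) + R (Suc k) * (zi ^ Suc k * m)) = M.q (C c) + A.q x + 2 * Re (M x (C c))"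
  proof -
    have "(C c + z * \<Phi>) + R (Suc k) * (zi ^ Suc k * m) = x + C c"
      unfolding x_eq by (simp only: add_ac)
    then show ?thesis by (simp only: A.q_add A_M_const A_M_q_const)
  qed
  have Mx: "Re (M x (C c)) = Re (M (z * \<Phi>) (C c)) + r ^ (2 * Suc k) * Re (M m (z ^ Suc k * C c))"
    unfolding x_eq M.form_add R_def M.form_scale M_move by simp
  have Mq: "M.q (C c + z * \<Phi>) = M.q (C c) + M.q \<Phi> + 2 * Re (M (z * \<Phi>) (C c))"
    by (simp add: M.q_add M_q_z M.Re_form_commute[of "C c"])
  have Mm: "Re (M m (z ^ Suc k * (C c + z * \<Phi>))) = Re (M m (z ^ Suc k * C c)) + Re (M m (z ^ Suc (Suc k) * \<Phi>))"
    by (simp add: distrib_left M.form_add_right mult_ac)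
  have 3: "gap m a (Suc k) (C c + z * \<Phi>) =
      M.q \<Phi> + 2 * r ^ (2 * Suc k) * Re (M m (z ^ Suc (Suc k) * \<Phi>)) + r ^ (2 * Suc k) * a - A.q x"
    unfolding gap_def Mm Mq using Aq Mx unfolding R_def by (simp add: algebra_simps)
  have zz: "z ^ k * (z * (z * \<Phi>)) = z ^ Suc (Suc k) * \<Phi>"
    by (simp add: mult_ac)
  have g1: "gap m a (Suc (Suc k)) \<Phi> = M.q \<Phi> + r ^ (2 * Suc (Suc k)) * (2 * Re (M m (z ^ Suc (Suc k) * \<Phi>)) + a) - A.q u"
    by (simp only: gap_def u_def R_def) (simp add: algebra_simps)
  have g2: "gap m a k (z * (z * \<Phi>)) = M.q \<Phi> + r ^ (2 * k) * (2 * Re (M m (z ^ Suc (Suc k) * \<Phi>)) + a) - A.q v"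
    by (simp only: gap_def v_def R_def zz M_q_z) (simp add: algebra_simps)
  have "p * gap m a (Suc (Suc k)) \<Phi> + (1 - p) * gap m a k (z * (z * \<Phi>))
    = M.q \<Phi> + (p * r ^ (2 * Suc (Suc k)) + (1 - p) * r ^ (2 * k)) * (2 * Re (M m (z ^ Suc (Suc k) * \<Phi>)) + a)
       - (p * A.q u + (1 - p) * A.q v)"
    unfolding g1 g2 by (simp only: algebra_simps)
  also have "\<dots> \<le> gap m a (Suc k) (C c + z * \<Phi>)"
    unfolding p_power 3 using row' by (simp add: algebra_simps)
  finally show ?thesis .
qed

text \<open>At the first negative value the sequence has just decreased. Superharmonicity makes
  every decrease continue, so the sequence stays below a negative number, although its lower bound
  tends to 0.\<close>

lemma superharmonic_nonneg:
  fixes e :: "nat \<Rightarrow> real"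
  assumes e0: "0 \<le> e 0" and super: "\<And>k. p * e (Suc (Suc k)) + (1 - p) * e k \<le> e (Suc k)"
    and lower: "\<And>k. - K * r ^ k \<le> e k"
  shows "0 \<le> e k"
proof (rule ccontr)
  assume neg: "\<not> 0 \<le> e k"
  define j where "j = (LEAST j. e j < 0)"
  have j: "e j < 0" unfolding j_def using neg by (metis LeastI not_le)
  have min: "e i \<ge> 0" if "i < j" for i using not_less_Least[of i "\<lambda>j. e j < 0"] that by (simp add: j_def)
  obtain i where i: "j = Suc i" using j e0 by (cases j) auto
  have step: "e (Suc (Suc k)) < e (Suc k)" if "e (Suc k) < e k" for k
  proof -
    have "p * (e (Suc (Suc k)) - e (Suc k)) \<le> (1 - p) * (e (Suc k) - e k)"
      using super[of k] by (simp add: algebra_simps)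
    also have "\<dots> < 0" using p_bounds that by (simp add: mult_pos_neg)
    finally show ?thesis using p_bounds by (simp add: mult_less_0_iff)
  qed
  have dec: "e (Suc (i + n)) < e (i + n) \<and> e (Suc (i + n)) \<le> e j" for n
  proof (induction n)
    case 0
    then show ?case using min[of i] j i by auto
  next
    case (Suc n)
    then show ?case using step[of "i + n"] by auto
  qed
  have "(\<lambda>n. - K * r ^ (Suc (i + n))) \<longlonglongrightarrow> - K * 0"
  proof (intro tendsto_intros)
    have "(\<lambda>n. r ^ n) \<longlonglongrightarrow> 0" using r by (intro LIMSEQ_realpow_zero) auto
    from LIMSEQ_ignore_initial_segment[OF this, of "Suc i"]
    show "(\<lambda>n. r ^ (Suc (i + n))) \<longlonglongrightarrow> 0" by (simp add: add.commute)
  qed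
  moreover have "- K * r ^ (Suc (i + n)) \<le> e j" for n
    using lower[of "Suc (i + n)"] dec[of n] by linarith
  ultimately have "- K * 0 \<le> e j"
    by (intro LIMSEQ_le_const2) auto
  then show False using j by simp
qed

lemma A_q_z_pow: "A.q (zi ^ k * x) * r ^ (2 * k) \<le> A.q x"
proof (induction k)
  case (Suc k)
  have "A.q (zi ^ Suc k * x) * r ^ (2 * Suc k) = (r\<^sup>2 * A.q (zi * (zi ^ k * x))) * r ^ (2 * k)"
    by (simp add: mult_ac power2_eq_square)
  also have "\<dots> \<le> A.q (zi ^ k * x) * r ^ (2 * k)"
    using r by (intro mult_right_mono zi_bound) auto
  finally show ?case using Suc by simp
qed simp

lemma adm_gap_0: assumes "adm m a" "pol R \<xi>" shows "0 \<le> gap m a 0 \<xi>"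
  using assms A.C_1 by (auto simp: adm_def gap_def)

text \<open>Apart from its two cross terms \<open>gap\<close> is nonnegative: by
  \<open>pol_contr\<close>, and since \<open>adm\<close> with \<open>\<eta> = 0\<close> gives
  \<open>A.q m \<le> a\<close>. In the cross term of \<open>A\<close> one factor
  \<open>r ^ k\<close> compensates the growth of \<open>zi ^ k\<close>, and the other one is the
  decay in the statement.\<close>

lemma gap_lower:
  assumes "adm m a" "pol R \<xi>"
  shows "- (2 * sqrt (M.q m) * (R * sqrt (M.q 1)) + 2 * sqrt (A.q m) * (R * sqrt (M.q 1))) * r ^ k \<le> gap m a k \<xi>"
proof -
  define w where "w = C (of_real (r ^ k)) * (zi ^ k * m)"
  have rk: "0 \<le> r ^ k" "r ^ (2 * k) = r ^ k * r ^ k" "r ^ k \<le> 1" using r by (auto simp: power_mult_distrib power_add mult_2 power_le_one)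
  have w: "A.q w \<le> A.q m"
    using A_q_z_pow[of k m] r unfolding w_def A.q_scale
    by (simp add: norm_power mult_ac flip: power_even_eq power_mult)
  have a: "A.q m \<le> a"
    using assms(1) pol_0[of 0] by (force simp: adm_def M.q_0 M.form_zero)
  have "C (of_real (r ^ (2 * k))) * (zi ^ k * m) = C (of_real (r ^ k)) * w"
    unfolding w_def rk(2) of_real_mult A.C_mult by (simp only: mult.assoc)
  then have 1: "A.q (\<xi> + C (of_real (r ^ (2 * k))) * (zi ^ k * m))
     = A.q \<xi> + (r ^ (2 * k)) * A.q w + 2 * r ^ k * Re (A \<xi> w)"
    using r by (simp add: A.q_add A.q_scale A.form_scale_right norm_power power_mult power2_eq_square power_mult_distrib)
  have 2: "r ^ (2 * k) * A.q w \<le> r ^ (2 * k) * a"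
    using w a r by (intro mult_left_mono) auto
  have 3: "Re (A \<xi> w) \<le> R * sqrt (M.q 1) * sqrt (A.q m)"
  proof -
    have "Re (A \<xi> w) \<le> sqrt (A.q \<xi>) * sqrt (A.q w)" using A.Re_form_le[of \<xi> w] by linarith
    also have "\<dots> \<le> R * sqrt (M.q 1) * sqrt (A.q m)"
      using pol_contr[OF assms(2)] pol_M_bound[OF assms(2)] w
      using pol_nonneg[OF assms(2)]
      by (intro mult_mono) (auto simp: A.q_nonneg M.q_nonneg intro: order.trans[OF real_sqrt_le_mono])
    finally show ?thesis .
  qed
  have 4: "- (sqrt (M.q m) * (R * sqrt (M.q 1))) \<le> Re (M m (z ^ k * \<xi>))"
  proof -
    have "\<bar>Re (M m (z ^ k * \<xi>))\<bar> \<le> sqrt (M.q m) * sqrt (M.q (z ^ k * \<xi>))" by (rule M.Re_form_le)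
    also have "M.q (z ^ k * \<xi>) = M.q \<xi>" by (simp add: M.q_def M_shift_pow)
    also have "sqrt (M.q m) * sqrt (M.q \<xi>) \<le> sqrt (M.q m) * (R * sqrt (M.q 1))"
      using pol_M_bound[OF assms(2)] by (intro mult_left_mono) (auto simp: M.q_nonneg)
    finally show ?thesis by linarith
  qed
  have 5: "- (r ^ k * (sqrt (M.q m) * (R * sqrt (M.q 1)))) \<le> r ^ (2 * k) * Re (M m (z ^ k * \<xi>))"
  proof -
    have nn: "0 \<le> sqrt (M.q m) * (R * sqrt (M.q 1))"
      using pol_nonneg[OF assms(2)] by (simp add: M.q_nonneg)
    have "r ^ (2 * k) * (sqrt (M.q m) * (R * sqrt (M.q 1))) \<le> r ^ k * (sqrt (M.q m) * (R * sqrt (M.q 1)))"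
      using rk nn by (intro mult_right_mono) (auto simp: mult_left_le)
    moreover have "r ^ (2 * k) * - (sqrt (M.q m) * (R * sqrt (M.q 1))) \<le> r ^ (2 * k) * Re (M m (z ^ k * \<xi>))"
      using 4 r by (intro mult_left_mono) auto
    ultimately show ?thesis by simp
  qed
  have 6: "r ^ k * Re (A \<xi> w) \<le> r ^ k * (R * sqrt (M.q 1) * sqrt (A.q m))"
    using 3 rk by (intro mult_left_mono) auto
  show ?thesis
    using 2 5 6 pol_contr[OF assms(2)] unfolding gap_def 1 by (simp add: algebra_simps)
qed

lemma gap_nonneg: assumes adm: "adm m a" and "pol R \<xi>" shows "0 \<le> gap m a k \<xi>"
proof -
  define K where "K = 2 * sqrt (M.q m) * (R * sqrt (M.q 1)) + 2 * sqrt (A.q m) * (R * sqrt (M.q 1))"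
  \<comment> \<open>A step replaces \<open>\<xi>\<close> by other polynomials, so positivity is
    shown for the infimum over all of \<open>pol R\<close>. The class contains both
    \<open>\<Phi>\<close> and \<open>z * (z * \<Phi>)\<close> along with \<open>\<xi>\<close>, which
    makes the infima superharmonic in \<open>k\<close>.\<close>
  define e where "e k = (INF \<xi>\<in>Collect (pol R). gap m a k \<xi>)" for k
  have R: "0 \<le> R" using assms(2) by (rule pol_nonneg)
  have lower: "- K * r ^ k \<le> gap m a k \<xi>" if "pol R \<xi>" for k \<xi>
    using gap_lower[OF adm that, of k] by (simp add: K_def)
  then have bdd: "bdd_below (gap m a k ` Collect (pol R))" for k
    by (intro bdd_belowI2[of _ "- K * r ^ k"]) auto
  have ne: "Collect (pol R) \<noteq> {}" using assms(2) by auto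
  have e_le: "e k \<le> gap m a k \<xi>" if "pol R \<xi>" for k \<xi>
    unfolding e_def using that by (intro cINF_lower bdd) auto
  have "0 \<le> e k"
  proof (rule superharmonic_nonneg)
    show "0 \<le> e 0" unfolding e_def using adm_gap_0[OF adm] by (intro cINF_greatest ne) auto
    show "- K * r ^ k \<le> e k" for k unfolding e_def using lower by (intro cINF_greatest ne) auto
    show "p * e (Suc (Suc k)) + (1 - p) * e k \<le> e (Suc k)" for k
      unfolding e_def[of "Suc k"]
    proof (intro cINF_greatest ne)
      fix \<xi> assume "\<xi> \<in> Collect (pol R)"
      then have "pol R \<xi>" by simp
      then obtain c \<Phi> where \<Phi>: "\<xi> = C c + z * \<Phi>" "pol R \<Phi>"
      proof (cases rule: pol.cases)
        case pol_0
        then show ?thesis using that[of 0 0] R by (simp add: A.C_0 pol.pol_0)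
      next
        case (pol_Suc R' \<eta> c)
        then show ?thesis using that[of c \<eta>] pol_mono[of R' \<eta> R] by simp
      qed
      have "p * e (Suc (Suc k)) + (1 - p) * e k
        \<le> p * gap m a (Suc (Suc k)) \<Phi> + (1 - p) * gap m a k (z * (z * \<Phi>))"
        using p_bounds \<Phi>(2) by (intro add_mono mult_left_mono e_le pol_mult_z) auto
      also have "\<dots> \<le> gap m a (Suc k) \<xi>" unfolding \<Phi>(1) by (rule gap_superharmonic)
      finally show "p * e (Suc (Suc k)) + (1 - p) * e k \<le> gap m a (Suc k) \<xi>" .
    qed
  qed
  also have "\<dots> \<le> gap m a k \<xi>" by (rule e_le) fact
  finally show ?thesis .
qed

text \<open>Add \<open>\<xi>\<close> at once and start the construction of \<open>m\<close> anew
  when the walk first descends by one level, an event of probability \<open>r^2\<close>. The case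
  \<open>k = 1\<close> of \<open>gap_nonneg\<close> is this claim.\<close>

lemma adm_step:
  assumes adm: "adm m a" and \<xi>: "pol R \<xi>"
  shows "adm (\<xi> + C (of_real (r\<^sup>2)) * (zi * m)) (M.q \<xi> + 2 * r\<^sup>2 * Re (M m (z * \<xi>)) + r\<^sup>2 * a)"
  unfolding adm_def
proof (intro allI impI)
  fix R' \<eta> assume \<eta>: "pol R' \<eta>"
  have "0 \<le> gap m a 1 (\<eta> + \<xi>)" by (rule gap_nonneg[OF adm pol_add[OF \<eta> \<xi>]])
  moreover have "Re (M (\<xi> + C (of_real (r\<^sup>2)) * (zi * m)) \<eta>) = Re (M \<xi> \<eta>) + r\<^sup>2 * Re (M m (z * \<eta>))"
    unfolding M.form_add M.form_scale using M_move[of m 1 \<eta>] by simp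
  ultimately show "A.q (\<eta> + (\<xi> + C (of_real (r\<^sup>2)) * (zi * m)))
      \<le> M.q \<eta> + 2 * Re (M (\<xi> + C (of_real (r\<^sup>2)) * (zi * m)) \<eta>)
        + (M.q \<xi> + 2 * r\<^sup>2 * Re (M m (z * \<xi>)) + r\<^sup>2 * a)"
    by (simp only: gap_def distrib_left M.form_add_right M.q_add M.Re_form_commute[of \<xi>]
        power_one_right mult_1_right plus_complex.simps add.assoc)
qed

end

context form_pair
begin

text \<open>With \<open>e = 1 / cnj w\<close> and \<open>d = cnj w\<close>, the element \<open>total_chain e d \<pi> n\<close> is \<open>\<pi>\<close> times a truncation of
  the Laurent series of the kernel \<open>k\<^sub>r\<close> at \<open>w\<close>.\<close>

fun lower_chain :: "complex \<Rightarrow> 'a \<Rightarrow> nat \<Rightarrow> 'a" where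
  "lower_chain e \<pi> 0 = \<pi>"
| "lower_chain e \<pi> (Suc j) = \<pi> + C (of_real (r\<^sup>2)) * (zi * (C e * lower_chain e \<pi> j))"

fun lower_bd :: "complex \<Rightarrow> 'a \<Rightarrow> nat \<Rightarrow> real" where
  "lower_bd e \<pi> 0 = M.q \<pi>"
| "lower_bd e \<pi> (Suc j) =
     M.q \<pi> + 2 * r\<^sup>2 * Re (M (C e * lower_chain e \<pi> j) (z * \<pi>)) + r\<^sup>2 * ((cmod e)\<^sup>2 * lower_bd e \<pi> j)"

text \<open>The counterpart for the levels from 0 upwards. No factor like \<open>r^2\<close>
  appears, because these levels are visited almost surely; the whole chain is a polynomial that can
  be added at time 0.\<close>

fun upper_chain :: "complex \<Rightarrow> 'a \<Rightarrow> nat \<Rightarrow> 'a" where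
  "upper_chain d \<pi> 0 = \<pi>"
| "upper_chain d \<pi> (Suc k) = \<pi> + C d * (z * upper_chain d \<pi> k)"

lemma pol_upper_chain: "pol R \<pi> \<Longrightarrow> \<exists>R'. pol R' (upper_chain d \<pi> k)"
  by (induction k) (auto intro!: pol_add pol_scale pol_mult_z)

lemma adm_lower_chain: "pol R \<pi> \<Longrightarrow> e \<noteq> 0 \<Longrightarrow> adm (lower_chain e \<pi> j) (lower_bd e \<pi> j)"
proof (induction j)
  case (Suc j)
  then show ?case using adm_step[OF adm_scale[of _ _ e]] by simp
qed (auto intro: adm_pol)

definition total_chain :: "complex \<Rightarrow> complex \<Rightarrow> 'a \<Rightarrow> nat \<Rightarrow> 'a" where
  "total_chain e d \<pi> n = upper_chain d \<pi> n + C (of_real (r\<^sup>2)) * (zi * (C e * lower_chain e \<pi> n))"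

definition total_bd :: "complex \<Rightarrow> complex \<Rightarrow> 'a \<Rightarrow> nat \<Rightarrow> real" where
  "total_bd e d \<pi> n = M.q (upper_chain d \<pi> n)
     + 2 * r\<^sup>2 * Re (M (C e * lower_chain e \<pi> n) (z * upper_chain d \<pi> n)) + r\<^sup>2 * ((cmod e)\<^sup>2 * lower_bd e \<pi> n)"

lemma A_total_chain_le:
  assumes "pol R \<pi>" "e \<noteq> 0"
  shows "A.q (total_chain e d \<pi> n) \<le> total_bd e d \<pi> n"
proof -
  obtain R' where "pol R' (upper_chain d \<pi> n)" using pol_upper_chain[OF assms(1)] by blast
  from adm_step[OF adm_scale[OF adm_lower_chain[OF assms] assms(2)] this]
  have "adm (total_chain e d \<pi> n) (total_bd e d \<pi> n)"
    unfolding total_chain_def total_bd_def .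
  then show ?thesis using pol_0[of 0] by (force simp: adm_def M.q_0 M.form_zero)
qed

text \<open>The limit is the bound for \<open>\<pi> = 1\<close> in \<open>L\<^sup>2\<close> of the circle with normalized arc length, where the
  powers of \<open>z\<close> are orthonormal.\<close>

context
  fixes \<pi> :: "nat \<Rightarrow> 'a"
  assumes lim_1: "(\<lambda>i. M.q (\<pi> i)) \<longlonglongrightarrow> 1"
    and lim_0: "\<And>k. (\<lambda>i. M (z ^ Suc k * \<pi> i) (\<pi> i)) \<longlonglongrightarrow> 0"
begin

lemma lim_0': "(\<lambda>i. M (\<pi> i) (z ^ Suc k * \<pi> i)) \<longlonglongrightarrow> 0"
  using tendsto_cnj[OF lim_0[of k]] by (subst M.form_herm) simp

text \<open>\<open>M_move\<close> trades a factor \<open>zi\<close> in the first argument for a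
  factor \<open>z\<close> in the second, so descending only raises the exponent and the limits
  always stay within those of \<open>lim_0'\<close>.\<close>

lemma lower_chain_lim: "(\<lambda>i. M (C e * lower_chain e (\<pi> i) j) (z ^ Suc l * \<pi> i)) \<longlonglongrightarrow> 0"
proof (induction j arbitrary: l)
  case 0
  show ?case using tendsto_mult_right_zero[OF lim_0', of e l] by (simp only: lower_chain.simps M.form_scale)
next
  case (Suc j)
  have "M (C e * lower_chain e (\<pi> i) (Suc j)) (z ^ Suc l * \<pi> i)
     = e * M (\<pi> i) (z ^ Suc l * \<pi> i)
       + e * (of_real (r\<^sup>2) * M (C e * lower_chain e (\<pi> i) j) (z ^ Suc (Suc l) * \<pi> i))" for i
  proof -
    have "z ^ Suc (Suc l) * \<pi> i = z ^ 1 * (z ^ Suc l * \<pi> i)" by (simp add: mult_ac)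
    then have "M (C e * lower_chain e (\<pi> i) j) (z ^ Suc (Suc l) * \<pi> i)
       = M (zi * (C e * lower_chain e (\<pi> i) j)) (z ^ Suc l * \<pi> i)"
      using M_move[of "C e * lower_chain e (\<pi> i) j" 1 "z ^ Suc l * \<pi> i"] by (simp only: power_one_right)
    then show ?thesis by (simp only: lower_chain.simps M.form_scale M.form_add distrib_left)
  qed
  moreover have "(\<lambda>i. e * M (\<pi> i) (z ^ Suc l * \<pi> i)
       + e * (of_real (r\<^sup>2) * M (C e * lower_chain e (\<pi> i) j) (z ^ Suc (Suc l) * \<pi> i)))
     \<longlonglongrightarrow> e * 0 + e * (of_real (r\<^sup>2) * 0)"
    by (intro tendsto_intros lim_0' Suc.IH)
  ultimately show ?case by simp
qed

lemma lower_bd_lim: "(\<lambda>i. lower_bd e (\<pi> i) j) \<longlonglongrightarrow> (\<Sum>i\<le>j. (r\<^sup>2 * (cmod e)\<^sup>2) ^ i)"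
proof (induction j)
  case 0
  show ?case using lim_1 by simp
next
  case (Suc j)
  have "(\<lambda>i. lower_bd e (\<pi> i) (Suc j)) \<longlonglongrightarrow>
     1 + 2 * r\<^sup>2 * Re 0 + r\<^sup>2 * ((cmod e)\<^sup>2 * (\<Sum>i\<le>j. (r\<^sup>2 * (cmod e)\<^sup>2) ^ i))"
    unfolding lower_bd.simps
    using lower_chain_lim[of e j 0] by (intro tendsto_intros lim_1 Suc.IH) simp
  also have "1 + 2 * r\<^sup>2 * Re 0 + r\<^sup>2 * ((cmod e)\<^sup>2 * (\<Sum>i\<le>j. (r\<^sup>2 * (cmod e)\<^sup>2) ^ i))
     = (\<Sum>i\<le>Suc j. (r\<^sup>2 * (cmod e)\<^sup>2) ^ i)"
    by (subst sum.atMost_Suc_shift) (simp add: sum_distrib_left mult_ac)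
  finally show ?case .
qed

lemma upper_chain_lim: "(\<lambda>i. M (z ^ Suc l * upper_chain d (\<pi> i) k) (\<pi> i)) \<longlonglongrightarrow> 0"
proof (induction k arbitrary: l)
  case 0
  show ?case using lim_0 by (simp only: upper_chain.simps)
next
  case (Suc k)
  have "M (z ^ Suc l * upper_chain d (\<pi> i) (Suc k)) (\<pi> i)
     = M (z ^ Suc l * \<pi> i) (\<pi> i) + d * M (z ^ Suc (Suc l) * upper_chain d (\<pi> i) k) (\<pi> i)" for i
  proof -
    have "z ^ Suc l * upper_chain d (\<pi> i) (Suc k)
       = z ^ Suc l * \<pi> i + C d * (z ^ Suc (Suc l) * upper_chain d (\<pi> i) k)"
      by (simp add: algebra_simps)
    then show ?thesis by (simp only: M.form_scale M.form_add)
  qed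
  moreover have "(\<lambda>i. M (z ^ Suc l * \<pi> i) (\<pi> i) + d * M (z ^ Suc (Suc l) * upper_chain d (\<pi> i) k) (\<pi> i))
     \<longlonglongrightarrow> 0 + d * 0"
    by (intro tendsto_intros lim_0 Suc.IH)
  ultimately show ?case by simp
qed

lemma upper_q_lim: "(\<lambda>i. M.q (upper_chain d (\<pi> i) k)) \<longlonglongrightarrow> (\<Sum>i\<le>k. ((cmod d)\<^sup>2) ^ i)"
proof (induction k)
  case 0
  show ?case using lim_1 by simp
next
  case (Suc k)
  have "M.q (upper_chain d (\<pi> i) (Suc k)) = M.q (\<pi> i) + (cmod d)\<^sup>2 * M.q (upper_chain d (\<pi> i) k)
     + 2 * Re (d * M (z ^ Suc 0 * upper_chain d (\<pi> i) k) (\<pi> i))" for i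
    unfolding upper_chain.simps M.q_add M.q_scale M_q_z
    by (subst M.Re_form_commute) (simp add: M.form_scale)
  moreover have "(\<lambda>i. M.q (\<pi> i) + (cmod d)\<^sup>2 * M.q (upper_chain d (\<pi> i) k)
     + 2 * Re (d * M (z ^ Suc 0 * upper_chain d (\<pi> i) k) (\<pi> i)))
     \<longlonglongrightarrow> 1 + (cmod d)\<^sup>2 * (\<Sum>i\<le>k. ((cmod d)\<^sup>2) ^ i) + 2 * Re (d * 0)"
    by (intro tendsto_intros lim_1 Suc.IH upper_chain_lim)
  moreover have "1 + (cmod d)\<^sup>2 * (\<Sum>i\<le>k. ((cmod d)\<^sup>2) ^ i) + 2 * Re (d * 0) = (\<Sum>i\<le>Suc k. ((cmod d)\<^sup>2) ^ i)"
    by (subst sum.atMost_Suc_shift) (simp add: sum_distrib_left)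
  ultimately show ?case by simp
qed

lemma mixed_lim: "(\<lambda>i. M (C e * lower_chain e (\<pi> i) j) (z ^ Suc l * upper_chain d (\<pi> i) k)) \<longlonglongrightarrow> 0"
proof (induction k arbitrary: l)
  case 0
  show ?case using lower_chain_lim by (simp only: upper_chain.simps)
next
  case (Suc k)
  have "z ^ Suc l * upper_chain d (\<pi> i) (Suc k)
       = z ^ Suc l * \<pi> i + C d * (z ^ Suc (Suc l) * upper_chain d (\<pi> i) k)" for i
    by (simp add: algebra_simps)
  moreover have "(\<lambda>i. M (C e * lower_chain e (\<pi> i) j) (z ^ Suc l * \<pi> i)
      + cnj d * M (C e * lower_chain e (\<pi> i) j) (z ^ Suc (Suc l) * upper_chain d (\<pi> i) k))
     \<longlonglongrightarrow> 0 + cnj d * 0"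
    by (intro tendsto_intros lower_chain_lim Suc.IH)
  ultimately show ?case by (simp only: M.form_add_right M.form_scale_right) simp
qed

text \<open>For \<open>e = 1 / cnj w\<close> and \<open>d = cnj w\<close> the limit is a truncation
  of the kernel at \<open>(w, w)\<close>. The two parts do not interact, since by
  \<open>mixed_lim\<close> negative and nonnegative powers become orthogonal.\<close>

lemma total_bd_lim:
  "(\<lambda>i. total_bd e d (\<pi> i) n) \<longlonglongrightarrow>
     (\<Sum>i\<le>n. ((cmod d)\<^sup>2) ^ i) + r\<^sup>2 * (cmod e)\<^sup>2 * (\<Sum>i\<le>n. (r\<^sup>2 * (cmod e)\<^sup>2) ^ i)"
proof -
  have "(\<lambda>i. total_bd e d (\<pi> i) n) \<longlonglongrightarrow>
     (\<Sum>i\<le>n. ((cmod d)\<^sup>2) ^ i) + 2 * r\<^sup>2 * Re 0 + r\<^sup>2 * ((cmod e)\<^sup>2 * (\<Sum>i\<le>n. (r\<^sup>2 * (cmod e)\<^sup>2) ^ i))"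
    unfolding total_bd_def
    using mixed_lim[of e n 0 d n] by (intro tendsto_intros upper_q_lim lower_bd_lim) simp
  then show ?thesis by (simp add: mult.assoc)
qed

end

end

section \<open>Weighted square-summable sequences\<close>

definition wl2 :: "(int \<Rightarrow> real) \<Rightarrow> (int \<Rightarrow> complex) \<Rightarrow> bool" where
  "wl2 v b \<longleftrightarrow> (\<lambda>n. v n * (cmod (b n))\<^sup>2) summable_on UNIV"

definition wip :: "(int \<Rightarrow> real) \<Rightarrow> (int \<Rightarrow> complex) \<Rightarrow> (int \<Rightarrow> complex) \<Rightarrow> complex" where
  "wip v a b = (\<Sum>\<^sub>\<infinity>n. of_real (v n) * a n * cnj (b n))"

lemma mult_le_sum_squares:
  fixes x y :: real
  assumes "0 \<le> x" "0 \<le> y" shows "x * y \<le> x\<^sup>2 + y\<^sup>2"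
  using mult_nonneg_nonneg[OF assms] sum_squares_bound[of x y] by simp

lemma wip_summable:
  assumes "\<And>n. 0 \<le> v n" "wl2 v a" "wl2 v b"
  shows "(\<lambda>n. of_real (v n) * a n * cnj (b n)) summable_on UNIV"
proof -
  have "(\<lambda>n. v n * (cmod (a n))\<^sup>2 + v n * (cmod (b n))\<^sup>2) summable_on UNIV"
    using assms(2,3) unfolding wl2_def by (rule summable_on_add)
  moreover have "norm (of_real (v n) * a n * cnj (b n)) \<le> v n * (cmod (a n))\<^sup>2 + v n * (cmod (b n))\<^sup>2" for n
  proof -
    have "cmod (a n) * cmod (b n) \<le> (cmod (a n))\<^sup>2 + (cmod (b n))\<^sup>2"
      by (rule mult_le_sum_squares) auto
    from mult_left_mono[OF this assms(1)[of n]] show ?thesis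
      using assms(1)[of n] by (simp add: norm_mult distrib_left mult.assoc)
  qed
  ultimately have "(\<lambda>n. norm (of_real (v n) * a n * cnj (b n))) summable_on UNIV"
    by (rule summable_on_comparison_test) auto
  then show ?thesis by (rule abs_summable_summable)
qed

lemma wl2_add:
  assumes "\<And>n. 0 \<le> v n" "wl2 v a" "wl2 v b"
  shows "wl2 v (\<lambda>n. a n + b n)"
  unfolding wl2_def
proof (rule summable_on_comparison_test)
  show "(\<lambda>n. 2 * (v n * (cmod (a n))\<^sup>2) + 2 * (v n * (cmod (b n))\<^sup>2)) summable_on UNIV"
    using assms(2,3) unfolding wl2_def by (intro summable_on_add summable_on_cmult_right)
  show "v n * (cmod (a n + b n))\<^sup>2 \<le> 2 * (v n * (cmod (a n))\<^sup>2) + 2 * (v n * (cmod (b n))\<^sup>2)" for n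
  proof -
    have "(cmod (a n + b n))\<^sup>2 \<le> (cmod (a n) + cmod (b n))\<^sup>2"
      by (intro power_mono norm_triangle_ineq) auto
    also have "\<dots> \<le> 2 * (cmod (a n))\<^sup>2 + 2 * (cmod (b n))\<^sup>2"
      using sum_squares_bound[of "cmod (a n)" "cmod (b n)"] by (simp add: power2_sum)
    finally show ?thesis using mult_left_mono[OF _ assms(1)[of n]] by (fastforce simp: algebra_simps)
  qed
qed (use assms in auto)

lemma wl2_scale: "wl2 v a \<Longrightarrow> wl2 v (\<lambda>n. c * a n)"
  unfolding wl2_def
  using summable_on_cmult_right[of "\<lambda>n. v n * (cmod (a n))\<^sup>2" UNIV "(cmod c)\<^sup>2"]
  by (simp add: norm_mult power_mult_distrib mult_ac)

lemma wl2_zero: "wl2 v (\<lambda>n. 0)" by (simp add: wl2_def)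

lemma wl2_sum:
  assumes "\<And>n. 0 \<le> v n" "\<And>k. k \<in> K \<Longrightarrow> wl2 v (a k)"
  shows "wl2 v (\<lambda>n. \<Sum>k\<in>K. a k n)"
proof (cases "finite K")
  case True
  then show ?thesis using assms(2)
    by (induction K rule: finite_induct) (auto intro!: wl2_zero wl2_add assms(1))
qed (simp add: wl2_zero)

lemma wip_add:
  assumes "\<And>n. 0 \<le> v n" "wl2 v a" "wl2 v b" "wl2 v c"
  shows "wip v (\<lambda>n. a n + b n) c = wip v a c + wip v b c"
  unfolding wip_def
  unfolding distrib_left distrib_right
  by (rule infsum_add) (intro wip_summable assms)+

lemma wip_scale: "wip v (\<lambda>n. c * a n) b = c * wip v a b"
  unfolding wip_def by (subst infsum_cmult_right'[symmetric]) (simp add: mult_ac)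

lemma wip_cnj: "wip v a b = cnj (wip v b a)"
  unfolding wip_def by (subst infsum_cnj[symmetric]) (simp add: mult_ac)

lemma wip_self:
  assumes "wl2 v a"
  shows "wip v a a = of_real (\<Sum>\<^sub>\<infinity>n. v n * (cmod (a n))\<^sup>2)"
proof -
  have "((\<lambda>n. of_real (v n * (cmod (a n))\<^sup>2)) has_sum (of_real (\<Sum>\<^sub>\<infinity>n. v n * (cmod (a n))\<^sup>2) :: complex)) UNIV"
    using assms unfolding wl2_def by (intro has_sum_of_real has_sum_infsum)
  then show ?thesis unfolding wip_def
    by (intro infsumI) (simp only: of_real_mult complex_norm_square mult.assoc)
qed

lemma Re_wip_self: "wl2 v a \<Longrightarrow> Re (wip v a a) = (\<Sum>\<^sub>\<infinity>n. v n * (cmod (a n))\<^sup>2)"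
  by (simp add: wip_self)

locale shift_weight =
  fixes v :: "int \<Rightarrow> real" and K :: real
  assumes v_pos: "0 < v n" and v_up: "v (n + 1) \<le> K * v n" and v_down: "v n \<le> K * v (n + 1)"
begin

lemma v_nonneg: "0 \<le> v n" using v_pos[of n] by simp

lemma wl2_shift1: assumes "wl2 v b" shows "wl2 v (\<lambda>n. b (n - 1))" "wl2 v (\<lambda>n. b (n + 1))"
proof -
  have b1: "bij (\<lambda>n. n - 1 :: int)" "bij (\<lambda>n. n + 1 :: int)"
    by (rule bij_betwI[of _ _ _ "\<lambda>n. n + 1"], auto, rule bij_betwI[of _ _ _ "\<lambda>n. n - 1"], auto)
  have 1: "(\<lambda>n. K * (v (n - 1) * (cmod (b (n - 1)))\<^sup>2)) summable_on UNIV"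
    using assms summable_on_reindex_bij_betw[OF b1(1), of "\<lambda>n. v n * (cmod (b n))\<^sup>2"]
    unfolding wl2_def by (intro summable_on_cmult_right) auto
  show "wl2 v (\<lambda>n. b (n - 1))"
    unfolding wl2_def
  proof (rule summable_on_comparison_test[OF 1])
    show "v n * (cmod (b (n - 1)))\<^sup>2 \<le> K * (v (n - 1) * (cmod (b (n - 1)))\<^sup>2)" for n
      using mult_right_mono[OF v_up[of "n - 1"], of "(cmod (b (n - 1)))\<^sup>2"] by (simp add: mult.assoc)
  qed (auto simp: v_nonneg)
  have 2: "(\<lambda>n. K * (v (n + 1) * (cmod (b (n + 1)))\<^sup>2)) summable_on UNIV"
    using assms summable_on_reindex_bij_betw[OF b1(2), of "\<lambda>n. v n * (cmod (b n))\<^sup>2"]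
    unfolding wl2_def by (intro summable_on_cmult_right) auto
  show "wl2 v (\<lambda>n. b (n + 1))"
    unfolding wl2_def
  proof (rule summable_on_comparison_test[OF 2])
    show "v n * (cmod (b (n + 1)))\<^sup>2 \<le> K * (v (n + 1) * (cmod (b (n + 1)))\<^sup>2)" for n
      using mult_right_mono[OF v_down[of "n"], of "(cmod (b (n + 1)))\<^sup>2"] by (simp add: mult.assoc)
  qed (auto simp: v_nonneg)
qed

lemma wl2_shift: assumes "wl2 v b" shows "wl2 v (\<lambda>n. b (n - k))"
proof (induction k rule: int_induct[where k = 0])
  case base
  then show ?case using assms by simp
next
  case (step1 i)
  then show ?case using wl2_shift1(1)[OF step1(2)] by (simp add: algebra_simps)
next
  case (step2 i)
  then show ?case using wl2_shift1(2)[OF step2(2)] by (simp add: algebra_simps)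
qed

end

section \<open>Laurent polynomials acting on coefficient sequences\<close>

type_synonym lpoly = "int \<Rightarrow>\<^sub>0 complex"

abbreviation "lookup \<equiv> Poly_Mapping.lookup"
abbreviation "keys \<equiv> Poly_Mapping.keys"

text \<open>Convolution: if \<open>b\<close> holds the Laurent coefficients of g, then
  \<open>act x b\<close> holds those of x g.\<close>

definition act :: "lpoly \<Rightarrow> (int \<Rightarrow> complex) \<Rightarrow> int \<Rightarrow> complex" where
  "act x b n = (\<Sum>k\<in>keys x. lookup x k * b (n - k))"

lemma act_superset:
  assumes "finite F" "keys x \<subseteq> F"
  shows "act x b n = (\<Sum>k\<in>F. lookup x k * b (n - k))"
  unfolding act_def by (rule sum.mono_neutral_left) (use assms in \<open>auto simp: in_keys_iff\<close>)

lemma act_add: "act (x + y) b n = act x b n + act y b n"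
proof -
  have F: "finite (keys x \<union> keys y)" by simp
  show ?thesis
    by (subst (1 2 3) act_superset[OF F]) (auto simp: lookup_add sum.distrib algebra_simps dest: set_mp[OF keys_add])
qed

lemma act_zero: "act 0 b n = 0" by (simp add: act_def)

lemma act_single: "act (Poly_Mapping.single k c) b n = c * b (n - k)"
  by (cases "c = 0") (auto simp: act_def)

lemma lpoly_expand: fixes x :: lpoly shows "x = (\<Sum>k\<in>keys x. Poly_Mapping.single k (lookup x k))"
  by (rule poly_mapping_eqI) (auto simp: lookup_sum lookup_single when_def in_keys_iff)

lemma lpoly_induct [case_names zero single]:
  fixes x :: lpoly
  assumes "P 0" "\<And>k c y. P y \<Longrightarrow> P (Poly_Mapping.single k c + y)"
  shows "P x"
proof -
  have "P (\<Sum>k\<in>I. Poly_Mapping.single k (lookup x k))" if "finite I" for I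
    using that by (induction I rule: finite_induct) (auto intro: assms)
  then show ?thesis using lpoly_expand[of x] by (metis finite_keys)
qed

lemma act_single_mult: "act (Poly_Mapping.single k c * y) b n = c * act y b (n - k)"
  by (induction y rule: lpoly_induct) (auto simp: act_zero distrib_left act_add mult_single act_single algebra_simps)

lemma act_one: "act 1 b n = b n"
  using act_single[of 0 1] by simp

definition lform :: "(int \<Rightarrow> real) \<Rightarrow> (int \<Rightarrow> complex) \<Rightarrow> lpoly \<Rightarrow> lpoly \<Rightarrow> complex" where
  "lform v b x y = wip v (act x b) (act y b)"

context shift_weight
begin

lemma wl2_act: "wl2 v b \<Longrightarrow> wl2 v (act x b)"
  unfolding act_def[abs_def] by (intro wl2_sum wl2_scale wl2_shift v_nonneg)

lemma herm_form_lform: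
  assumes "wl2 v b"
  shows "herm_form (Poly_Mapping.single 0) (lform v b)"
proof
  fix x y w :: lpoly and c :: complex
  show "lform v b (x + y) w = lform v b x w + lform v b y w"
    unfolding lform_def act_add[abs_def] by (intro wip_add wl2_act assms v_nonneg)
  show "lform v b (Poly_Mapping.single 0 c * x) w = c * lform v b x w"
    by (simp add: lform_def act_single_mult[abs_def] wip_scale)
  show "lform v b w x = cnj (lform v b x w)"
    unfolding lform_def by (rule wip_cnj)
  show "0 \<le> Re (lform v b x x)"
    unfolding lform_def Re_wip_self[OF wl2_act[OF assms]] by (intro infsum_nonneg) (simp add: v_nonneg)
qed (auto simp: single_add mult_single)

end

section \<open>The weights of the annulus space and the row inequality\<close>

lemma weight_pos: "0 < r \<Longrightarrow> 0 < weight r n"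
  by (simp add: weight_def)

lemma weight_neg_step:
  assumes "0 < r" "n \<le> 0" shows "weight r n = r\<^sup>2 * weight r (n - 1)"
proof -
  have "r powi (2 * n) = r powi (2 + 2 * (n - 1))" by (simp add: algebra_simps)
  also have "\<dots> = r\<^sup>2 * r powi (2 * (n - 1))"
    using assms by (subst power_int_add) auto
  finally show ?thesis using assms by (auto simp: weight_def)
qed

lemma weight_antimono_step:
  assumes "0 < r" "r < 1" shows "weight r (n + 1) \<le> weight r n"
proof (cases "n < 0")
  case True
  have "weight r (n + 1) = r\<^sup>2 * weight r n"
    using weight_neg_step[of r "n + 1"] assms True by simp
  also have "\<dots> \<le> 1 * weight r n"
    using assms weight_pos[of r n] by (intro mult_right_mono) (auto simp: power_le_one)
  finally show ?thesis by simp
qed (simp add: weight_def)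

lemma weight_down_step:
  assumes "0 < r" "r < 1" shows "r\<^sup>2 * weight r n \<le> weight r (n + 1)"
proof (cases "n < 0")
  case True
  then show ?thesis using weight_neg_step[of r "n + 1"] assms by simp
next
  case False
  then show ?thesis using assms by (simp add: weight_def power_le_one)
qed

lemma shift_weight_weight:
  assumes "0 < r" "r < 1" shows "shift_weight (weight r) (1 / r\<^sup>2)"
proof
  fix n
  show "0 < weight r n" using assms(1) by (rule weight_pos)
  have "1 \<le> 1 / r\<^sup>2" using assms by (simp add: power_le_one)
  then have "1 * weight r n \<le> 1 / r\<^sup>2 * weight r n"
    using weight_pos[OF assms(1), of n] by (intro mult_right_mono) auto
  then show "weight r (n + 1) \<le> 1 / r\<^sup>2 * weight r n"
    using weight_antimono_step[OF assms, of n] by linarith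
  show "weight r n \<le> 1 / r\<^sup>2 * weight r (n + 1)"
    using weight_down_step[OF assms, of n] assms by (simp add: field_simps)
qed

lemma shift_weight_one: "shift_weight (\<lambda>_. 1) 1"
  by standard auto

text \<open>Cauchy-Schwarz in the form (p X + s Y)^2 \<le> (p / a + s / b) (p a X^2 + s b Y^2); the
  hypothesis \<open>le\<close> absorbs the first factor together with \<open>w\<close>.\<close>

lemma weighted_convex_square:
  fixes x y :: complex and p s a b w :: real
  assumes "0 \<le> p" "0 \<le> s" "0 < a" "0 < b" "0 \<le> w" and le: "p * (w / a) + s * (w / b) \<le> 1"
  shows "w * (cmod (of_real p * x + of_real s * y))\<^sup>2 \<le> p * (a * (cmod x)\<^sup>2) + s * (b * (cmod y)\<^sup>2)"
proof -
  define X Y where "X = cmod x" and "Y = cmod y"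
  have "cmod (of_real p * x + of_real s * y) \<le> p * X + s * Y"
    using norm_triangle_ineq[of "of_real p * x" "of_real s * y"] assms by (simp add: norm_mult X_def Y_def)
  then have "w * (cmod (of_real p * x + of_real s * y))\<^sup>2 \<le> w * (p * X + s * Y)\<^sup>2"
    using assms by (intro mult_left_mono power_mono) auto
  also have "(p * X + s * Y)\<^sup>2 \<le> (p / a + s / b) * (p * a * X\<^sup>2 + s * b * Y\<^sup>2)"
  proof -
    have "(p / a + s / b) * (p * a * X\<^sup>2 + s * b * Y\<^sup>2) - (p * X + s * Y)\<^sup>2
        = p * s / (a * b) * (a * X - b * Y)\<^sup>2"
      using assms by (simp add: field_simps power2_eq_square)
    also have "\<dots> \<ge> 0" using assms by simp
    finally show ?thesis by simp
  qed
  then have "w * (p * X + s * Y)\<^sup>2 \<le> w * ((p / a + s / b) * (p * a * X\<^sup>2 + s * b * Y\<^sup>2))"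
    using assms by (intro mult_left_mono) auto
  also have "\<dots> = (p * (w / a) + s * (w / b)) * (p * (a * X\<^sup>2) + s * (b * Y\<^sup>2))"
    by (simp add: field_simps)
  also have "\<dots> \<le> 1 * (p * (a * X\<^sup>2) + s * (b * Y\<^sup>2))"
    using assms le by (intro mult_right_mono) auto
  finally show ?thesis by (simp add: X_def Y_def)
qed

text \<open>The row contraction for a single coefficient. There is equality except at
  \<open>n = 0\<close>, where the two geometric branches of the weight meet; the defect (1 - r^2) /
  (1 + r^2) there is the constant by which 1 / k_r differs from the normalized row.\<close>

lemma weight_row:
  assumes r: "0 < r" "r < 1" and p: "p = 1 / (1 + r\<^sup>2)"
  shows "p * (weight r n / weight r (n - 1)) + (1 - p) * (weight r n / weight r (n + 1)) \<le> 1"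
proof -
  have r2: "0 < r\<^sup>2" "r\<^sup>2 < 1" using r by (auto simp: power_less_one_iff)
  then have pos: "1 + r\<^sup>2 > 0" by linarith
  have ne: "1 + r\<^sup>2 \<noteq> 0" using pos by linarith
  have p': "1 - p = p * r\<^sup>2" using ne by (simp add: p field_simps)
  have w: "weight r n > 0" for n using r by (intro weight_pos)
  consider "n < 0" | "n = 0" | "0 < n" by linarith
  then show ?thesis
  proof cases
    case 1
    have "weight r n / weight r (n - 1) = r\<^sup>2" using weight_neg_step[of r n] w[of "n - 1"] r 1 by simp
    moreover have "weight r n / weight r (n + 1) = 1 / r\<^sup>2"
      using weight_neg_step[of r "n + 1"] w[of n] r 1 by simp
    ultimately show ?thesis using p' r by simp
  next
    case 2
    have "weight r n / weight r (n - 1) = r\<^sup>2" using weight_neg_step[of r n] w[of "n - 1"] r 2 by simp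
    moreover have "weight r n / weight r (n + 1) = 1" using 2 by (simp add: weight_def)
    moreover have "p * r\<^sup>2 \<le> p * 1"
      using r2 pos by (intro mult_left_mono) (auto simp: p)
    ultimately show ?thesis by simp
  next
    case 3
    then show ?thesis using p' by (simp add: weight_def)
  qed
qed

lemma shift_bij: "bij (\<lambda>n. n - k :: int)" "bij (\<lambda>n. n + k :: int)"
  by (rule bij_betwI[of _ _ _ "\<lambda>n. n + k"], auto, rule bij_betwI[of _ _ _ "\<lambda>n. n - k"], auto)

lemma wip_one_shift: "wip (\<lambda>_. 1) (\<lambda>n. a (n - k)) (\<lambda>n. b (n - k)) = wip (\<lambda>_. 1) a b"
  unfolding wip_def
  using infsum_reindex_bij_betw[OF shift_bij(1), of "\<lambda>n. complex_of_real 1 * a n * cnj (b n)" k] by simp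

text \<open>The sequences \<open>a\<close> and \<open>b\<close> are the coefficients of \<open>f\<close> and of a member of \<open>Eset r f\<close>, tested
  against the multipliers \<open>z\<^sup>k\<close>.\<close>

locale same_state =
  fixes r :: real and a b :: "int \<Rightarrow> complex"
  assumes r: "0 < r" "r < 1"
    and a: "wl2 (\<lambda>_. 1) a" and a_neg: "\<And>n. n < 0 \<Longrightarrow> a n = 0"
    and b: "wl2 (weight r) b"
    and state: "\<And>k. wip (weight r) (\<lambda>n. b (n - k)) b = wip (\<lambda>_. 1) (\<lambda>n. a (n - k)) a"
begin

interpretation W: shift_weight "weight r" "1 / r\<^sup>2" using r by (rule shift_weight_weight)
interpretation O: shift_weight "\<lambda>_. 1" 1 by (rule shift_weight_one)

abbreviation "z \<equiv> Poly_Mapping.single (1::int) (1::complex)"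
abbreviation "zi \<equiv> Poly_Mapping.single (- 1::int) (1::complex)"
abbreviation "CC \<equiv> Poly_Mapping.single (0::int) :: complex \<Rightarrow> _"

lemma state': "lform (weight r) b x 1 = lform (\<lambda>_. 1) a x 1"
proof -
  interpret A: herm_form CC "lform (weight r) b" using b by (rule W.herm_form_lform)
  interpret M: herm_form CC "lform (\<lambda>_. 1) a" using a by (rule O.herm_form_lform)
  show ?thesis
  proof (induction x rule: lpoly_induct)
    case zero
    show ?case by (simp add: A.form_zero M.form_zero)
  next
    case (single k c y)
    have "lform (weight r) b (Poly_Mapping.single k c) 1 = lform (\<lambda>_. 1) a (Poly_Mapping.single k c) 1"
      using state[of k] by (simp add: lform_def act_single[abs_def] act_one[abs_def] wip_scale)
    then show ?case by (simp add: A.form_add M.form_add single)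
  qed
qed

lemma lform_q: "herm_form.q (lform (weight r) b) x = (\<Sum>\<^sub>\<infinity>n. weight r n * (cmod (act x b n))\<^sup>2)"
proof -
  interpret A: herm_form CC "lform (weight r) b" using b by (rule W.herm_form_lform)
  show ?thesis unfolding A.q_def lform_def by (rule Re_wip_self[OF W.wl2_act[OF b]])
qed

lemma act_summable: "(\<lambda>n. weight r n * (cmod (act x b n))\<^sup>2) summable_on UNIV"
  using W.wl2_act[OF b] by (simp add: wl2_def)

lemma shift_summable: "(\<lambda>n. weight r (n - k) * (cmod (act x b (n - k)))\<^sup>2) summable_on UNIV"
  using summable_on_reindex_bij_betw[OF shift_bij(1), of "\<lambda>n. weight r n * (cmod (act x b n))\<^sup>2" k] act_summable
  by simp

lemma infsum_shift: "(\<Sum>\<^sub>\<infinity>n. weight r (n - k) * (cmod (act x b (n - k)))\<^sup>2) = (\<Sum>\<^sub>\<infinity>n. weight r n * (cmod (act x b n))\<^sup>2)"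
  using infsum_reindex_bij_betw[OF shift_bij(1), of "\<lambda>n. weight r n * (cmod (act x b n))\<^sup>2" k] by simp

text \<open>Every condition is checked coefficient by coefficient: \<open>z\<close> contracts
  because the weights decrease, \<open>zi\<close> is bounded because neighbouring weights differ by
  at most \<open>r^2\<close>, and a coefficient in \<open>row\<close> involves just one coefficient
  of each of \<open>u\<close> and \<open>v\<close>.\<close>

sublocale form_pair CC "lform (weight r) b" "lform (\<lambda>_. 1) a" z zi r "1 / (1 + r\<^sup>2)"
proof -
  interpret A: herm_form CC "lform (weight r) b" using b by (rule W.herm_form_lform)
  interpret M: herm_form CC "lform (\<lambda>_. 1) a" using a by (rule O.herm_form_lform)
  define p where "p = 1 / (1 + r\<^sup>2)"
  have pos: "1 + r\<^sup>2 > 0" using r by (simp add: add_pos_pos)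
  have p: "0 \<le> p" "p \<le> 1" using pos r by (auto simp: p_def)
  show "form_pair CC (lform (weight r) b) (lform (\<lambda>_. 1) a) z zi r (1 / (1 + r\<^sup>2))"
  proof
    show "0 < r" "r < 1" using r by auto
    show "1 / (1 + r\<^sup>2) = 1 / (1 + r\<^sup>2)" ..
    show "z * zi = 1" by (simp add: mult_single)
    show "lform (\<lambda>_. 1) a (z * x) (z * y) = lform (\<lambda>_. 1) a x y" for x y
      unfolding lform_def act_single_mult[abs_def] by (simp add: wip_one_shift)
    show "lform (weight r) b x 1 = lform (\<lambda>_. 1) a x 1" for x by (rule state')
    show "A.q (z * x) \<le> A.q x" for x
      unfolding lform_q act_single_mult infsum_shift[of 1 x, symmetric] mult_1_left
    proof (intro infsum_mono)
      show "(\<lambda>n. weight r n * (cmod (act x b (n - 1)))\<^sup>2) summable_on UNIV"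
        using act_summable[of "z * x"] by (simp add: act_single_mult)
      show "weight r n * (cmod (act x b (n - 1)))\<^sup>2 \<le> weight r (n - 1) * (cmod (act x b (n - 1)))\<^sup>2" for n
        using weight_antimono_step[OF r, of "n - 1"] by (intro mult_right_mono) auto
    qed (rule shift_summable)
    show "r\<^sup>2 * A.q (zi * x) \<le> A.q x" for x
      unfolding lform_q act_single_mult infsum_shift[of "- 1" x, symmetric] mult_1_left infsum_cmult_right'[symmetric]
    proof (intro infsum_mono)
      show "(\<lambda>n. r\<^sup>2 * (weight r n * (cmod (act x b (n - - 1)))\<^sup>2)) summable_on UNIV"
        using act_summable[of "zi * x"] by (intro summable_on_cmult_right) (simp add: act_single_mult)
      show "r\<^sup>2 * (weight r n * (cmod (act x b (n - - 1)))\<^sup>2) \<le> weight r (n - - 1) * (cmod (act x b (n - - 1)))\<^sup>2" for n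
        using mult_right_mono[OF weight_down_step[OF r, of n], of "(cmod (act x b (n - - 1)))\<^sup>2"]
        by (simp add: mult.assoc)
    qed (rule shift_summable)
    show "A.q (CC (of_real (1 / (1 + r\<^sup>2))) * z * u + CC (of_real (1 - 1 / (1 + r\<^sup>2))) * zi * v)
      \<le> 1 / (1 + r\<^sup>2) * A.q u + (1 - 1 / (1 + r\<^sup>2)) * A.q v" for u v
    proof -
      have eq: "act (CC (of_real p) * z * u + CC (of_real (1 - p)) * zi * v) b n
        = of_real p * act u b (n - 1) + of_real (1 - p) * act v b (n - - 1)" for n
        by (simp add: act_add mult_single act_single_mult)
      have "A.q (CC (of_real p) * z * u + CC (of_real (1 - p)) * zi * v)
        \<le> (\<Sum>\<^sub>\<infinity>n. p * (weight r (n - 1) * (cmod (act u b (n - 1)))\<^sup>2)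
            + (1 - p) * (weight r (n - - 1) * (cmod (act v b (n - - 1)))\<^sup>2))"
        unfolding lform_q
      proof (rule infsum_mono)
        show "(\<lambda>n. weight r n * (cmod (act (CC (of_real p) * z * u + CC (of_real (1 - p)) * zi * v) b n))\<^sup>2) summable_on UNIV"
          by (rule act_summable)
        show "(\<lambda>n. p * (weight r (n - 1) * (cmod (act u b (n - 1)))\<^sup>2)
            + (1 - p) * (weight r (n - - 1) * (cmod (act v b (n - - 1)))\<^sup>2)) summable_on UNIV"
          by (intro summable_on_add summable_on_cmult_right shift_summable)
        show "weight r n * (cmod (act (CC (of_real p) * z * u + CC (of_real (1 - p)) * zi * v) b n))\<^sup>2
          \<le> p * (weight r (n - 1) * (cmod (act u b (n - 1)))\<^sup>2)
            + (1 - p) * (weight r (n - - 1) * (cmod (act v b (n - - 1)))\<^sup>2)" for n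
          unfolding eq using p weight_row[OF r p_def, of n] weight_pos[OF r(1)]
          by (intro weighted_convex_square) (auto intro: less_imp_le)
      qed
      also have "\<dots> = p * A.q u + (1 - p) * A.q v"
        unfolding lform_q
        by (subst infsum_add) (auto intro!: summable_on_cmult_right shift_summable
            simp only: infsum_cmult_right' infsum_shift UNIV_I)
      finally show ?thesis by (simp only: p_def)
    qed
  qed
qed

end

section \<open>Point evaluation and the kernel on the diagonal\<close>

definition ev :: "complex \<Rightarrow> lpoly \<Rightarrow> complex" where
  "ev w x = (\<Sum>k\<in>keys x. lookup x k * w powi k)"

lemma ev_act: "ev w x = act x (\<lambda>n. w powi (- n)) 0"
  by (simp add: ev_def act_def)

lemma ev_add: "ev w (x + y) = ev w x + ev w y"
  by (simp add: ev_act act_add)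

lemma ev_single: "ev w (Poly_Mapping.single k c) = c * w powi k"
  by (simp add: ev_act act_single)

lemma ev_zero: "ev w 0 = 0"
  by (simp add: ev_def)

lemma ev_single_mult:
  assumes "w \<noteq> 0" shows "ev w (Poly_Mapping.single k c * y) = c * w powi k * ev w y"
  by (induction y rule: lpoly_induct)
    (auto simp: ev_zero distrib_left ev_add mult_single ev_single power_int_add assms algebra_simps)

lemma has_sum_act:
  assumes "((\<lambda>n. b n * w powi n) has_sum g) UNIV" "w \<noteq> 0"
  shows "((\<lambda>n. act x b n * w powi n) has_sum (ev w x * g)) UNIV"
proof (induction x rule: lpoly_induct)
  case zero
  show ?case by (simp add: act_zero ev_zero)
next
  case (single k c y)
  have "((\<lambda>n. b (n - k) * w powi (n - k)) has_sum g) UNIV"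
    using has_sum_reindex_bij_betw[OF shift_bij(1), of "\<lambda>n. b n * w powi n" k g] assms(1) by simp
  from has_sum_cmult_right[OF this, of "c * w powi k"]
  have "((\<lambda>n. c * b (n - k) * w powi n) has_sum (c * w powi k * g)) UNIV"
    using assms(2) by (simp add: power_int_diff mult_ac)
  from has_sum_add[OF this single] show ?case
    by (simp add: act_add act_single ev_add ev_single algebra_simps)
qed

text \<open>Two geometric series, in \<open>\<rho>^2\<close> for the nonnegative powers and in
  \<open>r^2 / \<rho>^2\<close> for the negative ones. The sum is the kernel at
  \<open>(w, w)\<close> with \<open>cmod w = \<rho>\<close>, left as a sum of two fractions because
  the chains above produce it in this shape.\<close>

lemma kernel_has_sum:
  assumes "0 < r" "r < \<rho>" "\<rho> < 1"
  shows "((\<lambda>n. \<rho> powi (2 * n) / weight r n) has_sum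
     (1 / (1 - \<rho>\<^sup>2) + (r\<^sup>2 / \<rho>\<^sup>2) / (1 - r\<^sup>2 / \<rho>\<^sup>2))) UNIV"
proof -
  define x y where "x = \<rho>\<^sup>2" and "y = r\<^sup>2 / \<rho>\<^sup>2"
  have x: "0 \<le> x" "x < 1" using assms by (auto simp: x_def power_less_one_iff)
  have y: "0 \<le> y" "y < 1" using assms by (auto simp: y_def power_strict_mono)
  have 1: "((\<lambda>i. x ^ i) has_sum (1 / (1 - x))) UNIV"
    using x by (intro sums_nonneg_imp_has_sum geometric_sums) auto
  have 2: "((\<lambda>i. y * y ^ i) has_sum (y * (1 / (1 - y)))) UNIV"
    using y by (intro has_sum_cmult_right sums_nonneg_imp_has_sum geometric_sums) auto
  have "(((\<lambda>n. \<rho> powi (2 * n) / weight r n) \<circ> int) has_sum (1 / (1 - x))) UNIV"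
    using 1 by (rule has_sum_cong[THEN iffD1, rotated])
      (auto simp: weight_def x_def power_int_def nat_mult_distrib power_mult)
  then have A: "((\<lambda>n. \<rho> powi (2 * n) / weight r n) has_sum (1 / (1 - x))) (range int)"
    by (subst has_sum_reindex) auto
  have "(((\<lambda>n. \<rho> powi (2 * n) / weight r n) \<circ> (\<lambda>i. - int i - 1)) has_sum (y * (1 / (1 - y)))) UNIV"
    using 2
  proof (rule has_sum_cong[THEN iffD1, rotated])
    fix i :: nat
    have e: "2 * (- int i - 1) = - int (2 * Suc i)" by simp
    have "\<rho> powi (2 * (- int i - 1)) / weight r (- int i - 1)
      = inverse (\<rho> ^ (2 * Suc i)) / inverse (r ^ (2 * Suc i))"
      unfolding weight_def e power_int_minus power_int_of_nat by simp
    also have "\<dots> = y ^ Suc i" using assms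
      by (simp add: y_def power_divide power_mult divide_simps power2_eq_square)
    finally show "y * y ^ i = ((\<lambda>n. \<rho> powi (2 * n) / weight r n) \<circ> (\<lambda>i. - int i - 1)) i" by simp
  qed
  then have B: "((\<lambda>n. \<rho> powi (2 * n) / weight r n) has_sum (y * (1 / (1 - y)))) (range (\<lambda>i. - int i - 1))"
    by (subst has_sum_reindex) (auto simp: inj_on_def)
  have U: "range int \<union> range (\<lambda>i. - int i - 1) = UNIV"
  proof -
    have "n \<in> range int \<union> range (\<lambda>i. - int i - 1)" for n
    proof (cases "0 \<le> n")
      case True
      then have "n = int (nat n)" by simp
      then show ?thesis by blast
    next
      case False
      then have "n = - int (nat (- n - 1)) - 1" by simp
      then show ?thesis by blast
    qed
    then show ?thesis by blast
  qed
  show ?thesis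
    using has_sum_Un_disjoint[OF A B] unfolding U by (force simp: x_def y_def)
qed

text \<open>Cauchy-Schwarz with the weight split between the two factors, on finite sums first and
  then in the limit.\<close>

lemma point_evaluation_bound:
  assumes "0 < r" "r < cmod w" "cmod w < 1" "wl2 (weight r) c"
    and "((\<lambda>n. c n * w powi n) has_sum s) UNIV"
  shows "(cmod s)\<^sup>2 \<le> (1 / (1 - (cmod w)\<^sup>2) + (r\<^sup>2 / (cmod w)\<^sup>2) / (1 - r\<^sup>2 / (cmod w)\<^sup>2))
     * (\<Sum>\<^sub>\<infinity>n. weight r n * (cmod (c n))\<^sup>2)" (is "_ \<le> ?\<kappa> * ?N")
proof -
  have fin: "(cmod (\<Sum>n\<in>F. c n * w powi n))\<^sup>2 \<le> ?\<kappa> * ?N" if F: "finite F" for F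
  proof -
    have "cmod (\<Sum>n\<in>F. c n * w powi n) \<le> (\<Sum>n\<in>F. cmod (c n * w powi n))"
      by (rule norm_sum)
    also have "\<dots> = (\<Sum>n\<in>F. (cmod w powi n / sqrt (weight r n)) * (sqrt (weight r n) * cmod (c n)))"
      using weight_pos[OF assms(1)] by (intro sum.cong) (auto simp: norm_mult norm_power_int less_imp_neq[symmetric])
    finally have "(cmod (\<Sum>n\<in>F. c n * w powi n))\<^sup>2
      \<le> (\<Sum>n\<in>F. (cmod w powi n / sqrt (weight r n)) * (sqrt (weight r n) * cmod (c n)))\<^sup>2"
      by (intro power_mono) auto
    also have "\<dots> \<le> (\<Sum>n\<in>F. (cmod w powi n / sqrt (weight r n))\<^sup>2) * (\<Sum>n\<in>F. (sqrt (weight r n) * cmod (c n))\<^sup>2)"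
      by (rule Cauchy_Schwarz_ineq_sum)
    also have "(\<Sum>n\<in>F. (cmod w powi n / sqrt (weight r n))\<^sup>2) = (\<Sum>n\<in>F. cmod w powi (2 * n) / weight r n)"
      using weight_pos[OF assms(1)] by (intro sum.cong) (auto simp: power_divide power_int_mult less_imp_le power_int_power mult.commute)
    also have "(\<Sum>n\<in>F. (sqrt (weight r n) * cmod (c n))\<^sup>2) = (\<Sum>n\<in>F. weight r n * (cmod (c n))\<^sup>2)"
      using weight_pos[OF assms(1)] by (intro sum.cong) (auto simp: power_mult_distrib less_imp_le)
    also have "(\<Sum>n\<in>F. cmod w powi (2 * n) / weight r n) * (\<Sum>n\<in>F. weight r n * (cmod (c n))\<^sup>2) \<le> ?\<kappa> * ?N"
    proof (intro mult_mono)
      show "(\<Sum>n\<in>F. cmod w powi (2 * n) / weight r n) \<le> ?\<kappa>"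
        using kernel_has_sum[OF assms(1-3)] F weight_pos[OF assms(1)]
        by (intro finite_sum_le_has_sum) (auto intro!: divide_nonneg_pos)
      show "(\<Sum>n\<in>F. weight r n * (cmod (c n))\<^sup>2) \<le> ?N"
        using assms(4) F weight_pos[OF assms(1)] unfolding wl2_def
        by (intro finite_sum_le_infsum) (auto simp: less_imp_le)
      show "0 \<le> ?\<kappa>"
        by (rule has_sum_nonneg[OF kernel_has_sum[OF assms(1-3)]])
          (use weight_pos[OF assms(1)] in \<open>auto intro!: divide_nonneg_pos\<close>)
      show "0 \<le> (\<Sum>n\<in>F. weight r n * (cmod (c n))\<^sup>2)"
        using weight_pos[OF assms(1)] by (intro sum_nonneg) (auto simp: less_imp_le)
    qed
    finally show ?thesis .
  qed
  have "((\<lambda>F. (cmod (\<Sum>n\<in>F. c n * w powi n))\<^sup>2) \<longlongrightarrow> (cmod s)\<^sup>2) (finite_subsets_at_top UNIV)"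
    using assms(5) unfolding has_sum_def by (intro tendsto_intros)
  then show ?thesis
    by (rule tendsto_upperbound) (rule eventually_finite_subsets_at_top_weakI, erule fin, simp)
qed

context same_state
begin

lemma extremal:
  assumes w: "r < cmod w" "cmod w < 1"
    and g: "((\<lambda>n. b n * w powi n) has_sum g) UNIV"
    and pol: "\<And>i. \<exists>R. pol R (\<pi> i)"
    and lim_1: "(\<lambda>i. M.q (\<pi> i)) \<longlonglongrightarrow> 1"
    and lim_0: "\<And>k. (\<lambda>i. lform (\<lambda>_. 1) a (z ^ Suc k * \<pi> i) (\<pi> i)) \<longlonglongrightarrow> 0"
    and lim_ev: "(\<lambda>i. ev w (\<pi> i)) \<longlonglongrightarrow> 1 / f0" and f0: "f0 \<noteq> 0"
  shows "cmod g \<le> cmod f0"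
proof -
  have w0: "w \<noteq> 0" using w r by auto
  define x y where "x = (cmod w)\<^sup>2" and "y = r\<^sup>2 / (cmod w)\<^sup>2"
  define \<kappa> where "\<kappa> = 1 / (1 - x) + y / (1 - y)"
  define \<kappa>n where "\<kappa>n n = (\<Sum>i\<le>n. x ^ i) + y * (\<Sum>i\<le>n. y ^ i)" for n
  have x: "0 \<le> x" "x < 1" using w r by (auto simp: x_def power_less_one_iff)
  have "r\<^sup>2 < (cmod w)\<^sup>2" using w r by (intro power_strict_mono) auto
  then have y: "0 \<le> y" "y < 1" using w0 by (auto simp: y_def divide_less_eq)
  have \<kappa>n_pos: "0 < \<kappa>n n" for n
  proof -
    have "(\<Sum>i\<le>0. x ^ i) \<le> (\<Sum>i\<le>n. x ^ i)" using x by (intro sum_mono2) auto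
    then have "1 \<le> (\<Sum>i\<le>n. x ^ i)" by simp
    moreover have "0 \<le> y * (\<Sum>i\<le>n. y ^ i)" using y by (intro mult_nonneg_nonneg sum_nonneg) auto
    ultimately show ?thesis by (simp add: \<kappa>n_def)
  qed
  \<comment> \<open>With these values each further link of a chain multiplies the value at
    \<open>w\<close> by \<open>x\<close> in the upper part and by \<open>y\<close> in the lower
    part, so both parts become truncated geometric series.\<close>
  define e d where "e = 1 / cnj w" and "d = cnj w"
  have wx: "cnj w * w = of_real x" "(r\<^sup>2 * (cmod e)\<^sup>2) = y" "(cmod d)\<^sup>2 = x"
    "of_real (r\<^sup>2) * (1 / w) * e = of_real y"
  proof -
    have cw: "cnj w * w = of_real ((cmod w)\<^sup>2)" by (simp only: complex_norm_square mult.commute)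
    then show "cnj w * w = of_real x" by (simp add: x_def)
    show "r\<^sup>2 * (cmod e)\<^sup>2 = y" by (simp add: y_def e_def norm_divide power_divide)
    show "(cmod d)\<^sup>2 = x" by (simp add: d_def x_def)
    have "of_real (r\<^sup>2) * (1 / w) * e = of_real (r\<^sup>2) / (cnj w * w)" by (simp add: e_def)
    then show "of_real (r\<^sup>2) * (1 / w) * e = of_real y" unfolding cw y_def by simp
  qed
  have ev_lower: "ev w (lower_chain e p n) = of_real (\<Sum>i\<le>n. y ^ i) * ev w p" for p n
  proof (induction n)
    case (Suc n)
    have "ev w (lower_chain e p (Suc n)) = ev w p + (of_real (r\<^sup>2) * (1 / w) * e) * ev w (lower_chain e p n)"
      using w0 by (simp add: ev_add ev_single_mult power_int_minus divide_inverse mult_ac)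
    then show ?case unfolding wx Suc
      by (subst sum.atMost_Suc_shift) (simp add: sum_distrib_left distrib_right mult.assoc)
  qed simp
  have ev_upper: "ev w (upper_chain d p n) = of_real (\<Sum>i\<le>n. x ^ i) * ev w p" for p n
  proof (induction n)
    case (Suc n)
    have "ev w (upper_chain d p (Suc n)) = ev w p + (cnj w * w) * ev w (upper_chain d p n)"
      using w0 by (simp add: ev_add ev_single_mult d_def)
    then show ?case unfolding wx Suc
      by (subst sum.atMost_Suc_shift) (simp add: sum_distrib_left distrib_right mult.assoc)
  qed simp
  have ev_total: "ev w (total_chain e d p n) = of_real (\<kappa>n n) * ev w p" for p n
  proof -
    have "ev w (total_chain e d p n) = ev w (upper_chain d p n) + (of_real (r\<^sup>2) * (1 / w) * e) * ev w (lower_chain e p n)"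
      using w0 by (simp add: total_chain_def ev_add ev_single_mult power_int_minus divide_inverse mult_ac)
    then show ?thesis unfolding wx ev_lower ev_upper \<kappa>n_def by (simp add: algebra_simps)
  qed
  \<comment> \<open>The limit in \<open>i\<close> is taken with \<open>n\<close> fixed, since
    \<open>total_bd_lim\<close> concerns one \<open>n\<close> at a time. The left side is quadratic
    in \<open>\<kappa>n n\<close> and the right side linear, so one factor cancels; afterwards
    \<open>\<kappa>n n\<close> tends to \<open>\<kappa>\<close>.\<close>
  have \<kappa>: "\<kappa>n n * (cmod g)\<^sup>2 \<le> \<kappa> * (cmod f0)\<^sup>2" for n
  proof -
    have "(cmod (of_real (\<kappa>n n) * ev w (\<pi> i) * g))\<^sup>2 \<le> \<kappa> * total_bd e d (\<pi> i) n" for i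
    proof -
      obtain R where "pol R (\<pi> i)" using pol by blast
      have "((\<lambda>n. act (total_chain e d (\<pi> i) n') b n * w powi n) has_sum (of_real (\<kappa>n n') * ev w (\<pi> i) * g)) UNIV" for n'
        using has_sum_act[OF g w0, of "total_chain e d (\<pi> i) n'"] by (simp add: ev_total)
      from point_evaluation_bound[OF r(1) w _ this]
      have "(cmod (of_real (\<kappa>n n) * ev w (\<pi> i) * g))\<^sup>2 \<le> \<kappa> * A.q (total_chain e d (\<pi> i) n)"
        unfolding lform_q \<kappa>_def x_def y_def using act_summable by (simp add: wl2_def)
      also have "\<dots> \<le> \<kappa> * total_bd e d (\<pi> i) n"
        using \<open>pol R (\<pi> i)\<close> w0 x y unfolding \<kappa>_def
        by (intro mult_left_mono A_total_chain_le) (auto simp: e_def)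
      finally show ?thesis .
    qed
    moreover have "(\<lambda>i. (cmod (of_real (\<kappa>n n) * ev w (\<pi> i) * g))\<^sup>2) \<longlonglongrightarrow> (cmod (of_real (\<kappa>n n) * (1 / f0) * g))\<^sup>2"
      by (intro tendsto_intros lim_ev)
    moreover have "(\<lambda>i. \<kappa> * total_bd e d (\<pi> i) n) \<longlonglongrightarrow> \<kappa> * \<kappa>n n"
      using total_bd_lim[OF lim_1 lim_0, of e d n] unfolding wx \<kappa>n_def by (intro tendsto_intros) auto
    ultimately have "(cmod (of_real (\<kappa>n n) * (1 / f0) * g))\<^sup>2 \<le> \<kappa> * \<kappa>n n"
      by (intro LIMSEQ_le) auto
    then have "(\<kappa>n n * cmod g)\<^sup>2 \<le> (\<kappa> * (cmod f0)\<^sup>2) * \<kappa>n n"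
      using f0 \<kappa>n_pos[of n] by (simp add: norm_mult norm_divide power_divide power_mult_distrib field_simps)
    then have "(\<kappa>n n * (cmod g)\<^sup>2) * \<kappa>n n \<le> (\<kappa> * (cmod f0)\<^sup>2) * \<kappa>n n"
      by (simp add: power2_eq_square mult_ac)
    then show ?thesis using \<kappa>n_pos[of n] by (simp add: mult.commute)
  qed
  have "(\<lambda>n. \<kappa>n n) \<longlonglongrightarrow> \<kappa>"
  proof -
    have geo: "(\<lambda>n. \<Sum>i\<le>n. t ^ i) \<longlonglongrightarrow> 1 / (1 - t)" if "0 \<le> t" "t < 1" for t :: real
      using geometric_sums[of t] that by (simp add: sums_def_le)
    have "\<kappa> = 1 / (1 - x) + y * (1 / (1 - y))" by (simp add: \<kappa>_def)
    then show ?thesis unfolding \<kappa>n_def by (simp only:) (intro tendsto_intros geo x y)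
  qed
  then have "(\<lambda>n. \<kappa>n n * (cmod g)\<^sup>2) \<longlonglongrightarrow> \<kappa> * (cmod g)\<^sup>2" by (intro tendsto_intros)
  then have "\<kappa> * (cmod g)\<^sup>2 \<le> \<kappa> * (cmod f0)\<^sup>2"
    using \<kappa> by (intro LIMSEQ_le_const2) auto
  moreover have "0 < \<kappa>" using x y unfolding \<kappa>_def by (intro add_pos_nonneg) auto
  ultimately have "(cmod g)\<^sup>2 \<le> (cmod f0)\<^sup>2" by simp
  then show ?thesis by (simp add: power2_le_iff_abs_le)
qed

end

section \<open>Laurent series on circles\<close>

lemma cis_has_integral:
  "((\<lambda>t. cis (of_int k * t)) has_integral (if k = 0 then 2 * of_real pi else 0)) {0..2 * pi}"
proof (cases "k = 0")
  case True
  have "((\<lambda>t. cis (of_int k * t)) has_integral ((2 * pi) *\<^sub>R (1::complex))) {0..2 * pi}"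
    using has_integral_const_real[of "1::complex" 0 "2 * pi"] True by simp
  then show ?thesis using True by (simp add: scaleR_conv_of_real)
next
  case False
  have "((\<lambda>t. cis (of_int k * t)) has_integral
      (cis (of_int k * (2 * pi)) / (\<i> * of_int k) - cis (of_int k * 0) / (\<i> * of_int k))) {0..2 * pi}"
  proof (rule fundamental_theorem_of_calculus)
    fix t :: real
    have "((\<lambda>t. exp (\<i> * of_int k * t) / (\<i> * of_int k)) has_field_derivative
            exp (\<i> * of_int k * of_real t) * (\<i> * of_int k) / (\<i> * of_int k)) (at (of_real t))"
      by (auto intro!: derivative_eq_intros)
    then have "((\<lambda>t. exp (\<i> * of_int k * of_real t) / (\<i> * of_int k)) has_vector_derivative
            exp (\<i> * of_int k * of_real t)) (at t within {0..2 * pi})"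
      using False by (auto dest!: has_vector_derivative_real_field)
    then show "((\<lambda>t. cis (of_int k * t) / (\<i> * of_int k)) has_vector_derivative cis (of_int k * t)) (at t within {0..2 * pi})"
      by (simp add: cis_conv_exp mult.assoc)
  qed simp
  moreover have "cis (of_int k * (2 * pi)) = 1"
    using cis_multiple_2pi[of "of_int k"] by (simp add: mult.commute)
  ultimately show ?thesis using False by simp
qed

text \<open>Absolute summability makes both series converge uniformly along finite index sets, so
  the integral of the product is the limit of integrals of finite sums, where
  \<open>cis_has_integral\<close> gives orthogonality.\<close>

lemma fourier_parseval:
  fixes a b :: "int \<Rightarrow> complex"
  assumes a: "(\<lambda>n. norm (a n)) summable_on UNIV" and b: "(\<lambda>n. norm (b n)) summable_on UNIV"
    and A: "\<And>t. ((\<lambda>n. a n * cis (of_int n * t)) has_sum A t) UNIV"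
    and B: "\<And>t. ((\<lambda>n. b n * cis (of_int n * t)) has_sum B t) UNIV"
  shows "(\<lambda>t. A t * cnj (B t)) integrable_on {0..2 * pi}"
    and "((\<lambda>n. a n * cnj (b n)) has_sum (integral {0..2 * pi} (\<lambda>t. A t * cnj (B t)) / (2 * of_real pi))) UNIV"
proof -
  let ?T = "finite_subsets_at_top (UNIV :: int set)"
  have uA: "uniform_limit {0..2 * pi} (\<lambda>F t. \<Sum>n\<in>F. a n * cis (of_int n * t)) A ?T"
    by (rule Weierstrass_m_test_general'[OF _ A a]) (simp add: norm_mult)
  have uB: "uniform_limit {0..2 * pi} (\<lambda>F t. \<Sum>n\<in>F. b n * cis (of_int n * t)) B ?T"
    by (rule Weierstrass_m_test_general'[OF _ B b]) (simp add: norm_mult)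
  have bd: "bounded (X ` {0..2 * pi})" if "(\<lambda>n. norm (x n)) summable_on UNIV"
      "\<And>t. ((\<lambda>n. x n * cis (of_int n * t)) has_sum X t) UNIV" for x :: "int \<Rightarrow> complex" and X
  proof (rule boundedI)
    fix y assume "y \<in> X ` {0..2 * pi}"
    then obtain t where t: "y = X t" by auto
    show "norm y \<le> (\<Sum>\<^sub>\<infinity>n. norm (x n))" unfolding t
      using norm_has_sum_bound[of "\<lambda>n. x n * cis (of_int n * t)" UNIV "\<Sum>\<^sub>\<infinity>n. norm (x n)" "X t"] that
      by (simp add: norm_mult)
  qed
  have "bounded ((\<lambda>t. cnj (B t)) ` {0..2 * pi})"
    using bd[OF b B] by (auto simp: bounded_iff)
  then have u: "uniform_limit {0..2 * pi} (\<lambda>F t. (\<Sum>n\<in>F. a n * cis (of_int n * t)) * cnj (\<Sum>n\<in>F. b n * cis (of_int n * t)))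
      (\<lambda>t. A t * cnj (B t)) ?T"
    by (intro uniform_limit_intros uA uB bd[OF a A])
  have int: "((\<lambda>t. (\<Sum>n\<in>F. a n * cis (of_int n * t)) * cnj (\<Sum>n\<in>F. b n * cis (of_int n * t)))
      has_integral (2 * of_real pi * (\<Sum>n\<in>F. a n * cnj (b n)))) {0..2 * pi}" if "finite F" for F
  proof -
    have "((\<lambda>t. \<Sum>m\<in>F. \<Sum>n\<in>F. (a m * cnj (b n)) * cis (of_int (m - n) * t)) has_integral
       (\<Sum>m\<in>F. \<Sum>n\<in>F. (a m * cnj (b n)) * (if m - n = 0 then 2 * of_real pi else 0))) {0..2 * pi}"
      using that by (intro has_integral_sum has_integral_mult_right cis_has_integral) auto
    moreover have "(\<Sum>m\<in>F. \<Sum>n\<in>F. (a m * cnj (b n)) * cis (of_int (m - n) * t))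
        = (\<Sum>n\<in>F. a n * cis (of_int n * t)) * cnj (\<Sum>n\<in>F. b n * cis (of_int n * t))" for t
      by (simp add: sum_product cis_cnj cis_mult algebra_simps flip: cis_divide)
    moreover have "(\<Sum>m\<in>F. \<Sum>n\<in>F. (a m * cnj (b n)) * (if m - n = 0 then 2 * of_real pi else 0))
        = 2 * of_real pi * (\<Sum>n\<in>F. a n * cnj (b n))"
      using that by (simp add: if_distrib[of "\<lambda>x. _ * x"] sum.delta sum_distrib_left mult_ac cong: if_cong)
    ultimately show ?thesis by simp
  qed
  obtain I J where I: "\<And>F. ((\<lambda>t. (\<Sum>n\<in>F. a n * cis (of_int n * t)) * cnj (\<Sum>n\<in>F. b n * cis (of_int n * t)))
      has_integral I F) {0..2 * pi}"
    and J: "((\<lambda>t. A t * cnj (B t)) has_integral J) {0..2 * pi}" and IJ: "(I \<longlongrightarrow> J) ?T"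
    by (rule uniform_limit_integral[OF u]) (auto intro!: continuous_intros)
  show "(\<lambda>t. A t * cnj (B t)) integrable_on {0..2 * pi}" using J by blast
  have "((\<lambda>F. I F / (2 * of_real pi)) \<longlongrightarrow> J / (2 * of_real pi)) ?T"
    by (intro tendsto_intros IJ) auto
  moreover have "\<forall>\<^sub>F F in ?T. I F / (2 * of_real pi) = (\<Sum>n\<in>F. a n * cnj (b n))"
  proof (rule eventually_finite_subsets_at_top_weakI)
    fix F :: "int set" assume "finite F"
    then have "I F = 2 * of_real pi * (\<Sum>n\<in>F. a n * cnj (b n))"
      using has_integral_unique[OF I int] by blast
    then show "I F / (2 * of_real pi) = (\<Sum>n\<in>F. a n * cnj (b n))" by simp
  qed
  ultimately have "((\<lambda>F. \<Sum>n\<in>F. a n * cnj (b n)) \<longlongrightarrow> J / (2 * of_real pi)) ?T"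
    by (rule Lim_transform_eventually)
  then show "((\<lambda>n. a n * cnj (b n)) has_sum (integral {0..2 * pi} (\<lambda>t. A t * cnj (B t)) / (2 * of_real pi))) UNIV"
    unfolding has_sum_def using J by (simp add: integral_unique)
qed

definition laurent_on_circle :: "real \<Rightarrow> (complex \<Rightarrow> complex) \<Rightarrow> (int \<Rightarrow> complex) \<Rightarrow> bool" where
  "laurent_on_circle \<rho> f c \<longleftrightarrow> (\<forall>z. cmod z = \<rho> \<longrightarrow> ((\<lambda>n. c n * z powi n) has_sum f z) UNIV)"

lemma circle_parseval:
  assumes \<rho>: "0 < \<rho>" and c: "laurent_on_circle \<rho> f c" and d: "laurent_on_circle \<rho> g d"
  shows "(\<lambda>t. f (of_real \<rho> * cis t) * cnj (g (of_real \<rho> * cis t))) integrable_on {0..2 * pi}"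
    and "((\<lambda>n. c n * cnj (d n) * of_real (\<rho> powi (2 * n))) has_sum
      (integral {0..2 * pi} (\<lambda>t. f (of_real \<rho> * cis t) * cnj (g (of_real \<rho> * cis t))) / (2 * of_real pi))) UNIV"
proof -
  have *: "((\<lambda>n. (h n * of_real (\<rho> powi n)) * cis (of_int n * t)) has_sum F (of_real \<rho> * cis t)) UNIV"
    "(\<lambda>n. norm (h n * of_real (\<rho> powi n))) summable_on UNIV"
    if "laurent_on_circle \<rho> F h" for F h t
  proof -
    have "((\<lambda>n. h n * (of_real \<rho> * cis t) powi n) has_sum F (of_real \<rho> * cis t)) UNIV" for t
      using that \<rho> unfolding laurent_on_circle_def by (auto simp: norm_mult)
    then show 1: "((\<lambda>n. (h n * of_real (\<rho> powi n)) * cis (of_int n * t)) has_sum F (of_real \<rho> * cis t)) UNIV" for t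
      by (simp add: power_int_mult_distrib cis_power_int mult.assoc)
    \<comment> \<open>\<open>has_sum\<close> is unconditional convergence, hence absolute for
      complex terms, and the moduli of the terms do not depend on \<open>t\<close>; the single angle
      0 therefore suffices.\<close>
    from 1[of 0] show "(\<lambda>n. norm (h n * of_real (\<rho> powi n))) summable_on UNIV"
      by (simp add: summable_on_iff_abs_summable_on_complex[symmetric] has_sum_imp_summable)
  qed
  note P = fourier_parseval[OF *(2)[OF c] *(2)[OF d] *(1)[OF c] *(1)[OF d]]
  show "(\<lambda>t. f (of_real \<rho> * cis t) * cnj (g (of_real \<rho> * cis t))) integrable_on {0..2 * pi}"
    by (rule P(1))
  have "\<rho> powi (2 * n) = \<rho> powi n * \<rho> powi n" for n :: int
    by (simp add: mult.commute[of 2] power_int_mult power2_eq_square)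
  then show "((\<lambda>n. c n * cnj (d n) * of_real (\<rho> powi (2 * n))) has_sum
      (integral {0..2 * pi} (\<lambda>t. f (of_real \<rho> * cis t) * cnj (g (of_real \<rho> * cis t))) / (2 * of_real pi))) UNIV"
    using P(2) by (simp add: mult_ac)
qed

lemma circle_norm_parseval:
  assumes \<rho>: "0 < \<rho>" and c: "laurent_on_circle \<rho> f c"
  shows "(\<lambda>t. (cmod (f (of_real \<rho> * cis t)))\<^sup>2) integrable_on {0..2 * pi}"
    and "((\<lambda>n. (cmod (c n))\<^sup>2 * \<rho> powi (2 * n)) has_sum
      (integral {0..2 * pi} (\<lambda>t. (cmod (f (of_real \<rho> * cis t)))\<^sup>2) / (2 * pi))) UNIV"
proof -
  have eq: "f w * cnj (f w) = of_real ((cmod (f w))\<^sup>2)" for w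
    by (simp only: complex_norm_square)
  have "(\<lambda>t. (of_real ((cmod (f (of_real \<rho> * cis t)))\<^sup>2) :: complex)) integrable_on {0..2 * pi}"
    using circle_parseval(1)[OF \<rho> c c] unfolding eq .
  then have "(\<lambda>t. Re (of_real ((cmod (f (of_real \<rho> * cis t)))\<^sup>2))) integrable_on {0..2 * pi}"
    by (rule integrable_linear[OF _ bounded_linear_Re, unfolded o_def])
  then show int: "(\<lambda>t. (cmod (f (of_real \<rho> * cis t)))\<^sup>2) integrable_on {0..2 * pi}" by simp
  have "integral {0..2 * pi} (\<lambda>t. (of_real ((cmod (f (of_real \<rho> * cis t)))\<^sup>2) :: complex))
    = of_real (integral {0..2 * pi} (\<lambda>t. (cmod (f (of_real \<rho> * cis t)))\<^sup>2))"
    using integral_linear[OF int bounded_linear_of_real] by (simp add: o_def)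
  with circle_parseval(2)[OF \<rho> c c]
  have "((\<lambda>n. c n * cnj (c n) * of_real (\<rho> powi (2 * n))) has_sum
      (of_real (integral {0..2 * pi} (\<lambda>t. (cmod (f (of_real \<rho> * cis t)))\<^sup>2) / (2 * pi)))) UNIV"
    unfolding eq by simp
  moreover have "c n * cnj (c n) * of_real (\<rho> powi (2 * n)) = of_real ((cmod (c n))\<^sup>2 * \<rho> powi (2 * n))" for n
    by (simp only: complex_norm_square[symmetric] of_real_mult)
  ultimately show "((\<lambda>n. (cmod (c n))\<^sup>2 * \<rho> powi (2 * n)) has_sum
      (integral {0..2 * pi} (\<lambda>t. (cmod (f (of_real \<rho> * cis t)))\<^sup>2) / (2 * pi))) UNIV"
    by (simp only: has_sum_of_real_iff)
qed

text \<open>Parseval for the difference, which is a Laurent series of the zero function.\<close>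

lemma laurent_on_circle_unique:
  assumes \<rho>: "0 < \<rho>" and c: "laurent_on_circle \<rho> f c" and d: "laurent_on_circle \<rho> f d"
  shows "c = d"
proof
  fix n
  have "laurent_on_circle \<rho> (\<lambda>_. 0) (\<lambda>n. c n - d n)"
    unfolding laurent_on_circle_def
  proof (intro allI impI)
    fix z :: complex assume "cmod z = \<rho>"
    then show "((\<lambda>n. (c n - d n) * z powi n) has_sum 0) UNIV"
      using has_sum_add[of "\<lambda>n. c n * z powi n" UNIV "f z" "\<lambda>n. - (d n * z powi n)" "- f z"] c d
      by (simp add: laurent_on_circle_def left_diff_distrib has_sum_uminus)
  qed
  from circle_norm_parseval(2)[OF \<rho> this]
  have *: "((\<lambda>n. (cmod (c n - d n))\<^sup>2 * \<rho> powi (2 * n)) has_sum 0) UNIV" by simp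
  have "(cmod (c n - d n))\<^sup>2 * \<rho> powi (2 * n) = 0"
    by (rule nonneg_has_sum_le_0D[OF *]) (use \<rho> in auto)
  then show "c n = d n" using \<rho> by simp
qed

lemma is_laurent_circle: "is_laurent r f c \<Longrightarrow> r < \<rho> \<Longrightarrow> \<rho> < 1 \<Longrightarrow> laurent_on_circle \<rho> f c"
  by (auto simp: is_laurent_def laurent_on_circle_def annulus_def)

lemma laurent_coeffs_eq:
  assumes "0 < r" "r < 1" "is_laurent r f c" shows "laurent_coeffs r f = c"
  unfolding laurent_coeffs_def
proof (rule the_equality)
  obtain \<rho> where \<rho>: "r < \<rho>" "\<rho> < 1" using assms dense by blast
  show "d = c" if "is_laurent r f d" for d
    using that assms \<rho> by (intro laurent_on_circle_unique[of \<rho> f]) (auto intro: is_laurent_circle)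
qed fact

text \<open>Indexed by the integers, so that Taylor and Laurent coefficients can be compared and
  shifted as sequences of one type.\<close>

definition tay :: "(complex \<Rightarrow> complex) \<Rightarrow> int \<Rightarrow> complex" where
  "tay f n = (if n < 0 then 0 else (deriv ^^ nat n) f 0 / fact (nat n))"

lemma has_sum_int_nat:
  fixes h :: "int \<Rightarrow> 'a::{comm_monoid_add, topological_space}"
  assumes "\<And>n. n < 0 \<Longrightarrow> h n = 0"
  shows "(h has_sum s) UNIV \<longleftrightarrow> ((\<lambda>n. h (int n)) has_sum s) UNIV"
proof -
  have "(h has_sum s) UNIV \<longleftrightarrow> (h has_sum s) (range int)"
  proof (rule has_sum_cong_neutral)
    fix n :: int assume "n \<in> UNIV - range int"
    then have "n < 0" by (metis DiffD2 nonneg_int_cases not_less rangeI)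
    then show "h n = 0" by (rule assms)
  qed auto
  also have "\<dots> \<longleftrightarrow> ((h \<circ> int) has_sum s) UNIV"
    by (subst has_sum_reindex) auto
  finally show ?thesis by (simp add: o_def)
qed

lemma summable_on_int_nat:
  fixes h :: "int \<Rightarrow> 'a::{comm_monoid_add, topological_space}"
  assumes "\<And>n. n < 0 \<Longrightarrow> h n = 0"
  shows "h summable_on UNIV \<longleftrightarrow> (\<lambda>n. h (int n)) summable_on UNIV"
  unfolding summable_on_def using has_sum_int_nat[OF assms] by simp

lemma tay_neg: "n < 0 \<Longrightarrow> tay f n = 0"
  by (simp add: tay_def)

lemma tay_has_sum:
  assumes "f holomorphic_on ball 0 1" "cmod z < 1"
  shows "((\<lambda>n. tay f n * z powi n) has_sum f z) UNIV"
proof -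
  obtain \<rho> where \<rho>: "cmod z < \<rho>" "\<rho> < 1" using assms(2) dense by blast
  have s: "(\<lambda>n. (deriv ^^ n) f 0 / fact n * w ^ n) sums f w" if "cmod w < 1" for w
    using holomorphic_power_series[OF assms(1), of w] that by simp
  have "summable (\<lambda>n. norm ((deriv ^^ n) f 0 / fact n * z ^ n))"
  proof (rule powser_insidea)
    show "summable (\<lambda>n. (deriv ^^ n) f 0 / fact n * of_real \<rho> ^ n)"
      using s[of "of_real \<rho>"] \<rho> norm_ge_zero[of z] by (auto simp: sums_iff)
    show "norm z < norm (of_real \<rho> :: complex)" using \<rho> by simp
  qed
  then have "((\<lambda>n. (deriv ^^ n) f 0 / fact n * z ^ n) has_sum f z) UNIV"
    using s[OF assms(2)] by (rule norm_summable_imp_has_sum)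
  then show ?thesis
    by (subst has_sum_int_nat) (auto simp: tay_def)
qed

lemma hardy_disk_iff: "f \<in> hardy_disk \<longleftrightarrow> f holomorphic_on ball 0 1 \<and> wl2 (\<lambda>_. 1) (tay f)"
proof -
  have "wl2 (\<lambda>_. 1) (tay f) \<longleftrightarrow> (\<lambda>n. (cmod ((deriv ^^ n) f 0 / fact n))\<^sup>2) summable_on UNIV"
    unfolding wl2_def by (subst summable_on_int_nat) (auto simp: tay_def)
  also have "\<dots> \<longleftrightarrow> summable (\<lambda>n. (cmod ((deriv ^^ n) f 0 / fact n))\<^sup>2)"
    by (rule summable_on_UNIV_nonneg_real_iff) simp
  finally show ?thesis by (simp add: hardy_disk_def)
qed

lemma tay_circle:
  assumes "f holomorphic_on ball 0 1" "\<rho> < 1"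
  shows "laurent_on_circle \<rho> f (tay f)"
  using assms tay_has_sum by (auto simp: laurent_on_circle_def)

lemma tay_laurent: "f holomorphic_on ball 0 1 \<Longrightarrow> is_laurent r f (tay f)"
  by (auto simp: is_laurent_def annulus_def tay_has_sum)

lemma tay_unique:
  assumes "f holomorphic_on ball 0 1" "0 < \<rho>" "\<rho> < 1" "laurent_on_circle \<rho> f c"
  shows "tay f = c"
  using laurent_on_circle_unique[OF assms(2) tay_circle assms(4)] assms by blast

section \<open>The annulus space, its multipliers and the set over which the supremum is
  taken\<close>

context
  fixes r :: real assumes r: "0 < r" "r < 1"
begin

lemma H2D:
  assumes "f \<in> H2_annulus r"
  shows "is_laurent r f (laurent_coeffs r f)" "wl2 (weight r) (laurent_coeffs r f)" "f holomorphic_on annulus r"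
  using assms laurent_coeffs_eq[OF r] unfolding H2_annulus_def wl2_def by auto

lemma H2I:
  assumes "f holomorphic_on annulus r" "is_laurent r f c" "wl2 (weight r) c"
  shows "f \<in> H2_annulus r"
  using assms unfolding H2_annulus_def wl2_def by auto

lemma H2_inner_eq: "H2_inner r f g = wip (weight r) (laurent_coeffs r f) (laurent_coeffs r g)"
  by (simp add: H2_inner_def wip_def)

lemma is_laurent_shift:
  assumes "is_laurent r f c" shows "is_laurent r (\<lambda>z. z powi k * f z) (\<lambda>n. c (n - k))"
  unfolding is_laurent_def
proof
  fix z assume z: "z \<in> annulus r"
  then have z0: "z \<noteq> 0" using r by (auto simp: annulus_def)
  from has_sum_act[OF _ z0, of c "f z" "Poly_Mapping.single k 1"]
  show "((\<lambda>n. c (n - k) * z powi n) has_sum z powi k * f z) UNIV"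
    using assms z by (simp add: act_single ev_single is_laurent_def)
qed

lemma H2_shift:
  assumes "f \<in> H2_annulus r" shows "(\<lambda>z. z powi k * f z) \<in> H2_annulus r"
proof (rule H2I)
  show "(\<lambda>z. z powi k * f z) holomorphic_on annulus r"
    using H2D(3)[OF assms] r by (intro holomorphic_intros) (auto simp: annulus_def)
  show "is_laurent r (\<lambda>z. z powi k * f z) (\<lambda>n. laurent_coeffs r f (n - k))"
    using H2D(1)[OF assms] by (rule is_laurent_shift)
  show "wl2 (weight r) (\<lambda>n. laurent_coeffs r f (n - k))"
    by (rule shift_weight.wl2_shift[OF shift_weight_weight[OF r] H2D(2)[OF assms]])
qed

lemma powi_Mult: "(\<lambda>z. z powi k) \<in> Mult r"
  unfolding Mult_def using H2_shift by auto

lemma Pfun_powi: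
  assumes "f \<in> H2_annulus r"
  shows "Pfun r f (\<lambda>z. z powi k) = wip (weight r) (\<lambda>n. laurent_coeffs r f (n - k)) (laurent_coeffs r f)"
  unfolding Pfun_def H2_inner_eq
  using laurent_coeffs_eq[OF r is_laurent_shift[OF H2D(1)[OF assms]]] by simp

lemma hardy_disk_H2:
  assumes "f \<in> hardy_disk"
  shows "f \<in> H2_annulus r" "laurent_coeffs r f = tay f"
proof -
  have hol: "f holomorphic_on ball 0 1" and l2: "wl2 (\<lambda>_. 1) (tay f)"
    using assms by (auto simp: hardy_disk_iff)
  have "(\<lambda>n. weight r n * (cmod (tay f n))\<^sup>2) = (\<lambda>n. 1 * (cmod (tay f n))\<^sup>2)"
    by (auto simp: fun_eq_iff tay_def weight_def)
  then have "wl2 (weight r) (tay f)" using l2 by (simp add: wl2_def)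
  then show "f \<in> H2_annulus r"
    using tay_laurent[OF hol] hol by (intro H2I) (auto intro: holomorphic_on_subset simp: annulus_def)
  show "laurent_coeffs r f = tay f" by (rule laurent_coeffs_eq[OF r tay_laurent[OF hol]])
qed

text \<open>This is why the functional of a function from the disk is an integral over the unit
  circle: its coefficients live where the weight is 1, whatever the other argument is.\<close>

lemma wip_weight_nonneg:
  assumes "\<And>n. n < 0 \<Longrightarrow> a n = 0" shows "wip (weight r) c a = wip (\<lambda>_. 1) c a"
  unfolding wip_def using assms by (intro infsum_cong) (auto simp: weight_def)

lemma Eset_same_state:
  assumes f: "f \<in> hardy_disk" and g: "g \<in> Eset r f"
  shows "same_state r (tay f) (laurent_coeffs r g)"
proof
  have gH: "g \<in> H2_annulus r" using g by (simp add: Eset_def)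
  show "0 < r" "r < 1" using r by auto
  show "wl2 (\<lambda>_. 1) (tay f)" using f by (simp add: hardy_disk_iff)
  show "tay f n = 0" if "n < 0" for n using that by (rule tay_neg)
  show "wl2 (weight r) (laurent_coeffs r g)" by (rule H2D(2)[OF gH])
  show "wip (weight r) (\<lambda>n. laurent_coeffs r g (n - k)) (laurent_coeffs r g)
      = wip (\<lambda>_. 1) (\<lambda>n. tay f (n - k)) (tay f)" for k
  proof -
    have "wip (weight r) (\<lambda>n. laurent_coeffs r g (n - k)) (laurent_coeffs r g) = Pfun r g (\<lambda>z. z powi k)"
      by (rule Pfun_powi[OF gH, symmetric])
    also have "\<dots> = Pfun r f (\<lambda>z. z powi k)"
      using g powi_Mult by (auto simp: Eset_def)
    also have "\<dots> = wip (weight r) (\<lambda>n. tay f (n - k)) (tay f)"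
      using Pfun_powi[OF hardy_disk_H2(1)[OF f]] by (simp add: hardy_disk_H2(2)[OF f])
    also have "\<dots> = wip (\<lambda>_. 1) (\<lambda>n. tay f (n - k)) (tay f)"
      by (rule wip_weight_nonneg) (simp add: tay_neg)
    finally show ?thesis .
  qed
qed

lemma Eset_self: "f \<in> H2_annulus r \<Longrightarrow> f \<in> Eset r f"
  by (simp add: Eset_def)

lemma Eset_bdd:
  assumes z: "z \<in> annulus r" and f: "f \<in> H2_annulus r"
  shows "bdd_above ((\<lambda>g. cmod (g z)) ` Eset r f)"
proof -
  define \<kappa> where "\<kappa> = (1 / (1 - (cmod z)\<^sup>2) + (r\<^sup>2 / (cmod z)\<^sup>2) / (1 - r\<^sup>2 / (cmod z)\<^sup>2))"
  \<comment> \<open>\<open>z powi 0\<close> is the constant multiplier 1, so its functional value is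
    the squared norm, shared by all members of \<open>Eset r f\<close>.\<close>
  have "cmod (g z) \<le> sqrt (\<kappa> * Re (Pfun r f (\<lambda>z. z powi 0)))" if "g \<in> Eset r f" for g
  proof (rule real_le_rsqrt)
    have gH: "g \<in> H2_annulus r" using that by (simp add: Eset_def)
    have "(cmod (g z))\<^sup>2 \<le> \<kappa> * (\<Sum>\<^sub>\<infinity>n. weight r n * (cmod (laurent_coeffs r g n))\<^sup>2)"
      unfolding \<kappa>_def using z r H2D[OF gH]
      by (intro point_evaluation_bound) (auto simp: annulus_def is_laurent_def)
    also have "(\<Sum>\<^sub>\<infinity>n. weight r n * (cmod (laurent_coeffs r g n))\<^sup>2) = Re (Pfun r g (\<lambda>z. z powi 0))"
      using H2D(2)[OF gH] by (subst Pfun_powi[OF gH]) (simp add: Re_wip_self)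
    also have "Pfun r g (\<lambda>z. z powi 0) = Pfun r f (\<lambda>z. z powi 0)"
      using that powi_Mult[of 0] unfolding Eset_def by blast
    finally show "(cmod (g z))\<^sup>2 \<le> \<kappa> * Re (Pfun r f (\<lambda>z. z powi 0))" .
  qed
  then show ?thesis by (auto intro!: bdd_aboveI2)
qed

lemma free_outer_iff:
  assumes z: "z \<in> annulus r" and f: "f \<in> H2_annulus r"
  shows "free_outer r z f \<longleftrightarrow> (\<forall>g\<in>Eset r f. cmod (g z) \<le> cmod (f z))"
proof
  assume *: "free_outer r z f"
  show "\<forall>g\<in>Eset r f. cmod (g z) \<le> cmod (f z)"
  proof
    fix g assume "g \<in> Eset r f"
    then have "cmod (g z) \<le> (SUP g\<in>Eset r f. cmod (g z))"
      by (rule cSUP_upper[OF _ Eset_bdd[OF z f]])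
    then show "cmod (g z) \<le> cmod (f z)" using * by (simp add: free_outer_def)
  qed
next
  assume *: "\<forall>g\<in>Eset r f. cmod (g z) \<le> cmod (f z)"
  have "(SUP g\<in>Eset r f. cmod (g z)) = cmod (f z)"
    by (rule cSup_eq_maximum) (use * Eset_self[OF f] in auto)
  then show "free_outer r z f" using f by (simp add: free_outer_def)
qed

end

section \<open>Hardy norms and means over circles\<close>

lemma circle_mean_tendsto_bound:
  fixes c :: "int \<Rightarrow> complex"
  assumes neg: "\<And>n. n < 0 \<Longrightarrow> c n = 0"
    and bd: "\<And>\<rho>. 0 < \<rho> \<Longrightarrow> \<rho> < 1 \<Longrightarrow> ((\<lambda>n. (cmod (c n))\<^sup>2 * \<rho> powi (2 * n)) has_sum m \<rho>) UNIV \<and> m \<rho> \<le> B"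
  shows "wl2 (\<lambda>_. 1) c \<and> (\<Sum>\<^sub>\<infinity>n. (cmod (c n))\<^sup>2) \<le> B"
proof -
  have fin: "(\<Sum>n\<in>F. (cmod (c n))\<^sup>2) \<le> B" if F: "finite F" for F
  proof -
    \<comment> \<open>The summand 2 keeps the radius positive already at
      \<open>k = 0\<close>.\<close>
    define \<rho> where "\<rho> k = 1 - 1 / (real k + 2)" for k :: nat
    have \<rho>: "0 < \<rho> k" "\<rho> k < 1" for k by (auto simp: \<rho>_def)
    have "\<rho> \<longlonglongrightarrow> 1" unfolding \<rho>_def by real_asymp
    have "(\<lambda>k. \<Sum>n\<in>F. (cmod (c n))\<^sup>2 * \<rho> k powi (2 * n)) \<longlonglongrightarrow> (\<Sum>n\<in>F. (cmod (c n))\<^sup>2 * 1 powi (2 * n))"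
      by (intro tendsto_intros \<open>\<rho> \<longlonglongrightarrow> 1\<close>) auto
    moreover have "(\<Sum>n\<in>F. (cmod (c n))\<^sup>2 * \<rho> k powi (2 * n)) \<le> B" for k
    proof -
      have "(\<Sum>n\<in>F. (cmod (c n))\<^sup>2 * \<rho> k powi (2 * n)) \<le> m (\<rho> k)"
        by (rule finite_sum_le_has_sum[OF conjunct1[OF bd]]) (use \<rho>[of k] F in \<open>auto simp: less_imp_le\<close>)
      then show ?thesis using bd[OF \<rho>(1,2)[of k]] by linarith
    qed
    ultimately show ?thesis by (intro LIMSEQ_le_const2[of _ _ B]) auto
  qed
  have sm: "(\<lambda>n. (cmod (c n))\<^sup>2) summable_on UNIV"
    by (rule nonneg_bdd_above_summable_on) (auto intro!: bdd_aboveI2[of _ _ B] fin)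
  moreover have "(\<Sum>\<^sub>\<infinity>n. (cmod (c n))\<^sup>2) \<le> B"
    using fin by (intro infsum_le_finite_sums sm) auto
  ultimately show ?thesis by (simp add: wl2_def)
qed

lemma hardy_norm_le:
  assumes "u holomorphic_on ball 0 1"
    and "\<And>\<rho>. 0 < \<rho> \<Longrightarrow> \<rho> < 1 \<Longrightarrow> integral {0..2 * pi} (\<lambda>t. (cmod (u (of_real \<rho> * cis t)))\<^sup>2) / (2 * pi) \<le> B"
  shows "wl2 (\<lambda>_. 1) (tay u)" "(\<Sum>\<^sub>\<infinity>n. (cmod (tay u n))\<^sup>2) \<le> B"
  using circle_mean_tendsto_bound[of "tay u" "\<lambda>\<rho>. integral {0..2 * pi} (\<lambda>t. (cmod (u (of_real \<rho> * cis t)))\<^sup>2) / (2 * pi)" B]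
    assms circle_norm_parseval(2)[OF _ tay_circle[OF assms(1)]] tay_neg[of _ u] by auto

lemma hardy_mean_le:
  assumes "u holomorphic_on ball 0 1" "wl2 (\<lambda>_. 1) (tay u)" "0 < \<rho>" "\<rho> < 1"
  shows "integral {0..2 * pi} (\<lambda>t. (cmod (u (of_real \<rho> * cis t)))\<^sup>2) / (2 * pi) \<le> (\<Sum>\<^sub>\<infinity>n. (cmod (tay u n))\<^sup>2)"
proof (rule has_sum_mono)
  show "((\<lambda>n. (cmod (tay u n))\<^sup>2 * \<rho> powi (2 * n)) has_sum
      (integral {0..2 * pi} (\<lambda>t. (cmod (u (of_real \<rho> * cis t)))\<^sup>2) / (2 * pi))) UNIV"
    by (rule circle_norm_parseval(2)[OF assms(3) tay_circle[OF assms(1,4)]])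
  show "((\<lambda>n. (cmod (tay u n))\<^sup>2) has_sum (\<Sum>\<^sub>\<infinity>n. (cmod (tay u n))\<^sup>2)) UNIV"
    using assms(2) by (simp add: wl2_def)
  show "(cmod (tay u n))\<^sup>2 * \<rho> powi (2 * n) \<le> (cmod (tay u n))\<^sup>2" for n
  proof (cases "n < 0")
    case False
    then have "\<rho> powi (2 * n) \<le> 1" using assms by (simp add: power_int_def power_le_one)
    then show ?thesis by (simp add: mult_left_le)
  qed (simp add: tay_neg)
qed

lemma hardy_norm_mono:
  assumes u: "u holomorphic_on ball 0 1" and v: "v holomorphic_on ball 0 1" "wl2 (\<lambda>_. 1) (tay v)"
    and le: "\<And>z. cmod z < 1 \<Longrightarrow> cmod (u z) \<le> B * cmod (v z)" and B: "0 \<le> B"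
  shows "wl2 (\<lambda>_. 1) (tay u)" "(\<Sum>\<^sub>\<infinity>n. (cmod (tay u n))\<^sup>2) \<le> B\<^sup>2 * (\<Sum>\<^sub>\<infinity>n. (cmod (tay v n))\<^sup>2)"
proof -
  have *: "integral {0..2 * pi} (\<lambda>t. (cmod (u (of_real \<rho> * cis t)))\<^sup>2) / (2 * pi) \<le> B\<^sup>2 * (\<Sum>\<^sub>\<infinity>n. (cmod (tay v n))\<^sup>2)"
    if \<rho>: "0 < \<rho>" "\<rho> < 1" for \<rho>
  proof -
    have "integral {0..2 * pi} (\<lambda>t. (cmod (u (of_real \<rho> * cis t)))\<^sup>2)
       \<le> integral {0..2 * pi} (\<lambda>t. B\<^sup>2 * (cmod (v (of_real \<rho> * cis t)))\<^sup>2)"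
    proof (rule integral_le)
      show "(\<lambda>t. (cmod (u (of_real \<rho> * cis t)))\<^sup>2) integrable_on {0..2 * pi}"
        by (rule circle_norm_parseval(1)[OF \<rho>(1) tay_circle[OF u \<rho>(2)]])
      show "(\<lambda>t. B\<^sup>2 * (cmod (v (of_real \<rho> * cis t)))\<^sup>2) integrable_on {0..2 * pi}"
        by (intro integrable_on_mult_right circle_norm_parseval(1)[OF \<rho>(1) tay_circle[OF v(1) \<rho>(2)]])
      show "(cmod (u (of_real \<rho> * cis t)))\<^sup>2 \<le> B\<^sup>2 * (cmod (v (of_real \<rho> * cis t)))\<^sup>2" for t
        using power_mono[OF le[of "of_real \<rho> * cis t"] norm_ge_zero, of 2] \<rho>
        by (simp add: power_mult_distrib norm_mult)
    qed
    then have "integral {0..2 * pi} (\<lambda>t. (cmod (u (of_real \<rho> * cis t)))\<^sup>2) / (2 * pi)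
       \<le> B\<^sup>2 * (integral {0..2 * pi} (\<lambda>t. (cmod (v (of_real \<rho> * cis t)))\<^sup>2) / (2 * pi))"
      by (simp add: divide_right_mono)
    also have "\<dots> \<le> B\<^sup>2 * (\<Sum>\<^sub>\<infinity>n. (cmod (tay v n))\<^sup>2)"
      by (intro mult_left_mono hardy_mean_le v \<rho>) auto
    finally show ?thesis .
  qed
  show "wl2 (\<lambda>_. 1) (tay u)" "(\<Sum>\<^sub>\<infinity>n. (cmod (tay u n))\<^sup>2) \<le> B\<^sup>2 * (\<Sum>\<^sub>\<infinity>n. (cmod (tay v n))\<^sup>2)"
    by (rule hardy_norm_le[OF u *]; assumption)+
qed

section \<open>Herglotz integrals\<close>

text \<open>The Schwarz kernel. Its real part is the Poisson kernel, so
  \<open>Re (herg \<psi> z)\<close> is the Poisson integral of \<open>\<psi>\<close>, and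
  \<open>exp (herg (\<lambda>t. ln (\<phi> t)) z)\<close> is the outer function built from
  \<open>\<phi>\<close>.\<close>

definition herg_kernel :: "complex \<Rightarrow> real \<Rightarrow> complex" where
  "herg_kernel z t = (cis t + z) / (cis t - z)"

definition herg :: "(real \<Rightarrow> real) \<Rightarrow> complex \<Rightarrow> complex" where
  "herg \<psi> z = 1 / (2 * of_real pi) *
     (LINT t:{0..2*pi}|lborel. herg_kernel z t * of_real (\<psi> t))"

abbreviation circ_integrable :: "(real \<Rightarrow> real) \<Rightarrow> bool" where
  "circ_integrable \<psi> \<equiv> set_integrable lborel {0..2*pi} \<psi>"

lemma cis_neq: "cmod z < 1 \<Longrightarrow> cis t - z \<noteq> 0"
  by auto

text \<open>The kernel is (1 + w) / (1 - w) = 2 / (1 - w) - 1 with w = \<open>cis (- t) * z\<close>;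
  the -1 is why the constant term is 1 and all later ones are 2.\<close>

lemma herg_kernel_sums:
  assumes "cmod z < 1"
  shows "(\<lambda>n. (if n = 0 then 1 else 2) * cis (of_int (- int n) * t) * z ^ n) sums herg_kernel z t"
proof -
  define w where "w = cis (- t) * z"
  have w: "cmod w < 1" using assms by (simp add: w_def norm_mult)
  have zw: "z = cis t * w" by (simp add: w_def cis_mult flip: mult.assoc)
  have "(\<lambda>n. 2 * w ^ n) sums (2 * (1 / (1 - w)))"
    by (intro sums_mult geometric_sums w)
  then have "(\<lambda>n. 2 * w ^ n + (if n = 0 then - 1 else 0)) sums (2 * (1 / (1 - w)) + - 1)"
    by (intro sums_add sums_single)
  moreover have "2 * w ^ n + (if n = 0 then - 1 else 0) = (if n = 0 then 1 else 2) * cis (of_int (- int n) * t) * z ^ n" for n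
    by (simp add: w_def power_mult_distrib Complex.DeMoivre)
  moreover have "2 * (1 / (1 - w)) + - 1 = herg_kernel z t"
  proof -
    have "w \<noteq> 1" using w by auto
    have "herg_kernel z t = (cis t * (1 + w)) / (cis t * (1 - w))"
      by (simp add: herg_kernel_def zw algebra_simps)
    also have "\<dots> = (1 + w) / (1 - w)" by simp
    finally show ?thesis using \<open>w \<noteq> 1\<close> by (simp add: field_simps)
  qed
  ultimately show ?thesis by simp
qed

lemma cis_measurable [measurable]: "(\<lambda>t. cis (c * t)) \<in> borel_measurable borel"
  by (intro borel_measurable_continuous_onI continuous_intros)

lemma circ_integrable_bounded_mult:
  fixes k :: "real \<Rightarrow> complex"
  assumes \<psi>: "circ_integrable \<psi>" and k: "k \<in> borel_measurable borel" and bd: "\<And>t. cmod (k t) \<le> B"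
  shows "set_integrable lborel {0..2*pi} (\<lambda>t. k t * of_real (\<psi> t))"
  unfolding set_integrable_def
proof (rule Bochner_Integration.integrable_bound)
  show "integrable lborel (\<lambda>t. B * norm (indicator {0..2*pi} t *\<^sub>R \<psi> t))"
    using \<psi> unfolding set_integrable_def by (intro integrable_mult_right integrable_norm)
  have "(\<lambda>t. k t * of_real (indicator {0..2*pi} t *\<^sub>R \<psi> t)) \<in> borel_measurable lborel"
    using k \<psi>[unfolded set_integrable_def, THEN borel_measurable_integrable] by measurable
  moreover have "(\<lambda>t. k t * of_real (indicator {0..2*pi} t *\<^sub>R \<psi> t)) = (\<lambda>t. indicator {0..2*pi} t *\<^sub>R (k t * of_real (\<psi> t)))"
    by (auto simp: indicator_def)
  ultimately show "(\<lambda>t. indicator {0..2*pi} t *\<^sub>R (k t * of_real (\<psi> t))) \<in> borel_measurable lborel"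
    by simp
  show "AE t in lborel. norm (indicator {0..2*pi} t *\<^sub>R (k t * of_real (\<psi> t))) \<le> norm (B * norm (indicator {0..2*pi} t *\<^sub>R \<psi> t))"
  proof (rule AE_I2)
    fix t :: real
    have "cmod (k t) * \<bar>\<psi> t\<bar> \<le> \<bar>B\<bar> * \<bar>\<psi> t\<bar>"
      using bd[of t] by (intro mult_right_mono) auto
    then show "norm (indicator {0..2*pi} t *\<^sub>R (k t * of_real (\<psi> t))) \<le> norm (B * norm (indicator {0..2*pi} t *\<^sub>R \<psi> t))"
      by (auto simp: norm_mult indicator_def abs_mult)
  qed
qed

lemma herg_kernel_bound: assumes "cmod z < 1" shows "cmod (herg_kernel z t) \<le> 2 / (1 - cmod z)"
proof -
  have "1 - cmod z \<le> cmod (cis t - z)" using norm_triangle_ineq2[of "cis t" z] by simp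
  moreover have "cmod (cis t + z) \<le> 2" using norm_triangle_ineq[of "cis t" z] assms by simp
  ultimately show ?thesis unfolding herg_kernel_def norm_divide using assms
    by (intro frac_le) auto
qed

lemma herg_kernel_measurable: "cmod z < 1 \<Longrightarrow> herg_kernel z \<in> borel_measurable borel"
  unfolding herg_kernel_def using cis_neq
  by (intro borel_measurable_continuous_onI continuous_intros) auto

lemma herg_integrable:
  "circ_integrable \<psi> \<Longrightarrow> cmod z < 1 \<Longrightarrow> set_integrable lborel {0..2*pi} (\<lambda>t. herg_kernel z t * of_real (\<psi> t))"
  by (rule circ_integrable_bounded_mult[OF _ herg_kernel_measurable herg_kernel_bound])

text \<open>Termwise integration exhibits \<open>herg \<psi>\<close> as a power series, which yields
  holomorphy at once and reduces explicit evaluations to Fourier coefficients.\<close>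

lemma herg_sums:
  assumes \<psi>: "circ_integrable \<psi>" and z: "cmod z < 1"
  shows "(\<lambda>n. ((if n = 0 then 1 else 2) / (2 * of_real pi) *
      (LINT t:{0..2*pi}|lborel. cis (of_int (- int n) * t) * of_real (\<psi> t))) * z ^ n) sums herg \<psi> z"
proof -
  define e where "e n t = (if n = 0 then 1 else 2) * cis (of_int (- int n) * t) * z ^ n" for n t
  define F where "F n t = indicator {0..2*pi} t *\<^sub>R (e n t * of_real (\<psi> t))" for n t
  have e: "cmod (e n t) \<le> 2 * cmod z ^ n" for n t by (simp add: e_def norm_mult norm_power)
  have e_meas: "e n \<in> borel_measurable borel" for n unfolding e_def by measurable
  have \<psi>': "integrable lborel (\<lambda>t. \<bar>indicator {0..2*pi} t * \<psi> t\<bar>)"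
    using \<psi> unfolding set_integrable_def by (simp add: integrable_abs)
  have int: "integrable lborel (F n)" for n
    using circ_integrable_bounded_mult[OF \<psi> e_meas e] unfolding set_integrable_def F_def .
  have bound: "norm (F n t) \<le> 2 * cmod z ^ n * \<bar>indicator {0..2*pi} t * \<psi> t\<bar>" for n t
    using mult_right_mono[OF e[of n t], of "\<bar>\<psi> t\<bar>"] by (auto simp: F_def indicator_def norm_mult)
  have geo: "summable (\<lambda>n. 2 * cmod z ^ n)" using z by (intro summable_mult summable_geometric) auto
  have S: "(\<lambda>n. integral\<^sup>L lborel (F n)) sums (\<integral>t. suminf (\<lambda>n. F n t) \<partial>lborel)"
  proof (rule sums_integral)
    show "AE t in lborel. summable (\<lambda>n. norm (F n t))"
      by (intro AE_I2 summable_comparison_test'[OF summable_mult2[OF geo], of 0]) (use bound in auto)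
    have "norm (\<integral>t. norm (F n t) \<partial>lborel) \<le> 2 * cmod z ^ n * (\<integral>t. \<bar>indicator {0..2*pi} t * \<psi> t\<bar> \<partial>lborel)" for n
    proof -
      have "(\<integral>t. norm (F n t) \<partial>lborel) \<le> (\<integral>t. 2 * cmod z ^ n * \<bar>indicator {0..2*pi} t * \<psi> t\<bar> \<partial>lborel)"
        using int \<psi>' bound by (intro integral_mono integrable_norm integrable_mult_right) auto
      then show ?thesis by (simp add: integral_nonneg_AE)
    qed
    then show "summable (\<lambda>n. \<integral>t. norm (F n t) \<partial>lborel)"
      by (intro summable_comparison_test'[OF summable_mult2[OF geo], of 0]) auto
  qed (rule int)
  have "suminf (\<lambda>n. F n t) = indicator {0..2*pi} t *\<^sub>R (herg_kernel z t * of_real (\<psi> t))" for t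
  proof -
    have "(\<lambda>n. F n t) sums (indicator {0..2*pi} t *\<^sub>R (herg_kernel z t * of_real (\<psi> t)))"
      unfolding F_def e_def by (intro sums_scaleR_right sums_mult2 herg_kernel_sums z)
    then show ?thesis by (simp add: sums_iff)
  qed
  with S have "(\<lambda>n. integral\<^sup>L lborel (F n)) sums (LINT t:{0..2*pi}|lborel. herg_kernel z t * of_real (\<psi> t))"
    by (simp add: set_lebesgue_integral_def)
  from sums_mult[OF this, of "1 / (2 * of_real pi)"]
  have "(\<lambda>n. 1 / (2 * of_real pi) * integral\<^sup>L lborel (F n)) sums herg \<psi> z"
    by (simp add: herg_def)
  moreover have "integral\<^sup>L lborel (F n) = (if n = 0 then 1 else 2) * z ^ n *
      (LINT t:{0..2*pi}|lborel. cis (of_int (- int n) * t) * of_real (\<psi> t))" for n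
  proof -
    have F_eq: "F n = (\<lambda>t. (if n = 0 then 1 else 2) * z ^ n * (indicator {0..2*pi} t *\<^sub>R (cis (of_int (- int n) * t) * of_real (\<psi> t))))"
      by (rule ext) (simp add: F_def e_def indicator_def)
    show ?thesis unfolding set_lebesgue_integral_def F_eq by (rule integral_mult_right_zero)
  qed
  ultimately show ?thesis by (simp add: mult_ac)
qed

lemma herg_holomorphic: "circ_integrable \<psi> \<Longrightarrow> herg \<psi> holomorphic_on ball 0 1"
  by (rule power_series_holomorphic[where a = "\<lambda>n. (if n = 0 then 1 else 2) / (2 * of_real pi) *
      (LINT t:{0..2*pi}|lborel. cis (of_int (- int n) * t) * of_real (\<psi> t))"])
    (use herg_sums[of \<psi>] in simp)

lemma herg_const: "cmod z < 1 \<Longrightarrow> herg (\<lambda>_. c) z = of_real c"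
proof -
  assume z: "cmod z < 1"
  have ci: "circ_integrable (\<lambda>_. c)" by (simp add: set_integrable_def)
  have "(LINT t:{0..2*pi}|lborel. cis (of_int (- int n) * t) * of_real c) = (if n = 0 then 2 * of_real pi else 0) * of_real c" for n
  proof -
    have 1: "((\<lambda>t. cis (of_int (- int n) * t) * of_real c) has_integral (if - int n = 0 then 2 * of_real pi else 0) * of_real c) {0..2*pi}"
      by (intro has_integral_mult_left cis_has_integral)
    have "set_integrable lborel {0..2*pi} (\<lambda>t. cis (of_int (- int n) * t) * of_real c)"
      by (rule circ_integrable_bounded_mult[OF ci, of _ 1], rule cis_measurable) simp
    from set_borel_integral_eq_integral(2)[OF this] show ?thesis
      unfolding integral_unique[OF 1] by (simp only: neg_equal_0_iff_equal of_nat_eq_0_iff)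
  qed
  then have L: "((if n = 0 then 1 else 2) / (2 * of_real pi) *
      (LINT t:{0..2*pi}|lborel. cis (of_int (- int n) * t) * of_real c)) * z ^ n = (if n = 0 then of_real c else 0)" for n
    by (cases "n = 0") (simp_all only: if_True if_False mult_zero_left mult_zero_right, simp)
  have "(\<lambda>n::nat. if n = 0 then of_real c else 0) sums herg (\<lambda>_. c) z"
    using herg_sums[OF ci z] unfolding L .
  then show ?thesis using sums_single[of 0 "\<lambda>_. of_real c"] by (rule sums_unique2)
qed

lemma herg_add:
  assumes "circ_integrable \<psi>" "circ_integrable \<theta>" "cmod z < 1"
  shows "herg (\<lambda>t. \<psi> t + \<theta> t) z = herg \<psi> z + herg \<theta> z"
  unfolding herg_def of_real_add distrib_left
  by (subst set_integral_add(2)[OF herg_integrable herg_integrable])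
    (use assms in \<open>auto simp: distrib_left\<close>)

lemma herg_mult: "herg (\<lambda>t. c * \<psi> t) z = of_real c * herg \<psi> z"
proof -
  have "(LINT t:{0..2*pi}|lborel. herg_kernel z t * of_real (c * \<psi> t)) = of_real c * (LINT t:{0..2*pi}|lborel. herg_kernel z t * of_real (\<psi> t))"
    by (subst set_integral_mult_right[symmetric]) (simp add: mult_ac)
  then show ?thesis by (simp add: herg_def)
qed

lemma Re_herg_kernel_nonneg: assumes "cmod z < 1" shows "0 \<le> Re (herg_kernel z t)"
proof -
  have "(cmod z)\<^sup>2 \<le> 1" using assms by (intro power_le_one) auto
  then have "(Re z)\<^sup>2 + (Im z)\<^sup>2 \<le> 1" by (simp only: cmod_power2)
  moreover have "(cos t)\<^sup>2 + (sin t)\<^sup>2 = 1" by simp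
  ultimately have "0 \<le> (cos t + Re z) * (cos t - Re z) + (sin t + Im z) * (sin t - Im z)"
    by (simp only: square_diff_square_factored[symmetric] power2_eq_square[symmetric])
  then show ?thesis
    unfolding herg_kernel_def Re_divide plus_complex.sel minus_complex.sel cis.sel
    by (rule divide_nonneg_nonneg) simp
qed

lemma Re_herg:
  assumes "circ_integrable \<psi>" "cmod z < 1"
  shows "Re (herg \<psi> z) = (LINT t:{0..2*pi}|lborel. Re (herg_kernel z t) * \<psi> t) / (2 * pi)"
    and "set_integrable lborel {0..2*pi} (\<lambda>t. Re (herg_kernel z t) * \<psi> t)"
proof -
  note I = herg_integrable[OF assms, unfolded set_integrable_def]
  have eq: "Re (indicator {0..2*pi} t *\<^sub>R (herg_kernel z t * of_real (\<psi> t))) = indicator {0..2*pi} t *\<^sub>R (Re (herg_kernel z t) * \<psi> t)" for t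
    by simp
  show "set_integrable lborel {0..2*pi} (\<lambda>t. Re (herg_kernel z t) * \<psi> t)"
    using integrable_Re[OF I] unfolding eq set_integrable_def .
  have "Re (LINT t:{0..2*pi}|lborel. herg_kernel z t * of_real (\<psi> t)) = (LINT t:{0..2*pi}|lborel. Re (herg_kernel z t) * \<psi> t)"
    unfolding set_lebesgue_integral_def integral_Re[OF I, symmetric] eq ..
  then show "Re (herg \<psi> z) = (LINT t:{0..2*pi}|lborel. Re (herg_kernel z t) * \<psi> t) / (2 * pi)"
  proof -
    have "1 / (2 * of_real pi) = complex_of_real (1 / (2 * pi))" by simp
    then have "herg \<psi> z = of_real (1 / (2 * pi)) * (LINT t:{0..2*pi}|lborel. herg_kernel z t * of_real (\<psi> t))"
      by (simp only: herg_def)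
    then show ?thesis
      using \<open>Re (LINT t:{0..2*pi}|lborel. herg_kernel z t * of_real (\<psi> t)) = _\<close>
      by (simp only: Re_complex_of_real times_complex.sel Im_complex_of_real) simp
  qed
qed

lemma Re_herg_mono:
  assumes "circ_integrable \<psi>" "circ_integrable \<theta>" "cmod z < 1"
    and "AE t in lborel. t \<in> {0..2*pi} \<longrightarrow> \<psi> t \<le> \<theta> t"
  shows "Re (herg \<psi> z) \<le> Re (herg \<theta> z)"
  unfolding Re_herg(1)[OF assms(1,3)] Re_herg(1)[OF assms(2,3)] set_lebesgue_integral_def
proof (intro divide_right_mono integral_mono_AE)
  show "AE t in lborel. indicator {0..2*pi} t *\<^sub>R (Re (herg_kernel z t) * \<psi> t) \<le> indicator {0..2*pi} t *\<^sub>R (Re (herg_kernel z t) * \<theta> t)"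
    using assms(4)
  proof eventually_elim
    case (elim t)
    then show ?case
      using mult_left_mono[OF _ Re_herg_kernel_nonneg[OF assms(3), of t], of "\<psi> t" "\<theta> t"]
      by (cases "t \<in> {0..2*pi}") auto
  qed
qed (use Re_herg(2)[OF assms(1,3)] Re_herg(2)[OF assms(2,3)] in \<open>simp_all add: set_integrable_def\<close>)

lemma herg_at_0: "herg \<psi> 0 = of_real ((LINT t:{0..2*pi}|lborel. \<psi> t) / (2 * pi))"
proof -
  have "herg_kernel 0 t = 1" for t by (simp add: herg_kernel_def)
  then have "herg \<psi> 0 = 1 / (2 * of_real pi) * of_real (LINT t:{0..2*pi}|lborel. \<psi> t)"
    by (simp only: herg_def mult_1_left set_integral_complex_of_real)
  then show ?thesis by simp
qed

text \<open>Jensen's inequality for the Poisson probability measure: integrate the tangent line of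
  the exponential at the Poisson mean \<open>m\<close>.\<close>

lemma Poisson_Jensen:
  assumes "circ_integrable \<psi>" "circ_integrable (\<lambda>t. exp (\<psi> t))" "cmod z < 1"
  shows "exp (Re (herg \<psi> z)) \<le> Re (herg (\<lambda>t. exp (\<psi> t)) z)"
proof -
  define m where "m = Re (herg \<psi> z)"
  have c: "circ_integrable (\<lambda>_. k)" for k by (simp add: set_integrable_def)
  have i: "circ_integrable (\<lambda>t. exp m * \<psi> t)" using assms(1) by (rule set_integrable_mult_right)
  have "exp m = Re (herg (\<lambda>t. exp m * (1 - m)) z + herg (\<lambda>t. exp m * \<psi> t) z)"
    by (simp only: herg_const[OF assms(3)] herg_mult plus_complex.sel Re_complex_of_real) (simp add: m_def algebra_simps)
  also have "\<dots> = Re (herg (\<lambda>t. exp m * (1 - m) + exp m * \<psi> t) z)"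
    by (subst herg_add[OF c i assms(3)]) simp
  also have "\<dots> \<le> Re (herg (\<lambda>t. exp (\<psi> t)) z)"
  proof (intro Re_herg_mono set_integral_add c i assms AE_I2 impI)
    fix t
    have "exp m * (1 + (\<psi> t - m)) \<le> exp m * exp (\<psi> t - m)"
      by (intro mult_left_mono exp_ge_add_one_self) auto
    then show "exp m * (1 - m) + exp m * \<psi> t \<le> exp (\<psi> t)"
      by (simp add: algebra_simps flip: exp_add)
  qed
  finally show ?thesis by (simp add: m_def)
qed

text \<open>Parseval against the constant 1 picks out the coefficient at 0.\<close>

lemma holomorphic_mean_value:
  assumes "G holomorphic_on ball 0 1" "0 < \<rho>" "\<rho> < 1"
  shows "(\<lambda>t. Re (G (of_real \<rho> * cis t))) integrable_on {0..2*pi}"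
    and "integral {0..2*pi} (\<lambda>t. Re (G (of_real \<rho> * cis t))) / (2 * pi) = Re (G 0)"
proof -
  have one: "laurent_on_circle \<rho> (\<lambda>_. 1) (\<lambda>n. if n = 0 then 1 else 0)"
    unfolding laurent_on_circle_def
  proof (intro allI impI)
    fix z :: complex
    have "((\<lambda>n::int. (if n = 0 then 1 else 0) * z powi n) has_sum (\<Sum>n\<in>{0}. (if n = 0 then 1 else 0) * z powi n)) {0::int}"
      by (rule has_sum_finite) auto
    then have "((\<lambda>n::int. (if n = 0 then 1 else 0) * z powi n) has_sum 1) {0::int}" by simp
    then show "((\<lambda>n::int. (if n = 0 then 1 else 0) * z powi n) has_sum 1) UNIV"
      by (rule has_sum_cong_neutral[THEN iffD1, rotated -1]) auto
  qed
  note P = circle_parseval[OF assms(2) tay_circle[OF assms(1,3)] one]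
  have I: "(\<lambda>t. G (of_real \<rho> * cis t)) integrable_on {0..2*pi}" using P(1) by simp
  then show "(\<lambda>t. Re (G (of_real \<rho> * cis t))) integrable_on {0..2*pi}"
    by (rule integrable_linear[OF _ bounded_linear_Re, unfolded o_def])
  have "((\<lambda>n. tay G n * cnj (if n = 0 then 1 else 0) * of_real (\<rho> powi (2 * n))) has_sum
     (\<Sum>n\<in>{0}. tay G n * cnj (if n = 0 then 1 else 0) * of_real (\<rho> powi (2 * n)))) {0::int}"
    by (rule has_sum_finite) auto
  then have "((\<lambda>n. tay G n * cnj (if n = 0 then 1 else 0) * of_real (\<rho> powi (2 * n))) has_sum
     (\<Sum>n\<in>{0}. tay G n * cnj (if n = 0 then 1 else 0) * of_real (\<rho> powi (2 * n)))) UNIV"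
    by (rule has_sum_cong_neutral[THEN iffD1, rotated -1]) auto
  from has_sum_unique[OF P(2) this]
  have "integral {0..2*pi} (\<lambda>t. G (of_real \<rho> * cis t)) = 2 * of_real pi * G 0"
    by (simp add: tay_def field_simps)
  then have "Re (integral {0..2*pi} (\<lambda>t. G (of_real \<rho> * cis t))) = 2 * pi * Re (G 0)" by simp
  then show "integral {0..2*pi} (\<lambda>t. Re (G (of_real \<rho> * cis t))) / (2 * pi) = Re (G 0)"
    using integral_linear[OF I bounded_linear_Re] by (simp add: o_def)
qed

section \<open>Outer functions are free outer\<close>

definition sq :: "(int \<Rightarrow> complex) \<Rightarrow> real" where
  "sq c = (\<Sum>\<^sub>\<infinity>n. (cmod (c n))\<^sup>2)"

abbreviation l2 :: "(int \<Rightarrow> complex) \<Rightarrow> bool" where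
  "l2 \<equiv> wl2 (\<lambda>_. 1)"

lemma l2_summable: "l2 c \<longleftrightarrow> (\<lambda>n. (cmod (c n))\<^sup>2) summable_on UNIV"
  by (simp add: wl2_def)

lemma sq_nonneg: "0 \<le> sq c"
  by (simp add: sq_def infsum_nonneg)

lemma l2_add: "l2 a \<Longrightarrow> l2 b \<Longrightarrow> l2 (\<lambda>n. a n + b n)"
  by (rule wl2_add) auto

lemma l2_diff: "l2 a \<Longrightarrow> l2 b \<Longrightarrow> l2 (\<lambda>n. a n - b n)"
  using l2_add[of a "\<lambda>n. - 1 * b n"] wl2_scale[of "\<lambda>_. 1" b "- 1"] by simp

lemma sq_add3:
  assumes "l2 a" "l2 b" "l2 c"
  shows "sq (\<lambda>n. a n + b n + c n) \<le> 3 * (sq a + sq b + sq c)"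
proof -
  have "sq (\<lambda>n. a n + b n + c n) \<le> (\<Sum>\<^sub>\<infinity>n. 3 * ((cmod (a n))\<^sup>2 + (cmod (b n))\<^sup>2 + (cmod (c n))\<^sup>2))"
    unfolding sq_def
  proof (rule infsum_mono)
    show "(\<lambda>n. (cmod (a n + b n + c n))\<^sup>2) summable_on UNIV"
      using l2_add[OF l2_add[OF assms(1,2)] assms(3)] by (simp add: l2_summable)
    show "(\<lambda>n. 3 * ((cmod (a n))\<^sup>2 + (cmod (b n))\<^sup>2 + (cmod (c n))\<^sup>2)) summable_on UNIV"
      using assms by (intro summable_on_cmult_right summable_on_add) (auto simp: l2_summable)
    fix n
    have "cmod (a n + b n + c n) \<le> cmod (a n) + cmod (b n) + cmod (c n)"
      using norm_triangle_ineq[of "a n + b n" "c n"] norm_triangle_ineq[of "a n" "b n"] by linarith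
    then have "(cmod (a n + b n + c n))\<^sup>2 \<le> (cmod (a n) + cmod (b n) + cmod (c n))\<^sup>2"
      by (intro power_mono) auto
    also have "\<dots> \<le> 3 * ((cmod (a n))\<^sup>2 + (cmod (b n))\<^sup>2 + (cmod (c n))\<^sup>2)"
      using sum_squares_bound[of "cmod (a n)" "cmod (b n)"] sum_squares_bound[of "cmod (a n)" "cmod (c n)"]
        sum_squares_bound[of "cmod (b n)" "cmod (c n)"]
      by (simp add: power2_eq_square algebra_simps)
    finally show "(cmod (a n + b n + c n))\<^sup>2 \<le> 3 * ((cmod (a n))\<^sup>2 + (cmod (b n))\<^sup>2 + (cmod (c n))\<^sup>2)" .
  qed
  also have "\<dots> = 3 * (sq a + sq b + sq c)"
    using assms unfolding sq_def l2_summable infsum_cmult_right'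
    by (simp only: infsum_add summable_on_add)
  finally show ?thesis .
qed

lemma powi_le_one_nonneg: "0 < \<rho> \<Longrightarrow> \<rho> < 1 \<Longrightarrow> 0 \<le> n \<Longrightarrow> \<rho> powi n \<le> (1::real)"
  by (simp add: power_int_def power_le_one)

text \<open>A finite set of indices carries the norm up to \<open>\<epsilon> / 2\<close>, its
  dilated sum is continuous in the radius, and the omitted terms are nonnegative. The form as an
  eventual statement lets several instances hold at a common radius.\<close>

lemma Abel_l2:
  assumes c: "l2 c" and neg: "\<And>n. n < 0 \<Longrightarrow> c n = 0" and \<epsilon>: "0 < \<epsilon>"
  shows "\<forall>\<^sub>F \<rho> in at_left 1. 0 < \<rho> \<and> \<rho> < 1 \<and> (\<lambda>n. (cmod (c n))\<^sup>2 * \<rho> powi (2 * n)) summable_on UNIV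
     \<and> sq c - \<epsilon> < (\<Sum>\<^sub>\<infinity>n. (cmod (c n))\<^sup>2 * \<rho> powi (2 * n))"
proof -
  obtain F where F: "finite F" "norm ((\<Sum>n\<in>F. (cmod (c n))\<^sup>2) - sq c) \<le> \<epsilon> / 2"
    using infsum_finite_approximation[of "\<lambda>n. (cmod (c n))\<^sup>2" UNIV "\<epsilon> / 2"] c \<epsilon>
    by (auto simp: l2_summable sq_def dist_norm)
  have "((\<lambda>\<rho>. \<Sum>n\<in>F. (cmod (c n))\<^sup>2 * \<rho> powi (2 * n)) \<longlongrightarrow> (\<Sum>n\<in>F. (cmod (c n))\<^sup>2 * 1 powi (2 * n))) (at_left 1)"
    by (intro tendsto_intros) auto
  moreover have "sq c - \<epsilon> < (\<Sum>n\<in>F. (cmod (c n))\<^sup>2 * 1 powi (2 * n))"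
  proof -
    have "\<bar>(\<Sum>n\<in>F. (cmod (c n))\<^sup>2) - sq c\<bar> \<le> \<epsilon> / 2" using F(2) by simp
    then show ?thesis unfolding power_int_1_left mult_1_right using \<epsilon> by linarith
  qed
  ultimately have "\<forall>\<^sub>F \<rho> in at_left 1. sq c - \<epsilon> < (\<Sum>n\<in>F. (cmod (c n))\<^sup>2 * \<rho> powi (2 * n))"
    by (rule order_tendstoD)
  moreover have "\<forall>\<^sub>F \<rho> in at_left 1. \<rho> \<in> {0<..<1::real}"
    by (rule eventually_at_left_real) simp
  ultimately show ?thesis
  proof eventually_elim
    case (elim \<rho>)
    then have \<rho>: "0 < \<rho>" "\<rho> < 1" by auto
    have s: "(\<lambda>n. (cmod (c n))\<^sup>2 * \<rho> powi (2 * n)) summable_on UNIV"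
    proof (rule summable_on_comparison_test)
      show "(\<lambda>n. (cmod (c n))\<^sup>2) summable_on UNIV" using c by (simp add: l2_summable)
      show "(cmod (c n))\<^sup>2 * \<rho> powi (2 * n) \<le> (cmod (c n))\<^sup>2" for n
        using powi_le_one_nonneg[OF \<rho>, of "2 * n"] neg[of n] by (cases "n < 0") (auto simp: mult_left_le)
    qed (use \<rho> in auto)
    moreover have "(\<Sum>n\<in>F. (cmod (c n))\<^sup>2 * \<rho> powi (2 * n)) \<le> (\<Sum>\<^sub>\<infinity>n. (cmod (c n))\<^sup>2 * \<rho> powi (2 * n))"
      using F(1) \<rho> by (intro finite_sum_le_infsum s) auto
    ultimately show ?case using \<rho> elim by linarith
  qed
qed

text \<open>Since (1 - x)^2 \<le> 1 - x^2 for x in [0, 1], the squared distance to the dilated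
  sequence is at most the loss of squared norm, which \<open>Abel_l2\<close> controls.\<close>

lemma dilate_l2:
  assumes c: "l2 c" and neg: "\<And>n. n < 0 \<Longrightarrow> c n = 0" and \<rho>: "0 < \<rho>" "\<rho> < 1"
    and s: "(\<lambda>n. (cmod (c n))\<^sup>2 * \<rho> powi (2 * n)) summable_on UNIV"
  shows "l2 (\<lambda>n. c n * of_real (\<rho> powi n))"
    and "sq (\<lambda>n. c n - c n * of_real (\<rho> powi n)) \<le> sq c - (\<Sum>\<^sub>\<infinity>n. (cmod (c n))\<^sup>2 * \<rho> powi (2 * n))"
proof -
  have p2: "(\<rho> powi n)\<^sup>2 = \<rho> powi (2 * n)" for n
    by (simp add: mult.commute[of 2] power_int_mult)
  show 1: "l2 (\<lambda>n. c n * of_real (\<rho> powi n))"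
    using s \<rho> by (simp add: l2_summable norm_mult power_mult_distrib p2 norm_power_int)
  have "sq (\<lambda>n. c n - c n * of_real (\<rho> powi n)) \<le> sq c + - (\<Sum>\<^sub>\<infinity>n. (cmod (c n))\<^sup>2 * \<rho> powi (2 * n))"
  proof (rule has_sum_mono)
    show "((\<lambda>n. (cmod (c n - c n * of_real (\<rho> powi n)))\<^sup>2) has_sum sq (\<lambda>n. c n - c n * of_real (\<rho> powi n))) UNIV"
      using l2_diff[OF c 1] by (simp add: l2_summable sq_def)
    show "((\<lambda>n. (cmod (c n))\<^sup>2 + - ((cmod (c n))\<^sup>2 * \<rho> powi (2 * n))) has_sum
        (sq c + - (\<Sum>\<^sub>\<infinity>n. (cmod (c n))\<^sup>2 * \<rho> powi (2 * n)))) UNIV"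
      using c s by (intro has_sum_add has_sum_uminus[THEN iffD2]) (auto simp: l2_summable sq_def has_sum_infsum)
    fix n
    show "(cmod (c n - c n * of_real (\<rho> powi n)))\<^sup>2 \<le> (cmod (c n))\<^sup>2 + - ((cmod (c n))\<^sup>2 * \<rho> powi (2 * n))"
    proof (cases "n < 0")
      case False
      define x where "x = \<rho> powi n"
      have x: "0 \<le> x" "x \<le> 1" using False powi_le_one_nonneg[OF \<rho>] \<rho> by (auto simp: x_def)
      have "c n - c n * of_real x = c n * of_real (1 - x)" by (simp add: algebra_simps)
      then have "(cmod (c n - c n * of_real x))\<^sup>2 = (cmod (c n))\<^sup>2 * (1 - x)\<^sup>2"
        using x by (simp only: norm_mult power_mult_distrib norm_of_real power2_abs)
      also have "\<dots> \<le> (cmod (c n))\<^sup>2 * (1 - x\<^sup>2)"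
      proof (rule mult_left_mono)
        have "x * x \<le> x * 1" using x by (intro mult_left_mono) auto
        then show "(1 - x)\<^sup>2 \<le> 1 - x\<^sup>2" by (simp add: power2_eq_square algebra_simps)
      qed simp
      finally show ?thesis by (simp add: x_def p2 right_diff_distrib)
    qed (simp add: neg)
  qed
  then show "sq (\<lambda>n. c n - c n * of_real (\<rho> powi n)) \<le> sq c - (\<Sum>\<^sub>\<infinity>n. (cmod (c n))\<^sup>2 * \<rho> powi (2 * n))" by simp
qed

lemma tay_dilate:
  assumes "h holomorphic_on ball 0 1" "0 < \<rho>" "\<rho> < 1"
  shows "(\<lambda>z. h (of_real \<rho> * z)) holomorphic_on ball 0 1" "tay (\<lambda>z. h (of_real \<rho> * z)) n = tay h n * of_real (\<rho> powi n)"
proof -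
  have in_ball: "cmod (of_real \<rho> * z) < 1" if "cmod z < 1" for z :: complex
    using mult_strict_mono[of \<rho> 1 "cmod z" 1] that assms by (simp add: norm_mult)
  have "(h \<circ> (\<lambda>z. of_real \<rho> * z)) holomorphic_on ball 0 1"
    using in_ball by (intro holomorphic_on_compose_gen[OF _ assms(1)] holomorphic_intros) auto
  then show hol: "(\<lambda>z. h (of_real \<rho> * z)) holomorphic_on ball 0 1" by (simp add: o_def)
  have "laurent_on_circle (1/2) (\<lambda>z. h (of_real \<rho> * z)) (\<lambda>n. tay h n * of_real (\<rho> powi n))"
    unfolding laurent_on_circle_def
  proof (intro allI impI)
    fix z :: complex assume "cmod z = 1 / 2"
    then have "((\<lambda>n. tay h n * (of_real \<rho> * z) powi n) has_sum h (of_real \<rho> * z)) UNIV"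
      by (intro tay_has_sum assms in_ball) auto
    then show "((\<lambda>n. tay h n * of_real (\<rho> powi n) * z powi n) has_sum h (of_real \<rho> * z)) UNIV"
      by (simp add: power_int_mult_distrib mult.assoc)
  qed
  then show "tay (\<lambda>z. h (of_real \<rho> * z)) n = tay h n * of_real (\<rho> powi n)"
    by (subst tay_unique[OF hol, of "1/2"]) auto
qed

lemma tay_diff:
  assumes "g holomorphic_on ball 0 1" "h holomorphic_on ball 0 1"
  shows "tay (\<lambda>z. g z - h z) n = tay g n - tay h n"
  using assms by (simp add: tay_def higher_deriv_diff[of _ "ball 0 1"] diff_divide_distrib)

text \<open>Horner form, following the constructors of \<open>pol\<close>.\<close>

fun tpoly :: "nat \<Rightarrow> (nat \<Rightarrow> complex) \<Rightarrow> lpoly" where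
  "tpoly 0 h = 0"
| "tpoly (Suc m) h = Poly_Mapping.single 0 (h 0) + Poly_Mapping.single 1 1 * tpoly m (\<lambda>k. h (Suc k))"

lemma ev_tpoly: "w \<noteq> 0 \<Longrightarrow> ev w (tpoly m h) = (\<Sum>k<m. h k * w ^ k)"
proof (induction m arbitrary: h)
  case (Suc m)
  then show ?case
    by (subst sum.lessThan_Suc_shift) (simp add: ev_add ev_single ev_single_mult sum_distrib_left mult_ac)
qed (simp add: ev_zero)

lemma (in same_state) pol_tpoly: "\<exists>R. pol R (tpoly m h)"
proof (induction m arbitrary: h)
  case (Suc m)
  obtain R where "pol R (tpoly m (\<lambda>k. h (Suc k)))" using Suc by blast
  then show ?case by (auto intro: pol_Suc)
qed (auto intro: pol_0[of 0])

lemma act_tpoly: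
  assumes f: "f holomorphic_on ball 0 1"
  shows "tay (\<lambda>z. (\<Sum>k<m. h k * z ^ k) * f z) = act (tpoly m h) (tay f)"
proof (rule tay_unique[of _ "1/2"])
  show "(\<lambda>z. (\<Sum>k<m. h k * z ^ k) * f z) holomorphic_on ball 0 1"
    by (intro holomorphic_intros f)
  show "laurent_on_circle (1/2) (\<lambda>z. (\<Sum>k<m. h k * z ^ k) * f z) (act (tpoly m h) (tay f))"
    unfolding laurent_on_circle_def
  proof (intro allI impI)
    fix z :: complex assume z: "cmod z = 1 / 2"
    then have "z \<noteq> 0" by auto
    from has_sum_act[OF tay_has_sum[OF f] this, of "tpoly m h"] z
    show "((\<lambda>n. act (tpoly m h) (tay f) n * z powi n) has_sum (\<Sum>k<m. h k * z ^ k) * f z) UNIV"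
      using \<open>z \<noteq> 0\<close> by (simp add: ev_tpoly)
  qed
qed auto

lemma bounded_dilate_poly_approx:
  assumes q: "q holomorphic_on ball 0 1" and \<rho>: "0 < \<rho>" "\<rho> < 1" and \<delta>: "0 < \<delta>"
  shows "\<exists>m h. \<forall>z. cmod z < 1 \<longrightarrow> cmod (q (of_real \<rho> * z) - (\<Sum>k<m. h k * z ^ k)) \<le> \<delta>"
proof -
  define h where "h k = (deriv ^^ k) q 0 / fact k * of_real \<rho> ^ k" for k
  \<comment> \<open>Convergence of the series at the larger radius \<open>\<rho>'\<close> gives
    absolute convergence at \<open>\<rho>\<close>, hence a tail bound uniform in the disk.\<close>
  obtain \<rho>' where \<rho>': "\<rho> < \<rho>'" "\<rho>' < 1" using \<rho> dense by blast
  have s: "(\<lambda>k. (deriv ^^ k) q 0 / fact k * w ^ k) sums q w" if "cmod w < 1" for w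
    using holomorphic_power_series[OF q, of w] that by simp
  have sm: "summable (\<lambda>k. cmod (h k))"
    unfolding h_def
  proof (rule powser_insidea)
    show "summable (\<lambda>k. (deriv ^^ k) q 0 / fact k * of_real \<rho>' ^ k)"
      using s[of "of_real \<rho>'"] \<rho>' \<rho> by (auto simp: sums_iff)
  qed (use \<rho> \<rho>' in auto)
  then obtain m where m: "\<And>n. n \<ge> m \<Longrightarrow> norm (suminf (\<lambda>k. cmod (h (k + n)))) < \<delta>"
    using suminf_exist_split[OF \<delta> sm] by blast
  have "cmod (q (of_real \<rho> * z) - (\<Sum>k<m. h k * z ^ k)) \<le> \<delta>" if z: "cmod z < 1" for z
  proof -
    have "cmod (of_real \<rho> * z) < 1"
      using mult_strict_mono[of \<rho> 1 "cmod z" 1] z \<rho> by (simp add: norm_mult)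
    from s[OF this] have S: "(\<lambda>k. h k * z ^ k) sums q (of_real \<rho> * z)"
      by (simp add: h_def power_mult_distrib mult_ac)
    have hz: "cmod (h k * z ^ k) \<le> cmod (h k)" for k
      using z by (simp add: norm_mult norm_power mult_left_le power_le_one)
    have sn: "summable (\<lambda>k. cmod (h (k + m)))" using sm by (rule summable_ignore_initial_segment)
    have sn': "summable (\<lambda>k. cmod (h (k + m) * z ^ (k + m)))"
      by (rule summable_comparison_test'[OF sn, of 0]) (use hz in auto)
    have "q (of_real \<rho> * z) - (\<Sum>k<m. h k * z ^ k) = suminf (\<lambda>k. h (k + m) * z ^ (k + m))"
      using S by (subst suminf_minus_initial_segment) (auto simp: sums_iff)
    also have "cmod \<dots> \<le> suminf (\<lambda>k. cmod (h (k + m) * z ^ (k + m)))"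
      by (rule summable_norm[OF sn'])
    also have "\<dots> \<le> suminf (\<lambda>k. cmod (h (k + m)))"
      by (rule suminf_le[OF hz sn' sn])
    also have "\<dots> \<le> \<delta>" using m[of m] by simp
    finally show ?thesis .
  qed
  then show ?thesis by blast
qed

text \<open>With D for dilation, q f - P f splits as (q f - D(q f)) + D q (D f - f) + (D q - P) f.
  The first two terms are small because dilations converge in norm and \<open>q\<close> is bounded,
  the third because a Taylor polynomial P approximates the dilated \<open>q\<close>
  uniformly.\<close>

lemma bounded_mult_poly_approx:
  assumes q: "q holomorphic_on ball 0 1" and B: "\<And>z. cmod z < 1 \<Longrightarrow> cmod (q z) \<le> B"
    and f: "f holomorphic_on ball 0 1" "l2 (tay f)" and \<epsilon>: "0 < \<epsilon>"
  shows "\<exists>m h. sq (\<lambda>n. act (tpoly m h) (tay f) n - tay (\<lambda>z. q z * f z) n) \<le> \<epsilon>"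
proof -
  have B0: "0 \<le> B" by (rule order.trans[OF norm_ge_zero B[of 0]]) simp
  define u where "u z = q z * f z" for z
  have u: "u holomorphic_on ball 0 1" unfolding u_def by (intro holomorphic_intros q f)
  have ul: "l2 (tay u)"
    by (rule hardy_norm_mono[OF u f _ B0]) (use B in \<open>auto simp: u_def norm_mult intro!: mult_right_mono\<close>)
  \<comment> \<open>The 9 is the factor 3 of \<open>sq_add3\<close> times its three summands. Adding
    1 to the square of \<open>B\<close> avoids dividing by 0; \<open>\<delta>\<close> below is
    chosen by the same pattern.\<close>
  define \<epsilon>1 where "\<epsilon>1 = \<epsilon> / (9 * (B\<^sup>2 + 1))"
  have B1: "0 < B\<^sup>2 + 1" by (simp add: add_nonneg_pos)
  have \<epsilon>1: "0 < \<epsilon>1" using \<epsilon> B1 by (simp add: \<epsilon>1_def)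
  have "\<forall>\<^sub>F \<rho> in at_left 1.
     (0 < \<rho> \<and> \<rho> < 1 \<and> (\<lambda>n. (cmod (tay f n))\<^sup>2 * \<rho> powi (2 * n)) summable_on UNIV
       \<and> sq (tay f) - \<epsilon>1 < (\<Sum>\<^sub>\<infinity>n. (cmod (tay f n))\<^sup>2 * \<rho> powi (2 * n)))
   \<and> (0 < \<rho> \<and> \<rho> < 1 \<and> (\<lambda>n. (cmod (tay u n))\<^sup>2 * \<rho> powi (2 * n)) summable_on UNIV
       \<and> sq (tay u) - \<epsilon> / 9 < (\<Sum>\<^sub>\<infinity>n. (cmod (tay u n))\<^sup>2 * \<rho> powi (2 * n)))"
    using \<epsilon> \<epsilon>1 by (intro eventually_conj Abel_l2 f ul) (auto simp: tay_neg)
  from eventually_happens'[OF _ this] obtain \<rho> where \<rho>: "0 < \<rho>" "\<rho> < 1"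
    and sf: "(\<lambda>n. (cmod (tay f n))\<^sup>2 * \<rho> powi (2 * n)) summable_on UNIV"
       "sq (tay f) - \<epsilon>1 < (\<Sum>\<^sub>\<infinity>n. (cmod (tay f n))\<^sup>2 * \<rho> powi (2 * n))"
    and su: "(\<lambda>n. (cmod (tay u n))\<^sup>2 * \<rho> powi (2 * n)) summable_on UNIV"
       "sq (tay u) - \<epsilon> / 9 < (\<Sum>\<^sub>\<infinity>n. (cmod (tay u n))\<^sup>2 * \<rho> powi (2 * n))"
    by (auto simp: trivial_limit_at_left_real)
  define \<delta> where "\<delta> = sqrt (\<epsilon> / (9 * (sq (tay f) + 1)))"
  have sf0: "0 < sq (tay f) + 1" using sq_nonneg[of "tay f"] by linarith
  have \<delta>: "0 < \<delta>" using \<epsilon> sf0 by (simp add: \<delta>_def)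
  obtain m h where mh: "\<And>z. cmod z < 1 \<Longrightarrow> cmod (q (of_real \<rho> * z) - (\<Sum>k<m. h k * z ^ k)) \<le> \<delta>"
    using bounded_dilate_poly_approx[OF q \<rho> \<delta>] by blast
  define P where "P z = (\<Sum>k<m. h k * z ^ k)" for z
  define D where "D g z = g (of_real \<rho> * z)" for g :: "complex \<Rightarrow> complex" and z :: complex
  have holD: "D g holomorphic_on ball 0 1" if "g holomorphic_on ball 0 1" for g
    using tay_dilate(1)[OF that \<rho>] by (simp add: D_def[abs_def])
  have tayD: "tay (D g) = (\<lambda>n. tay g n * of_real (\<rho> powi n))" if "g holomorphic_on ball 0 1" for g
    using tay_dilate(2)[OF that \<rho>] by (auto simp: D_def[abs_def] fun_eq_iff)
  have P: "P holomorphic_on ball 0 1" unfolding P_def[abs_def] by (intro holomorphic_intros)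
  define a where "a z = u z - D u z" for z
  define b where "b z = D q z * (D f z - f z)" for z
  define c where "c z = (D q z - P z) * f z" for z
  have ha: "a holomorphic_on ball 0 1" unfolding a_def by (intro holomorphic_intros u holD)
  have fh: "(\<lambda>z. D f z - f z) holomorphic_on ball 0 1" by (intro holomorphic_intros f holD)
  have hb: "b holomorphic_on ball 0 1" unfolding b_def by (intro holomorphic_intros fh q holD)
  have hc: "c holomorphic_on ball 0 1" unfolding c_def by (intro holomorphic_intros f q P holD)
  have in_ball: "cmod (of_real \<rho> * z) < 1" if "cmod z < 1" for z :: complex
    using mult_strict_mono[of \<rho> 1 "cmod z" 1] that \<rho> by (simp add: norm_mult)
  have ta: "tay a = (\<lambda>n. tay u n - tay u n * of_real (\<rho> powi n))"
    unfolding a_def by (rule ext, subst tay_diff[OF u holD[OF u]]) (simp add: tayD[OF u])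
  have la: "l2 (tay a)" unfolding ta by (intro l2_diff ul dilate_l2(1)[OF ul tay_neg \<rho> su(1)])
  have na: "sq (tay a) \<le> \<epsilon> / 9"
    using dilate_l2(2)[OF ul tay_neg \<rho> su(1)] su(2) unfolding ta by linarith
  have tfd: "tay (\<lambda>z. D f z - f z) = (\<lambda>n. - (tay f n - tay f n * of_real (\<rho> powi n)))"
    by (rule ext, subst tay_diff[OF holD[OF f(1)] f(1)]) (simp add: tayD[OF f(1)])
  have lfd: "l2 (tay (\<lambda>z. D f z - f z))"
    unfolding tfd using wl2_scale[OF l2_diff[OF f(2) dilate_l2(1)[OF f(2) tay_neg \<rho> sf(1)]], of "- 1"] by simp
  have nfd: "sq (tay (\<lambda>z. D f z - f z)) \<le> \<epsilon>1"
    unfolding tfd sq_def norm_minus_cancel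
    using dilate_l2(2)[OF f(2) tay_neg \<rho> sf(1)] sf(2) unfolding sq_def by linarith
  have lb: "l2 (tay b)" "sq (tay b) \<le> B\<^sup>2 * sq (tay (\<lambda>z. D f z - f z))"
    unfolding sq_def
    by (rule hardy_norm_mono[OF hb fh lfd _ B0];
        use B in_ball in \<open>auto simp: b_def D_def norm_mult intro!: mult_right_mono\<close>)+
  have "B\<^sup>2 * sq (tay (\<lambda>z. D f z - f z)) \<le> (B\<^sup>2 + 1) * \<epsilon>1"
    using nfd sq_nonneg by (intro mult_mono) auto
  also have "\<dots> = \<epsilon> / 9"
  proof -
    have "x * (\<epsilon> / (9 * x)) = \<epsilon> / 9" if "0 < x" for x using that by simp
    from this[OF B1] show ?thesis by (simp only: \<epsilon>1_def)
  qed
  finally have nb: "sq (tay b) \<le> \<epsilon> / 9" using lb(2) by linarith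
  have lc: "l2 (tay c)" "sq (tay c) \<le> \<delta>\<^sup>2 * sq (tay f)"
    unfolding sq_def
    by (rule hardy_norm_mono[OF hc f _ less_imp_le[OF \<delta>]];
        use mh in \<open>auto simp: c_def D_def P_def norm_mult intro!: mult_right_mono\<close>)+
  have "\<delta>\<^sup>2 * sq (tay f) \<le> \<delta>\<^sup>2 * (sq (tay f) + 1)" by (intro mult_left_mono) auto
  also have "\<dots> = \<epsilon> / 9"
  proof -
    have "\<epsilon> / (9 * x) * x = \<epsilon> / 9" if "0 < x" for x using that by simp
    moreover have "\<delta>\<^sup>2 = \<epsilon> / (9 * (sq (tay f) + 1))"
      unfolding \<delta>_def using \<epsilon> sf0 by (intro real_sqrt_pow2) (auto intro!: divide_nonneg_pos)
    ultimately show ?thesis using sf0 by (simp only:)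
  qed
  finally have nc: "sq (tay c) \<le> \<epsilon> / 9" using lc(2) by linarith
  have "(\<lambda>z. u z - P z * f z) = (\<lambda>z. a z + b z + c z)"
    by (simp add: fun_eq_iff a_def b_def c_def u_def D_def algebra_simps)
  moreover have "tay (\<lambda>z. a z + b z + c z) n = tay a n + tay b n + tay c n" for n
  proof -
    have "(\<lambda>z. a z + b z) holomorphic_on ball 0 1" by (intro holomorphic_intros ha hb)
    then show ?thesis
      using ha hb hc by (simp add: tay_def higher_deriv_add[of _ "ball 0 1"] add_divide_distrib)
  qed
  ultimately have "tay u n - tay (\<lambda>z. P z * f z) n = tay a n + tay b n + tay c n" for n
    using tay_diff[OF u holomorphic_on_mult[OF P f(1)], of n] by (simp only:)
  then have "tay u n - act (tpoly m h) (tay f) n = tay a n + tay b n + tay c n" for n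
    using act_tpoly[OF f(1), of h m] by (simp add: P_def[abs_def])
  then have "sq (\<lambda>n. act (tpoly m h) (tay f) n - tay u n) = sq (\<lambda>n. tay a n + tay b n + tay c n)"
    unfolding sq_def by (metis norm_minus_commute)
  also have "\<dots> \<le> 3 * (sq (tay a) + sq (tay b) + sq (tay c))"
    by (rule sq_add3[OF la lb(1) lc(1)])
  also have "\<dots> \<le> 3 * (\<epsilon> / 9 + \<epsilon> / 9 + \<epsilon> / 9)"
    by (intro mult_left_mono add_mono na nb nc) simp
  also have "\<dots> = \<epsilon>" by simp
  finally show ?thesis unfolding u_def[abs_def] by blast
qed

section \<open>Polynomial multiples of an outer function tending to 1\<close>

abbreviation kdelta :: "int \<Rightarrow> complex" where
  "kdelta \<equiv> (\<lambda>n. if n = 0 then 1 else 0)"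

lemma kdelta_has_sum: "((\<lambda>n::int. h n * kdelta n) has_sum h 0) UNIV" for h :: "int \<Rightarrow> complex"
proof -
  have "((\<lambda>n. h n * kdelta n) has_sum (\<Sum>n\<in>{0}. h n * kdelta n)) {0}"
    by (rule has_sum_finite) auto
  then have "((\<lambda>n. h n * kdelta n) has_sum h 0) {0}" by simp
  then show ?thesis by (rule has_sum_cong_neutral[THEN iffD1, rotated -1]) auto
qed

lemma tay_one: "tay (\<lambda>_. 1) = kdelta"
proof (rule tay_unique[of _ "1/2"])
  show "laurent_on_circle (1/2) (\<lambda>_. 1) kdelta"
    unfolding laurent_on_circle_def using kdelta_has_sum[of "\<lambda>n. z powi n" for z] by (simp add: mult.commute)
qed auto

lemma l2_kdelta: "l2 kdelta"
proof -
  have "(\<lambda>n::int. Re (1 * kdelta n)) summable_on UNIV"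
    by (rule has_sum_imp_summable[OF has_sum_Re[OF kdelta_has_sum]])
  moreover have "Re (1 * kdelta n) = (cmod (kdelta n))\<^sup>2" for n by simp
  ultimately show ?thesis by (simp only: l2_summable)
qed

lemma sq_kdelta: "sq kdelta = 1"
proof -
  have "sq kdelta = (\<Sum>\<^sub>\<infinity>n\<in>{0::int}. (cmod (kdelta n))\<^sup>2)"
    unfolding sq_def by (rule infsum_cong_neutral) auto
  then show ?thesis by simp
qed

text \<open>Used with \<open>sq c \<le> 1\<close>: a coefficient at 0 that is close to 1 then forces
  the whole sequence to be close to that of the constant 1.\<close>

lemma sq_minus_kdelta:
  assumes "l2 c" shows "sq (\<lambda>n. c n - kdelta n) = sq c + 1 - 2 * Re (c 0)"
proof -
  have 1: "((\<lambda>n. (cmod (c n))\<^sup>2) has_sum sq c) UNIV" using assms by (simp add: l2_summable sq_def)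
  have "((\<lambda>n::int. Re ((1 - 2 * of_real (Re (c 0))) * kdelta n)) has_sum Re (1 - 2 * of_real (Re (c 0)))) UNIV"
    by (rule has_sum_Re[OF kdelta_has_sum])
  from has_sum_add[OF 1 this]
  have "((\<lambda>n. (cmod (c n))\<^sup>2 + Re ((1 - 2 * of_real (Re (c 0))) * kdelta n)) has_sum (sq c + 1 - 2 * Re (c 0))) UNIV"
    by (simp add: add_diff_eq)
  moreover have "(cmod (c n))\<^sup>2 + Re ((1 - 2 * of_real (Re (c 0))) * kdelta n) = (cmod (c n - kdelta n))\<^sup>2" for n
    unfolding cmod_power2 by (simp add: power2_eq_square algebra_simps)
  ultimately show ?thesis unfolding sq_def[of "\<lambda>n. c n - kdelta n"] by (intro infsumI) simp
qed

lemma circ_integrable_const: "circ_integrable (\<lambda>_. k)"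
  by (simp add: set_integrable_def)

text \<open>Split \<open>ln \<phi>\<close> into \<open>hi = max (ln \<phi>) (-n)\<close> and \<open>lo \<le> 0\<close>. Then \<open>q = exp (- herg hi)\<close> is bounded,
  \<open>q f = exp (herg lo)\<close> is bounded by \<open>1\<close>, and \<open>(q f) 0\<close> tends to \<open>1\<close>; hence \<open>q f\<close> tends to \<open>1\<close> in norm.\<close>

lemma outer_approx_one:
  assumes f: "outer_disk f" and \<epsilon>: "0 < \<epsilon>"
  shows "\<exists>q B. q holomorphic_on ball 0 1 \<and> (\<forall>z. cmod z < 1 \<longrightarrow> cmod (q z) \<le> B)
     \<and> (\<lambda>z. q z * f z) holomorphic_on ball 0 1 \<and> l2 (tay (\<lambda>z. q z * f z))
     \<and> sq (\<lambda>n. tay (\<lambda>z. q z * f z) n - kdelta n) \<le> \<epsilon>"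
proof -
  obtain \<alpha> \<phi> where \<alpha>: "cmod \<alpha> = 1" and \<phi>: "\<phi> \<in> borel_measurable lborel" "\<And>t. 0 < \<phi> t"
    and int: "circ_integrable (\<lambda>t. ln (\<phi> t))"
    and fz: "\<And>z. cmod z < 1 \<Longrightarrow> f z = \<alpha> * exp (herg (\<lambda>t. ln (\<phi> t)) z)"
    using f unfolding outer_disk_def herg_def herg_kernel_def by auto
  define \<psi> where "\<psi> t = ln (\<phi> t)" for t
  have int: "circ_integrable \<psi>" using int by (simp add: \<psi>_def[abs_def])
  have fhol: "f holomorphic_on ball 0 1" using f by (simp add: outer_disk_def hardy_disk_def)
  define hi where "hi n t = max (\<psi> t) (- real n)" for n t
  define lo where "lo n t = \<psi> t - hi n t" for n t
  have ihi: "circ_integrable (hi n)" for n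
  proof -
    have "integrable lborel (\<lambda>t. max (indicator {0..2*pi} t *\<^sub>R \<psi> t) (indicator {0..2*pi} t *\<^sub>R (- real n)))"
      using int circ_integrable_const[of "- real n"] unfolding set_integrable_def by (rule integrable_max)
    moreover have "max (indicator {0..2*pi} t *\<^sub>R \<psi> t) (indicator {0..2*pi} t *\<^sub>R (- real n)) = indicator {0..2*pi} t *\<^sub>R hi n t" for t
      by (auto simp: hi_def indicator_def)
    ultimately show ?thesis unfolding set_integrable_def by simp
  qed
  have ilo: "circ_integrable (lo n)" for n
    unfolding lo_def by (intro set_integral_diff int ihi)
  define q where "q n z = cnj \<alpha> * exp (- herg (hi n) z)" for n z
  have q_hol: "q n holomorphic_on ball 0 1" for n
    unfolding q_def by (intro holomorphic_intros herg_holomorphic ihi)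
  have q_bound: "cmod (q n z) \<le> exp (real n)" if "cmod z < 1" for n z
  proof -
    have "Re (herg (\<lambda>_. - real n) z) \<le> Re (herg (hi n) z)"
      by (intro Re_herg_mono circ_integrable_const ihi that AE_I2) (simp add: hi_def)
    then show ?thesis using \<alpha> that by (simp add: q_def norm_mult herg_const)
  qed
  have qf: "q n z * f z = exp (herg (lo n) z)" if z: "cmod z < 1" for n z
  proof -
    have "\<psi> = (\<lambda>t. lo n t + hi n t)" by (simp add: lo_def fun_eq_iff)
    then have "herg \<psi> z = herg (lo n) z + herg (hi n) z"
      using herg_add[OF ilo ihi z, of n n] by simp
    moreover have "f z = \<alpha> * exp (herg \<psi> z)" using fz[OF z] by (simp add: \<psi>_def[abs_def])
    moreover have "cnj \<alpha> * \<alpha> = 1" using \<alpha> complex_norm_square[of \<alpha>] by (simp add: mult.commute)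
    moreover have "cnj \<alpha> * exp (- H) * (\<alpha> * exp (L + H)) = (cnj \<alpha> * \<alpha>) * exp L" for L H
      by (simp add: exp_add exp_minus field_simps)
    ultimately show ?thesis by (simp add: q_def)
  qed
  define u where "u n z = q n z * f z" for n z
  have u_hol: "u n holomorphic_on ball 0 1" for n
    unfolding u_def by (intro holomorphic_intros q_hol fhol)
  have u_le: "cmod (u n z) \<le> 1 * cmod 1" if "cmod z < 1" for n z
  proof -
    have "Re (herg (lo n) z) \<le> Re (herg (\<lambda>_. 0) z)"
      by (intro Re_herg_mono circ_integrable_const ilo that AE_I2) (simp add: lo_def hi_def)
    then show ?thesis using that by (simp add: u_def qf herg_const)
  qed
  have one: "(\<lambda>_. 1 :: complex) holomorphic_on ball 0 1" "l2 (tay (\<lambda>_. 1))"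
    unfolding tay_one by (auto intro: l2_kdelta)
  have u_l2: "l2 (tay (u n))" for n
    using hardy_norm_mono(1)[OF u_hol one u_le] by simp
  have u_sq: "sq (tay (u n)) \<le> 1" for n
    using hardy_norm_mono(2)[OF u_hol one u_le] sq_kdelta unfolding tay_one sq_def by simp
  define m where "m n = (LINT t:{0..2*pi}|lborel. lo n t) / (2 * pi)" for n
  have u0: "tay (u n) 0 = of_real (exp (m n))" for n
  proof -
    have "tay (u n) 0 = exp (herg (lo n) 0)" by (simp add: tay_def u_def qf)
    then show ?thesis unfolding herg_at_0 m_def exp_of_real .
  qed
  have "(\<lambda>n. LINT t:{0..2*pi}|lborel. lo n t) \<longlonglongrightarrow> (LINT t:{0..2*pi}|lborel. 0)"
    unfolding set_lebesgue_integral_def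
  proof (rule integral_dominated_convergence)
    show "integrable lborel (\<lambda>t. norm (indicator {0..2*pi} t *\<^sub>R \<psi> t))"
      using int unfolding set_integrable_def by (rule integrable_norm)
    show "(\<lambda>t. indicator {0..2*pi} t *\<^sub>R lo n t) \<in> borel_measurable lborel" for n
      using ilo[of n] unfolding set_integrable_def by (rule borel_measurable_integrable)
    show "AE t in lborel. norm (indicator {0..2*pi} t *\<^sub>R lo n t) \<le> norm (indicator {0..2*pi} t *\<^sub>R \<psi> t)" for n
      by (intro AE_I2) (auto simp: indicator_def lo_def hi_def)
    show "AE t in lborel. (\<lambda>n. indicator {0..2*pi} t *\<^sub>R lo n t) \<longlonglongrightarrow> indicator {0..2*pi} t *\<^sub>R 0"
    proof (rule AE_I2)
      fix t
      obtain N where N: "- \<psi> t \<le> real N" using real_arch_simple by blast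
      have "\<forall>\<^sub>F n in sequentially. indicator {0..2*pi} t *\<^sub>R lo n t = indicator {0..2*pi} t *\<^sub>R 0"
        using eventually_ge_at_top[of N] by eventually_elim (use N in \<open>auto simp: lo_def hi_def\<close>)
      then show "(\<lambda>n. indicator {0..2*pi} t *\<^sub>R lo n t) \<longlonglongrightarrow> indicator {0..2*pi} t *\<^sub>R 0"
        by (rule tendsto_eventually)
    qed
  qed simp
  then have "m \<longlonglongrightarrow> 0 / (2 * pi)" unfolding m_def[abs_def] by (intro tendsto_intros) auto
  then have "(\<lambda>n. 2 - 2 * exp (m n)) \<longlonglongrightarrow> 2 - 2 * exp (0 / (2 * pi))" by (intro tendsto_intros)
  then have "\<forall>\<^sub>F n in sequentially. 2 - 2 * exp (m n) < \<epsilon>" using \<epsilon> by (intro order_tendstoD(2)) auto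
  then obtain n where n: "2 - 2 * exp (m n) < \<epsilon>" by (auto simp: eventually_sequentially)
  have "sq (\<lambda>k. tay (u n) k - kdelta k) \<le> \<epsilon>"
    using sq_minus_kdelta[OF u_l2, of n] u_sq[of n] n unfolding u0 by simp
  then show ?thesis
    using q_hol[of n] q_bound[where n = n] u_hol[of n] u_l2[of n] unfolding u_def[abs_def] by blast
qed

lemma outer_poly_approx_one:
  assumes f: "outer_disk f" and \<epsilon>: "0 < \<epsilon>"
  shows "\<exists>m h. sq (\<lambda>n. act (tpoly m h) (tay f) n - kdelta n) \<le> \<epsilon>"
proof -
  have fhol: "f holomorphic_on ball 0 1" and fl2: "l2 (tay f)"
    using f by (auto simp: outer_disk_def hardy_disk_iff)
  obtain q B where q: "q holomorphic_on ball 0 1" "\<And>z. cmod z < 1 \<Longrightarrow> cmod (q z) \<le> B"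
    "l2 (tay (\<lambda>z. q z * f z))" "sq (\<lambda>n. tay (\<lambda>z. q z * f z) n - kdelta n) \<le> \<epsilon> / 6"
    using outer_approx_one[OF f, of "\<epsilon> / 6"] \<epsilon> by auto
  obtain m h where mh: "sq (\<lambda>n. act (tpoly m h) (tay f) n - tay (\<lambda>z. q z * f z) n) \<le> \<epsilon> / 6"
    using bounded_mult_poly_approx[OF q(1,2) fhol fl2, of "\<epsilon> / 6"] \<epsilon> by auto
  have l2a: "l2 (act (tpoly m h) (tay f))"
    by (rule shift_weight.wl2_act[OF shift_weight_one fl2])
  \<comment> \<open>The summand 0 lets \<open>sq_add3\<close> serve for a sum of two; hence the two
    errors \<open>\<epsilon> / 6\<close>.\<close>
  have "sq (\<lambda>n. (act (tpoly m h) (tay f) n - tay (\<lambda>z. q z * f z) n) + (tay (\<lambda>z. q z * f z) n - kdelta n) + 0)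
    \<le> 3 * (sq (\<lambda>n. act (tpoly m h) (tay f) n - tay (\<lambda>z. q z * f z) n) + sq (\<lambda>n. tay (\<lambda>z. q z * f z) n - kdelta n) + sq (\<lambda>_. 0))"
    by (intro sq_add3 l2_diff l2a q l2_kdelta wl2_zero)
  also have "\<dots> \<le> \<epsilon>" using mh q(4) by (simp add: sq_def)
  finally have "sq (\<lambda>n. act (tpoly m h) (tay f) n - kdelta n) \<le> \<epsilon>" by simp
  then show ?thesis by blast
qed

lemma cmod_le_sq: assumes "l2 e" shows "(cmod (e n))\<^sup>2 \<le> sq e"
  using finite_sum_le_infsum[of "\<lambda>n. (cmod (e n))\<^sup>2" UNIV "{n}"] assms by (simp add: l2_summable sq_def)

lemma sq_shift: "sq (\<lambda>n. e (n - k)) = sq e"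
  unfolding sq_def using infsum_reindex_bij_betw[OF shift_bij(1), of "\<lambda>n. (cmod (e n))\<^sup>2" k] by simp

text \<open>Cruder than Cauchy-Schwarz, but sufficient where both arguments tend to 0.\<close>

lemma cmod_wip_le: assumes "l2 a" "l2 b" shows "cmod (wip (\<lambda>_. 1) a b) \<le> sq a + sq b"
proof -
  have s: "(\<lambda>n. (cmod (a n))\<^sup>2 + (cmod (b n))\<^sup>2) summable_on UNIV"
    using assms by (intro summable_on_add) (auto simp: l2_summable)
  have W: "((\<lambda>n. a n * cnj (b n)) has_sum wip (\<lambda>_. 1) a b) UNIV"
    using wip_summable[of "\<lambda>_. 1" a b] assms by (simp add: wip_def)
  have S: "((\<lambda>n. (cmod (a n))\<^sup>2 + (cmod (b n))\<^sup>2) has_sum (sq a + sq b)) UNIV"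
    using assms by (intro has_sum_add) (auto simp: l2_summable sq_def)
  have le: "cmod (a n * cnj (b n)) \<le> (cmod (a n))\<^sup>2 + (cmod (b n))\<^sup>2" for n
    using mult_le_sum_squares[OF norm_ge_zero norm_ge_zero] by (simp add: norm_mult)
  have n: "(\<lambda>n. cmod (a n * cnj (b n))) summable_on UNIV"
    by (rule summable_on_comparison_test[OF s le]) simp
  have "cmod (wip (\<lambda>_. 1) a b) \<le> (\<Sum>\<^sub>\<infinity>n. cmod (a n * cnj (b n)))"
    by (rule norm_has_sum_bound[OF has_sum_infsum[OF n] W])
  also have "\<dots> \<le> sq a + sq b" by (rule has_sum_mono[OF has_sum_infsum[OF n] S le])
  finally show ?thesis .
qed

theorem outer_disk_imp_free_outer:
  assumes r: "0 < r" "r < 1" and w: "w \<in> annulus r" and f: "outer_disk f"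
  shows "free_outer r w f"
proof -
  have fH: "f \<in> hardy_disk" using f by (simp add: outer_disk_def)
  then have fhol: "f holomorphic_on ball 0 1" and fl2: "l2 (tay f)"
    by (auto simp: hardy_disk_iff)
  have w': "r < cmod w" "cmod w < 1" using w by (auto simp: annulus_def)
  have w0: "w \<noteq> 0" using w' r by auto
  have fw: "f w \<noteq> 0" using f w' unfolding outer_disk_def by auto
  have "\<exists>m h. sq (\<lambda>n. act (tpoly m h) (tay f) n - kdelta n) \<le> 1 / (real i + 1)" for i
    by (rule outer_poly_approx_one[OF f]) simp
  then obtain m h where mh: "\<And>i. sq (\<lambda>n. act (tpoly (m i) (h i)) (tay f) n - kdelta n) \<le> 1 / (real i + 1)"
    by metis
  define \<pi> where "\<pi> i = tpoly (m i) (h i)" for i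
  define e where "e i n = act (\<pi> i) (tay f) n - kdelta n" for i n
  have v: "act (\<pi> i) (tay f) n = kdelta n + e i n" for i n by (simp add: e_def)
  have vl2: "l2 (act (\<pi> i) (tay f))" for i by (rule shift_weight.wl2_act[OF shift_weight_one fl2])
  have el2: "l2 (e i)" for i unfolding e_def[abs_def] by (intro l2_diff vl2 l2_kdelta)
  have sh: "l2 (\<lambda>n. c (n - k))" if "l2 c" for c k
    by (rule shift_weight.wl2_shift[OF shift_weight_one that])
  have lim0: "(\<lambda>i. 1 / (real i + 1)) \<longlonglongrightarrow> 0" by real_asymp
  have sqe: "(\<lambda>i. sq (e i)) \<longlonglongrightarrow> 0"
    by (rule tendsto_sandwich[OF _ _ tendsto_const lim0])
      (use mh sq_nonneg in \<open>auto simp: e_def[abs_def] \<pi>_def\<close>)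
  have en: "(\<lambda>i. e i n) \<longlonglongrightarrow> 0" for n
  proof -
    have "(\<lambda>i. (cmod (e i n))\<^sup>2) \<longlonglongrightarrow> 0"
      by (rule tendsto_sandwich[OF _ _ tendsto_const sqe]) (use cmod_le_sq[OF el2] in auto)
    then have "(\<lambda>i. sqrt ((cmod (e i n))\<^sup>2)) \<longlonglongrightarrow> sqrt 0" by (rule tendsto_real_sqrt)
    then show ?thesis by (simp add: tendsto_norm_zero_iff)
  qed
  \<comment> \<open>The coefficients of \<open>\<pi> i\<close> times f are
    \<open>kdelta + e i\<close>, so in the limit the shifted pairings become those of the constant
    1, whose shifts are orthonormal.\<close>
  have wlim: "(\<lambda>i. wip (\<lambda>_. 1) (\<lambda>n. act (\<pi> i) (tay f) (n - k)) (act (\<pi> i) (tay f))) \<longlonglongrightarrow> kdelta k" for k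
  proof -
    have "wip (\<lambda>_. 1) (\<lambda>n. act (\<pi> i) (tay f) (n - k)) (act (\<pi> i) (tay f))
       = (kdelta k + cnj (e i k)) + (e i (- k) + wip (\<lambda>_. 1) (\<lambda>n. e i (n - k)) (e i))" for i
    proof -
      have dk: "wip (\<lambda>_. 1) (\<lambda>n. kdelta (n - k)) b = cnj (b k)" for b
      proof -
        have "((\<lambda>n. cnj (b (n + k)) * kdelta n) has_sum cnj (b (0 + k))) UNIV" by (rule kdelta_has_sum)
        then have "((\<lambda>n. cnj (b (n + k)) * kdelta n) has_sum cnj (b k)) UNIV" by simp
        then have "((\<lambda>n. cnj (b n) * kdelta (n - k)) has_sum cnj (b k)) UNIV"
          using has_sum_reindex_bij_betw[OF shift_bij(1), of "\<lambda>n. cnj (b (n + k)) * kdelta n" k] by simp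
        then show ?thesis unfolding wip_def by (intro infsumI) (simp add: mult.commute)
      qed
      have kd: "wip (\<lambda>_. 1) b kdelta = b 0" for b
        unfolding wip_def using infsumI[OF kdelta_has_sum[of b]] by (simp add: if_distrib cong: if_cong)
      have ee: "wip (\<lambda>_. 1) (\<lambda>n. e i (n - k)) (\<lambda>n. kdelta n + e i n)
        = e i (- k) + wip (\<lambda>_. 1) (\<lambda>n. e i (n - k)) (e i)"
      proof -
        have "wip (\<lambda>_. 1) (\<lambda>n. e i (n - k)) (\<lambda>n. kdelta n + e i n)
          = cnj (wip (\<lambda>_. 1) (\<lambda>n. kdelta n + e i n) (\<lambda>n. e i (n - k)))" by (rule wip_cnj)
        also have "\<dots> = cnj (wip (\<lambda>_. 1) kdelta (\<lambda>n. e i (n - k))) + cnj (wip (\<lambda>_. 1) (e i) (\<lambda>n. e i (n - k)))"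
          by (subst wip_add) (auto intro: l2_kdelta el2 sh[OF el2])
        also have "\<dots> = e i (- k) + wip (\<lambda>_. 1) (\<lambda>n. e i (n - k)) (e i)"
          unfolding wip_cnj[of _ kdelta, symmetric]
          using wip_cnj[of "\<lambda>_. 1" "\<lambda>n. e i (n - k)" kdelta] wip_cnj[of "\<lambda>_. 1" "\<lambda>n. e i (n - k)" "e i"]
            kd[of "\<lambda>n. e i (n - k)"] by simp
        finally show ?thesis .
      qed
      show ?thesis unfolding v
        by (subst wip_add) (auto intro: sh[OF l2_kdelta] sh[OF el2] l2_add l2_kdelta el2 simp only: dk ee complex_cnj_add complex_cnj_one complex_cnj_zero if_distrib[of cnj])
    qed
    moreover have "(\<lambda>i. (kdelta k + cnj (e i k)) + (e i (- k) + wip (\<lambda>_. 1) (\<lambda>n. e i (n - k)) (e i)))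
      \<longlonglongrightarrow> (kdelta k + cnj 0) + (0 + 0)"
    proof (intro tendsto_intros en)
      have "(\<lambda>i. sq (e i) + sq (e i)) \<longlonglongrightarrow> 0 + 0" by (intro tendsto_intros sqe)
      then have "(\<lambda>i. sq (e i) + sq (e i)) \<longlonglongrightarrow> 0" by simp
      then show "(\<lambda>i. wip (\<lambda>_. 1) (\<lambda>n. e i (n - k)) (e i)) \<longlonglongrightarrow> 0"
      proof (rule Lim_null_comparison[rotated], intro always_eventually allI)
        show "norm (wip (\<lambda>_. 1) (\<lambda>n. e i (n - k)) (e i)) \<le> sq (e i) + sq (e i)" for i
          using cmod_wip_le[OF sh[OF el2[of i], of k] el2[of i]] unfolding sq_shift .
      qed
    qed
    ultimately show ?thesis by simp
  qed
  \<comment> \<open>The error \<open>e i\<close> has no negative coefficients, so its annulus norm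
    is its l2 norm and \<open>point_evaluation_bound\<close> turns norm convergence into convergence
    at \<open>w\<close>.\<close>
  have evlim: "(\<lambda>i. ev w (\<pi> i)) \<longlonglongrightarrow> 1 / f w"
  proof -
    define \<kappa> where "\<kappa> = (1 / (1 - (cmod w)\<^sup>2) + (r\<^sup>2 / (cmod w)\<^sup>2) / (1 - r\<^sup>2 / (cmod w)\<^sup>2))"
    have "(cmod (ev w (\<pi> i) * f w - 1))\<^sup>2 \<le> \<kappa> * sq (e i)" for i
    proof -
      have neg: "e i n = 0" if "n < 0" for n
      proof -
        have "act (\<pi> i) (tay f) n = 0"
          unfolding \<pi>_def act_tpoly[OF fhol, symmetric] using that by (rule tay_neg)
        then show ?thesis using that by (simp add: e_def)
      qed
      have wt: "weight r n * (cmod (e i n))\<^sup>2 = (cmod (e i n))\<^sup>2" for n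
        using neg[of n] by (auto simp: weight_def)
      have "((\<lambda>n. act (\<pi> i) (tay f) n * w powi n) has_sum ev w (\<pi> i) * f w) UNIV"
        by (rule has_sum_act[OF tay_has_sum[OF fhol w'(2)] w0])
      moreover have "((\<lambda>n. - (w powi n * kdelta n)) has_sum - 1) UNIV"
        using kdelta_has_sum[of "\<lambda>n. w powi n"] by (simp add: has_sum_uminus)
      ultimately have "((\<lambda>n. act (\<pi> i) (tay f) n * w powi n + - (w powi n * kdelta n)) has_sum (ev w (\<pi> i) * f w + - 1)) UNIV"
        by (rule has_sum_add)
      then have "((\<lambda>n. e i n * w powi n) has_sum (ev w (\<pi> i) * f w - 1)) UNIV"
        by (simp add: e_def algebra_simps)
      from point_evaluation_bound[OF r(1) w' _ this] show ?thesis
        using el2[of i] unfolding wl2_def wt \<kappa>_def sq_def by simp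
    qed
    moreover have "(\<lambda>i. \<kappa> * sq (e i)) \<longlonglongrightarrow> \<kappa> * 0" by (intro tendsto_intros sqe)
    then have "(\<lambda>i. \<kappa> * sq (e i)) \<longlonglongrightarrow> 0" by simp
    ultimately have "(\<lambda>i. (cmod (ev w (\<pi> i) * f w - 1))\<^sup>2) \<longlonglongrightarrow> 0"
      by (intro tendsto_sandwich[OF _ _ tendsto_const \<open>(\<lambda>i. \<kappa> * sq (e i)) \<longlonglongrightarrow> 0\<close>]) auto
    then have "(\<lambda>i. sqrt ((cmod (ev w (\<pi> i) * f w - 1))\<^sup>2)) \<longlonglongrightarrow> sqrt 0" by (rule tendsto_real_sqrt)
    then have "(\<lambda>i. ev w (\<pi> i) * f w - 1) \<longlonglongrightarrow> 0" by (simp add: tendsto_norm_zero_iff)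
    then have "(\<lambda>i. ((ev w (\<pi> i) * f w - 1) + 1) / f w) \<longlonglongrightarrow> (0 + 1) / f w"
      using fw by (intro tendsto_intros)
    then show ?thesis using fw by simp
  qed
  have "cmod (g w) \<le> cmod (f w)" if g: "g \<in> Eset r f" for g
  proof -
    interpret same_state r "tay f" "laurent_coeffs r g"
      by (rule Eset_same_state[OF r fH g])
    have "g \<in> H2_annulus r" using g by (simp add: Eset_def)
    then have gs: "((\<lambda>n. laurent_coeffs r g n * w powi n) has_sum g w) UNIV"
      using H2D(1)[OF r] w by (auto simp: is_laurent_def)
    show ?thesis
    proof (rule extremal[OF w' gs _ _ _ evlim fw])
      show "\<exists>R. pol R (\<pi> i)" for i unfolding \<pi>_def by (rule pol_tpoly)
      have "(\<lambda>i. Re (wip (\<lambda>_. 1) (\<lambda>n. act (\<pi> i) (tay f) (n - 0)) (act (\<pi> i) (tay f)))) \<longlonglongrightarrow> Re (kdelta 0)"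
        by (intro tendsto_intros wlim)
      then show "(\<lambda>i. M.q (\<pi> i)) \<longlonglongrightarrow> 1" by (simp add: M.q_def lform_def)
      show "(\<lambda>i. lform (\<lambda>_. 1) (tay f) (z ^ Suc k * \<pi> i) (\<pi> i)) \<longlonglongrightarrow> 0" for k
      proof -
        have "z ^ Suc k = Poly_Mapping.single (int (Suc k)) 1"
          by (induction k) (simp_all add: mult_single add.commute)
        then show ?thesis using wlim[of "int (Suc k)"]
          by (simp add: lform_def act_single_mult[abs_def])
      qed
    qed
  qed
  then show ?thesis using free_outer_iff[OF r w hardy_disk_H2(1)[OF r fH]] by blast
qed

section \<open>Poisson majorants of the logarithm of the modulus\<close>

text \<open>Products of real parts produce terms with a conjugate. On the circle these are again
  real parts of polynomials, because each pair \<open>\<zeta> * cnj \<zeta>\<close> cancels to 1 and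
  a lone conjugated factor can be conjugated back under \<open>Re\<close>.\<close>

lemma Re_poly_mult_cnj:
  "\<exists>p. \<forall>\<zeta>. cmod \<zeta> = 1 \<longrightarrow> Re (poly p1 \<zeta> * cnj (poly p2 \<zeta>)) = Re (poly p \<zeta>)"
proof (induction p1 arbitrary: p2)
  case 0
  show ?case by (intro exI[of _ 0]) simp
next
  case (pCons a p1)
  obtain b p2' where p2: "p2 = pCons b p2'" by (cases p2)
  obtain p where p: "\<And>\<zeta>. cmod \<zeta> = 1 \<Longrightarrow> Re (poly p1 \<zeta> * cnj (poly p2' \<zeta>)) = Re (poly p \<zeta>)"
    using pCons.IH by blast
  show ?case
  proof (intro exI[of _ "smult (cnj a) p2 + (smult (cnj b) (pCons 0 p1) + p)"] allI impI)
    fix \<zeta> :: complex assume \<zeta>: "cmod \<zeta> = 1"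
    then have "\<zeta> * cnj \<zeta> = 1" using complex_norm_square[of \<zeta>] by simp
    have "poly (pCons a p1) \<zeta> * cnj (poly p2 \<zeta>)
      = a * cnj (poly p2 \<zeta>) + (cnj b * \<zeta> * poly p1 \<zeta> + (\<zeta> * cnj \<zeta>) * (poly p1 \<zeta> * cnj (poly p2' \<zeta>)))"
      by (simp add: p2 algebra_simps)
    then have "Re (poly (pCons a p1) \<zeta> * cnj (poly p2 \<zeta>))
      = Re (a * cnj (poly p2 \<zeta>)) + (Re (cnj b * \<zeta> * poly p1 \<zeta>) + Re (poly p1 \<zeta> * cnj (poly p2' \<zeta>)))"
      unfolding \<open>\<zeta> * cnj \<zeta> = 1\<close> by (simp only: plus_complex.sel mult_1_left)
    also have "Re (a * cnj (poly p2 \<zeta>)) = Re (cnj a * poly p2 \<zeta>)" by simp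
    finally show "Re (poly (pCons a p1) \<zeta> * cnj (poly p2 \<zeta>))
      = Re (poly (smult (cnj a) p2 + (smult (cnj b) (pCons 0 p1) + p)) \<zeta>)"
      unfolding p[OF \<zeta>] by (simp only: poly_add poly_smult poly_pCons plus_complex.sel add_0_left mult.assoc)
  qed
qed

lemma real_polynomial_function_circle:
  fixes g :: "complex \<Rightarrow> real"
  assumes "real_polynomial_function g"
  shows "\<exists>p. \<forall>\<zeta>. cmod \<zeta> = 1 \<longrightarrow> g \<zeta> = Re (poly p \<zeta>)"
  using assms
proof (induction rule: real_polynomial_function.induct)
  case (linear g)
  interpret bounded_linear g by fact
  have "g z = Re (poly [:0, of_real (g 1) - \<i> * of_real (g \<i>):] z)" for z
  proof -
    have "z = Re z *\<^sub>R 1 + Im z *\<^sub>R \<i>" by (simp add: complex_eq_iff)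
    then have "g z = Re z * g 1 + Im z * g \<i>" by (metis add scaleR real_scaleR_def)
    then show ?thesis by (simp add: algebra_simps)
  qed
  then show ?case by blast
next
  case (const c)
  show ?case by (intro exI[of _ "[:of_real c:]"]) simp
next
  case (add f g)
  then obtain p1 p2 where "\<And>\<zeta>. cmod \<zeta> = 1 \<Longrightarrow> f \<zeta> = Re (poly p1 \<zeta>)" "\<And>\<zeta>. cmod \<zeta> = 1 \<Longrightarrow> g \<zeta> = Re (poly p2 \<zeta>)"
    by blast
  then show ?case by (intro exI[of _ "p1 + p2"]) simp
next
  case (mult f g)
  then obtain p1 p2 where p: "\<And>\<zeta>. cmod \<zeta> = 1 \<Longrightarrow> f \<zeta> = Re (poly p1 \<zeta>)" "\<And>\<zeta>. cmod \<zeta> = 1 \<Longrightarrow> g \<zeta> = Re (poly p2 \<zeta>)"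
    by blast
  obtain p3 where p3: "\<And>\<zeta>. cmod \<zeta> = 1 \<Longrightarrow> Re (poly p1 \<zeta> * cnj (poly p2 \<zeta>)) = Re (poly p3 \<zeta>)"
    using Re_poly_mult_cnj by blast
  show ?case
  proof (intro exI[of _ "smult (1/2) (p1 * p2 + p3)"] allI impI)
    fix \<zeta> :: complex assume \<zeta>: "cmod \<zeta> = 1"
    have "Re (poly (smult (1/2) (p1 * p2 + p3)) \<zeta>) = (Re (poly p1 \<zeta> * poly p2 \<zeta>) + Re (poly p1 \<zeta> * cnj (poly p2 \<zeta>))) / 2"
      unfolding p3[OF \<zeta>] by simp
    also have "\<dots> = f \<zeta> * g \<zeta>" by (simp add: p \<zeta>)
    finally show "f \<zeta> * g \<zeta> = Re (poly (smult (1/2) (p1 * p2 + p3)) \<zeta>)" ..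
  qed
qed

text \<open>Stone-Weierstrass yields a real polynomial in the two coordinates, which need not be
  harmonic. Rewriting it on the circle as \<open>Re (poly p \<zeta>)\<close> supplies a harmonic
  extension together with its conjugate, as needed for multiplying by
  \<open>exp (- poly p \<zeta>)\<close>.\<close>

lemma circle_trig_approx:
  fixes v :: "complex \<Rightarrow> real"
  assumes "continuous_on (sphere 0 1) v" "0 < \<delta>"
  shows "\<exists>p. \<forall>\<zeta>. cmod \<zeta> = 1 \<longrightarrow> \<bar>v \<zeta> - Re (poly p \<zeta>)\<bar> < \<delta>"
proof -
  obtain g where g: "polynomial_function g" "\<And>\<zeta>. \<zeta> \<in> sphere 0 1 \<Longrightarrow> norm (v \<zeta> - g \<zeta>) < \<delta>"
    using Stone_Weierstrass_polynomial_function[OF compact_sphere assms] by blast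
  then have "real_polynomial_function g" by (simp add: real_polynomial_function_eq)
  from real_polynomial_function_circle[OF this] g(2) show ?thesis by fastforce
qed

lemma circ_integrable_continuous:
  "continuous_on UNIV \<psi> \<Longrightarrow> circ_integrable \<psi>"
  using borel_integrable_atLeastAtMost'[of 0 "2 * pi" \<psi>] continuous_on_subset by blast

lemma poly_laurent_on_circle:
  "laurent_on_circle \<rho> (poly p) (\<lambda>k. if k < 0 then 0 else coeff p (nat k))"
  unfolding laurent_on_circle_def
proof (intro allI impI)
  fix z :: complex
  have "((\<lambda>n. coeff p n * z ^ n) has_sum poly p z) {..degree p}"
    by (rule has_sum_finiteI) (auto simp: poly_altdef)
  then have "((\<lambda>n. coeff p n * z ^ n) has_sum poly p z) UNIV"
    by (rule has_sum_cong_neutral[THEN iffD1, rotated -1]) (auto simp: coeff_eq_0 not_le)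
  then show "((\<lambda>k. (if k < 0 then 0 else coeff p (nat k)) * z powi k) has_sum poly p z) UNIV"
    by (subst has_sum_int_nat) auto
qed

lemma powi_laurent_on_circle:
  "laurent_on_circle \<rho> (\<lambda>z. z powi m) (\<lambda>k. if k = m then 1 else 0)"
  unfolding laurent_on_circle_def
proof (intro allI impI)
  fix z :: complex
  have "((\<lambda>k. (if k = m then 1 else 0) * z powi k) has_sum z powi m) {m}"
    by (rule has_sum_finiteI) auto
  then show "((\<lambda>k. (if k = m then 1 else 0) * z powi k) has_sum z powi m) UNIV"
    by (rule has_sum_cong_neutral[THEN iffD1, rotated -1]) auto
qed

lemma poly_fourier_coeff:
  "((\<lambda>t. cis (of_int (- m) * t) * poly p (cis t)) has_integral
     2 * of_real pi * (if m < 0 then 0 else coeff p (nat m))) {0..2*pi}"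
proof -
  let ?c = "\<lambda>k. if k < 0 then 0 else coeff p (nat k)"
  note P = circle_parseval[OF zero_less_one poly_laurent_on_circle[of 1 p] powi_laurent_on_circle[of 1 m]]
  have e: "poly p (of_real 1 * cis t) * cnj ((of_real 1 * cis t) powi m) = cis (of_int (- m) * t) * poly p (cis t)" for t
    by (simp add: cis_power_int cis_cnj)
  have "((\<lambda>n. ?c n * cnj (if n = m then 1 else 0) * of_real (1 powi (2 * n))) has_sum ?c m) {m}"
    by (rule has_sum_finiteI) auto
  then have "((\<lambda>n. ?c n * cnj (if n = m then 1 else 0) * of_real (1 powi (2 * n))) has_sum ?c m) UNIV"
    by (rule has_sum_cong_neutral[THEN iffD1, rotated -1]) auto
  from has_sum_unique[OF P(2) this]
  have "integral {0..2*pi} (\<lambda>t. cis (of_int (- m) * t) * poly p (cis t)) = 2 * of_real pi * ?c m"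
    unfolding e by (simp add: field_simps)
  then show ?thesis using P(1) unfolding e by (metis integrable_integral)
qed

text \<open>For n > 0 the Fourier coefficient of the real part is half that of the polynomial, and
  the kernel's factor 2 restores it. Thus \<open>herg\<close> returns the polynomial up to the
  imaginary part of its constant term, which \<open>Re\<close> discards.\<close>

lemma Re_herg_poly:
  assumes z: "cmod z < 1"
  shows "Re (herg (\<lambda>t. Re (poly p (cis t))) z) = Re (poly p z)"
proof -
  define \<psi> where "\<psi> t = Re (poly p (cis t))" for t
  have ci: "circ_integrable \<psi>"
    unfolding \<psi>_def by (intro circ_integrable_continuous continuous_intros)
  have co: "(LINT t:{0..2*pi}|lborel. cis (of_int (- int n) * t) * of_real (\<psi> t))
      = of_real pi * (coeff p n + (if n = 0 then cnj (coeff p 0) else 0))" for n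
  proof -
    have 1: "((\<lambda>t. cis (of_int (- int n) * t) * poly p (cis t)) has_integral 2 * of_real pi * coeff p n) {0..2*pi}"
      using poly_fourier_coeff[of "int n" p] by simp
    have "((\<lambda>t. cnj (cis (of_int (- (- int n)) * t) * poly p (cis t))) has_integral
       cnj (2 * of_real pi * (if - int n < 0 then 0 else coeff p (nat (- int n))))) {0..2*pi}"
      using has_integral_linear[OF poly_fourier_coeff[of "- int n" p] bounded_linear_cnj] by (simp add: o_def)
    then have 2: "((\<lambda>t. cis (of_int (- int n) * t) * cnj (poly p (cis t))) has_integral
       2 * of_real pi * (if n = 0 then cnj (coeff p 0) else 0)) {0..2*pi}"
      by (cases "n = 0") (simp_all add: cis_cnj)
    have "((\<lambda>t. (cis (of_int (- int n) * t) * poly p (cis t) + cis (of_int (- int n) * t) * cnj (poly p (cis t))) / 2)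
      has_integral (2 * of_real pi * coeff p n + 2 * of_real pi * (if n = 0 then cnj (coeff p 0) else 0)) / 2) {0..2*pi}"
      by (intro has_integral_divide has_integral_add 1 2)
    moreover have "(cis (of_int (- int n) * t) * poly p (cis t) + cis (of_int (- int n) * t) * cnj (poly p (cis t))) / 2
       = cis (of_int (- int n) * t) * of_real (\<psi> t)" for t
    proof -
      have "poly p (cis t) + cnj (poly p (cis t)) = 2 * of_real (\<psi> t)"
        by (simp add: \<psi>_def complex_add_cnj)
      then show ?thesis by (simp only: distrib_left[symmetric]) simp
    qed
    moreover have "(2 * of_real pi * coeff p n + 2 * of_real pi * (if n = 0 then cnj (coeff p 0) else 0)) / 2
       = of_real pi * (coeff p n + (if n = 0 then cnj (coeff p 0) else 0))" by (simp add: distrib_left)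
    ultimately have "((\<lambda>t. cis (of_int (- int n) * t) * of_real (\<psi> t)) has_integral
       of_real pi * (coeff p n + (if n = 0 then cnj (coeff p 0) else 0))) {0..2*pi}" by simp
    moreover have "set_integrable lborel {0..2*pi} (\<lambda>t. cis (of_int (- int n) * t) * of_real (\<psi> t))"
      by (rule circ_integrable_bounded_mult[OF ci, of _ 1], rule cis_measurable) simp
    ultimately show ?thesis
      using set_borel_integral_eq_integral(2) integral_unique by metis
  qed
  have coef_eq: "((if n = 0 then 1 else 2) / (2 * of_real pi) *
      (LINT t:{0..2*pi}|lborel. cis (of_int (- int n) * t) * of_real (\<psi> t))) * z ^ n
      = (if n = 0 then of_real (Re (coeff p 0)) else coeff p n * z ^ n)" for n
    unfolding co by (cases "n = 0") (auto simp: complex_add_cnj)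
  have "(\<lambda>n. if n = 0 then of_real (Re (coeff p 0)) else coeff p n * z ^ n) sums herg \<psi> z"
    using herg_sums[OF ci z] unfolding coef_eq .
  from sums_add[OF this sums_single[of 0 "\<lambda>_. \<i> * of_real (Im (coeff p 0))"]]
  have "(\<lambda>n. (if n = 0 then of_real (Re (coeff p 0)) else coeff p n * z ^ n)
      + (if n = 0 then \<i> * of_real (Im (coeff p 0)) else 0)) sums (herg \<psi> z + \<i> * of_real (Im (coeff p 0)))" .
  moreover have "(if n = 0 then of_real (Re (coeff p 0)) else coeff p n * z ^ n)
      + (if n = 0 then \<i> * of_real (Im (coeff p 0)) else 0) = coeff p n * z ^ n" for n
    using complex_eq[of "coeff p 0"] by auto
  ultimately have "(\<lambda>n. coeff p n * z ^ n) sums (herg \<psi> z + \<i> * of_real (Im (coeff p 0)))" by simp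
  moreover have "(\<lambda>n. coeff p n * z ^ n) sums poly p z"
    unfolding poly_altdef by (rule sums_finite) (auto simp: coeff_eq_0)
  ultimately have "herg \<psi> z + \<i> * of_real (Im (coeff p 0)) = poly p z" by (rule sums_unique2)
  then have "Re (herg \<psi> z + \<i> * of_real (Im (coeff p 0))) = Re (poly p z)" by simp
  then show ?thesis by (simp add: \<psi>_def[abs_def])
qed

text \<open>If \<open>Re p\<close> is uniformly close to \<open>ln (cmod s + \<epsilon>)\<close> on the circle for a polynomial \<open>p\<close>, then the
  maximum principle applies to \<open>s exp (-p)\<close>.\<close>

lemma log_modulus_le_Poisson:
  assumes s: "s holomorphic_on UNIV" and \<epsilon>: "0 < \<epsilon>" and a: "cmod a < 1"
  shows "cmod (s a) \<le> exp (Re (herg (\<lambda>t. ln (cmod (s (cis t)) + \<epsilon>)) a))"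
proof -
  define v where "v \<zeta> = ln (cmod (s \<zeta>) + \<epsilon>)" for \<zeta>
  have pos: "0 < cmod (s \<zeta>) + \<epsilon>" for \<zeta> using \<epsilon> by (simp add: add_nonneg_pos)
  have sc: "continuous_on UNIV s" using s by (rule holomorphic_on_imp_continuous_on)
  have vc: "continuous_on UNIV v"
    unfolding v_def using pos by (intro continuous_intros sc) (auto simp: less_imp_neq[symmetric])
  have ci: "circ_integrable (\<lambda>t. v (cis t))"
    by (intro circ_integrable_continuous continuous_on_compose2[OF vc] continuous_intros) auto
  have bound: "cmod (s a) \<le> exp (Re (herg (\<lambda>t. v (cis t)) a) + 2 * \<delta>)" if \<delta>: "0 < \<delta>" for \<delta>
  proof -
    obtain p where p: "\<And>\<zeta>. cmod \<zeta> = 1 \<Longrightarrow> \<bar>v \<zeta> - Re (poly p \<zeta>)\<bar> < \<delta>"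
      using circle_trig_approx[OF continuous_on_subset[OF vc] \<delta>] by blast
    define u where "u \<zeta> = s \<zeta> * exp (- poly p \<zeta>)" for \<zeta>
    have u: "u holomorphic_on UNIV" unfolding u_def by (intro holomorphic_intros s)
    have "norm (u a) \<le> exp \<delta>"
    proof (rule maximum_modulus_frontier[of u "ball 0 1"])
      show "u holomorphic_on interior (ball 0 1)" using u holomorphic_on_subset by blast
      show "continuous_on (closure (ball 0 1)) u"
        using holomorphic_on_imp_continuous_on[OF u] continuous_on_subset by blast
      show "norm (u \<zeta>) \<le> exp \<delta>" if "\<zeta> \<in> frontier (ball 0 1)" for \<zeta>
      proof -
        have \<zeta>: "cmod \<zeta> = 1" using that by (simp add: frontier_ball)
        have "norm (u \<zeta>) \<le> (cmod (s \<zeta>) + \<epsilon>) * exp (- Re (poly p \<zeta>))"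
          using \<epsilon> by (simp add: u_def norm_mult)
        also have "\<dots> = exp (v \<zeta> - Re (poly p \<zeta>))" using pos[of \<zeta>] by (simp add: v_def exp_diff exp_minus field_simps)
        also have "\<dots> \<le> exp \<delta>" using p[OF \<zeta>] by simp
        finally show ?thesis .
      qed
    qed (use a in auto)
    then have "cmod (s a) * exp (- Re (poly p a)) \<le> exp \<delta>" by (simp add: u_def norm_mult)
    then have "cmod (s a) \<le> exp (Re (poly p a) + \<delta>)"
      by (simp add: exp_minus exp_add field_simps)
    also have "Re (poly p a) \<le> Re (herg (\<lambda>t. v (cis t)) a) + \<delta>"
    proof -
      have "Re (poly p a) = Re (herg (\<lambda>t. Re (poly p (cis t))) a)" by (rule Re_herg_poly[OF a, symmetric])
      also have "\<dots> \<le> Re (herg (\<lambda>t. v (cis t) + \<delta>) a)"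
      proof (intro Re_herg_mono AE_I2 impI a)
        show "circ_integrable (\<lambda>t. Re (poly p (cis t)))"
          by (intro circ_integrable_continuous continuous_intros)
        show "circ_integrable (\<lambda>t. v (cis t) + \<delta>)"
          by (intro set_integral_add ci) (simp add: set_integrable_def)
        show "Re (poly p (cis t)) \<le> v (cis t) + \<delta>" for t using p[of "cis t"] by simp
      qed
      also have "\<dots> = Re (herg (\<lambda>t. v (cis t)) a) + \<delta>"
        by (subst herg_add[OF ci _ a]) (auto simp: herg_const[OF a] set_integrable_def)
      finally show ?thesis .
    qed
    finally show ?thesis by (simp add: add.assoc)
  qed
  have "((\<lambda>\<delta>. exp (Re (herg (\<lambda>t. v (cis t)) a) + 2 * \<delta>)) \<longlongrightarrow> exp (Re (herg (\<lambda>t. v (cis t)) a) + 2 * 0)) (at_right 0)"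
    by (intro tendsto_intros)
  moreover have "\<forall>\<^sub>F \<delta> in at_right 0. cmod (s a) \<le> exp (Re (herg (\<lambda>t. v (cis t)) a) + 2 * \<delta>)"
    using eventually_at_right_less[of 0] by eventually_elim (rule bound)
  ultimately have "cmod (s a) \<le> exp (Re (herg (\<lambda>t. v (cis t)) a) + 2 * 0)"
    by (intro tendsto_lowerbound) auto
  then show ?thesis by (simp add: v_def)
qed

lemma herg_dominated:
  assumes D: "circ_integrable D" and z: "cmod z < 1"
    and m: "\<And>j. \<psi> j \<in> borel_measurable lborel" "\<psi>' \<in> borel_measurable lborel"
    and le: "\<And>j. AE t in lborel. t \<in> {0..2*pi} \<longrightarrow> \<bar>\<psi> j t\<bar> \<le> D t"
    and lim: "AE t in lborel. t \<in> {0..2*pi} \<longrightarrow> (\<lambda>j. \<psi> j t) \<longlonglongrightarrow> \<psi>' t"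
  shows "\<And>j. circ_integrable (\<psi> j)" and "circ_integrable \<psi>'"
    and "(\<lambda>j. Re (herg (\<psi> j) z)) \<longlonglongrightarrow> Re (herg \<psi>' z)"
proof -
  define D' where "D' t = indicator {0..2*pi} t *\<^sub>R D t" for t
  have D': "integrable lborel D'" using D unfolding set_integrable_def D'_def .
  have ms: "(\<lambda>t. indicator {0..2*pi} t *\<^sub>R \<psi> j t) \<in> borel_measurable lborel"
    "(\<lambda>t. indicator {0..2*pi} t *\<^sub>R \<psi>' t) \<in> borel_measurable lborel" for j
    using m by measurable
  have les: "AE t in lborel. norm (indicator {0..2*pi} t *\<^sub>R \<psi> j t) \<le> D' t" for j
    using le[of j] by eventually_elim (auto simp: D'_def indicator_def)
  have lims: "AE t in lborel. (\<lambda>j. indicator {0..2*pi} t *\<^sub>R \<psi> j t) \<longlonglongrightarrow> indicator {0..2*pi} t *\<^sub>R \<psi>' t"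
    using lim by eventually_elim (auto simp: indicator_def)
  show ci: "circ_integrable (\<psi> j)" for j
    unfolding set_integrable_def by (rule Bochner_Integration.integrable_bound[OF D' ms(1)])
      (use les[of j] in \<open>auto elim!: eventually_mono\<close>)
  show ci': "circ_integrable \<psi>'"
    unfolding set_integrable_def by (rule integrable_dominated_convergence[OF ms(2,1) D' lims les])
  define K where "K t = Re (herg_kernel z t)" for t
  have Km: "K \<in> borel_measurable lborel"
    using herg_kernel_measurable[OF z] unfolding K_def by measurable
  have K0: "0 \<le> K t" and Kb: "K t \<le> 2 / (1 - cmod z)" for t
    using Re_herg_kernel_nonneg[OF z] complex_Re_le_cmod[of "herg_kernel z t"] herg_kernel_bound[OF z, of t]
    by (auto simp: K_def intro: order.trans)
  have "(\<lambda>j. LINT t:{0..2*pi}|lborel. K t * \<psi> j t) \<longlonglongrightarrow> (LINT t:{0..2*pi}|lborel. K t * \<psi>' t)"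
    unfolding set_lebesgue_integral_def
  proof (rule integral_dominated_convergence)
    show "integrable lborel (\<lambda>t. 2 / (1 - cmod z) * D' t)" using D' by (rule integrable_mult_right)
    show "(\<lambda>t. indicator {0..2*pi} t *\<^sub>R (K t * \<psi> j t)) \<in> borel_measurable lborel" for j
      using m Km by measurable
    show "(\<lambda>t. indicator {0..2*pi} t *\<^sub>R (K t * \<psi>' t)) \<in> borel_measurable lborel"
      using m Km by measurable
    show "AE t in lborel. (\<lambda>j. indicator {0..2*pi} t *\<^sub>R (K t * \<psi> j t)) \<longlonglongrightarrow> indicator {0..2*pi} t *\<^sub>R (K t * \<psi>' t)"
      using lim by eventually_elim (auto simp: indicator_def intro!: tendsto_intros)
    show "AE t in lborel. norm (indicator {0..2*pi} t *\<^sub>R (K t * \<psi> j t)) \<le> 2 / (1 - cmod z) * D' t" for j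
      using le[of j]
    proof eventually_elim
      case (elim t)
      show ?case
      proof (cases "t \<in> {0..2*pi}")
        case True
        have "K t * \<bar>\<psi> j t\<bar> \<le> 2 / (1 - cmod z) * D t"
          using elim True Kb[of t] K0[of t] z by (intro mult_mono) auto
        then show ?thesis using True K0[of t] by (simp add: D'_def abs_mult)
      qed (simp add: D'_def)
    qed
  qed
  then have "(\<lambda>j. (LINT t:{0..2*pi}|lborel. K t * \<psi> j t) / (2 * pi)) \<longlonglongrightarrow> (LINT t:{0..2*pi}|lborel. K t * \<psi>' t) / (2 * pi)"
    by (intro tendsto_intros) auto
  then show "(\<lambda>j. Re (herg (\<psi> j) z)) \<longlonglongrightarrow> Re (herg \<psi>' z)"
    unfolding Re_herg(1)[OF ci z] Re_herg(1)[OF ci' z] K_def .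
qed

text \<open>The denominator of the Poisson kernel is at most 4. Through this bound the value of a
  Poisson integral at one single point controls an L1 norm on the circle.\<close>

lemma Re_herg_kernel_lower: assumes "cmod z < 1" shows "(1 - (cmod z)\<^sup>2) / 4 \<le> Re (herg_kernel z t)"
proof -
  have "Re (herg_kernel z t) = (1 - (cmod z)\<^sup>2) / (cmod (cis t - z))\<^sup>2"
  proof -
    have "(cos t)\<^sup>2 + (sin t)\<^sup>2 = 1" by simp
    then have "(cos t + Re z) * (cos t - Re z) + (sin t + Im z) * (sin t - Im z) = 1 - (cmod z)\<^sup>2"
      unfolding cmod_power2 by (simp only: square_diff_square_factored[symmetric] power2_eq_square[symmetric])
    then show ?thesis
      unfolding herg_kernel_def Re_divide cmod_power2 plus_complex.sel minus_complex.sel cis.sel by simp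
  qed
  moreover have "(cmod (cis t - z))\<^sup>2 \<le> 2\<^sup>2"
    using norm_triangle_ineq4[of "cis t" z] assms by (intro power_mono) auto
  moreover have "0 < (cmod (cis t - z))\<^sup>2" using cis_neq[OF assms, of t] by simp
  moreover have "0 \<le> 1 - (cmod z)\<^sup>2" using assms by (simp add: power_le_one)
  moreover have "v / 4 \<le> v / y" if "0 \<le> v" "0 < y" "y \<le> 2\<^sup>2" for v y :: real
    using that by (intro divide_left_mono) auto
  ultimately show ?thesis by (simp only:)
qed

lemma integral_le_Re_herg:
  assumes "circ_integrable \<psi>" "cmod z < 1" "\<And>t. 0 \<le> \<psi> t"
  shows "(1 - (cmod z)\<^sup>2) / 4 * (LINT t:{0..2*pi}|lborel. \<psi> t) \<le> 2 * pi * Re (herg \<psi> z)"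
proof -
  have "(1 - (cmod z)\<^sup>2) / 4 * (LINT t:{0..2*pi}|lborel. \<psi> t) = (LINT t:{0..2*pi}|lborel. (1 - (cmod z)\<^sup>2) / 4 * \<psi> t)"
    by (rule set_integral_mult_right[symmetric])
  also have "\<dots> \<le> (LINT t:{0..2*pi}|lborel. Re (herg_kernel z t) * \<psi> t)"
    by (intro set_integral_mono set_integrable_mult_right assms Re_herg(2) mult_right_mono Re_herg_kernel_lower)
  also have "\<dots> = 2 * pi * Re (herg \<psi> z)" unfolding Re_herg(1)[OF assms(1,2)] by simp
  finally show ?thesis .
qed

section \<open>Almost everywhere limits of Taylor polynomials on the circle\<close>

lemma trig_poly_norm:
  fixes a :: "nat \<Rightarrow> complex"
  assumes K: "finite K"
  shows "(LINT t:{0..2*pi}|lborel. (cmod (\<Sum>k\<in>K. a k * cis t ^ k))\<^sup>2) = 2 * pi * (\<Sum>k\<in>K. (cmod (a k))\<^sup>2)"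
proof -
  define c where "c n = (if 0 \<le> n \<and> nat n \<in> K then a (nat n) else 0)" for n :: int
  have c_neg: "c n = 0" if "n < 0" for n using that by (simp add: c_def)
  have "laurent_on_circle 1 (\<lambda>z. \<Sum>k\<in>K. a k * z ^ k) c"
    unfolding laurent_on_circle_def
  proof (intro allI impI)
    fix z :: complex
    have "((\<lambda>n. c (int n) * z powi (int n)) has_sum (\<Sum>k\<in>K. a k * z ^ k)) K"
      by (rule has_sum_finiteI[OF K]) (simp add: c_def)
    then have "((\<lambda>n. c (int n) * z powi (int n)) has_sum (\<Sum>k\<in>K. a k * z ^ k)) UNIV"
      by (rule has_sum_cong_neutral[THEN iffD1, rotated -1]) (auto simp: c_def)
    then show "((\<lambda>n. c n * z powi n) has_sum (\<Sum>k\<in>K. a k * z ^ k)) UNIV"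
      by (subst has_sum_int_nat) (auto simp: c_neg)
  qed
  from circle_norm_parseval[OF zero_less_one this]
  have P: "((\<lambda>n. (cmod (c n))\<^sup>2) has_sum (integral {0..2 * pi} (\<lambda>t. (cmod (\<Sum>k\<in>K. a k * cis t ^ k))\<^sup>2) / (2 * pi))) UNIV"
    by simp
  have "((\<lambda>n. (cmod (c (int n)))\<^sup>2) has_sum (\<Sum>k\<in>K. (cmod (a k))\<^sup>2)) K"
    by (rule has_sum_finiteI[OF K]) (simp add: c_def)
  then have "((\<lambda>n. (cmod (c (int n)))\<^sup>2) has_sum (\<Sum>k\<in>K. (cmod (a k))\<^sup>2)) UNIV"
    by (rule has_sum_cong_neutral[THEN iffD1, rotated -1]) (auto simp: c_def)
  then have "((\<lambda>n. (cmod (c n))\<^sup>2) has_sum (\<Sum>k\<in>K. (cmod (a k))\<^sup>2)) UNIV"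
    by (subst has_sum_int_nat) (auto simp: c_neg)
  from has_sum_unique[OF P this]
  have I: "integral {0..2 * pi} (\<lambda>t. (cmod (\<Sum>k\<in>K. a k * cis t ^ k))\<^sup>2) = 2 * pi * (\<Sum>k\<in>K. (cmod (a k))\<^sup>2)"
    by (simp add: field_simps)
  have ci: "circ_integrable (\<lambda>t. (cmod (\<Sum>k\<in>K. a k * cis t ^ k))\<^sup>2)"
    by (intro circ_integrable_continuous continuous_intros)
  show ?thesis unfolding set_borel_integral_eq_integral(2)[OF ci] by (rule I)
qed

lemma fast_subsequence:
  fixes x :: "nat \<Rightarrow> real"
  assumes "summable x" "\<And>k. 0 \<le> x k" "\<And>j. 0 < (e :: nat \<Rightarrow> real) j"
  shows "\<exists>N. mono N \<and> filterlim N at_top sequentially \<and> (\<forall>j. \<forall>m. (\<Sum>k\<in>{N j..<m}. x k) \<le> e j)"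
proof -
  have "\<exists>n. \<forall>m\<ge>n. \<forall>l. norm (sum x {m..<l}) < e j" for j
    using assms(1,3) unfolding summable_Cauchy by blast
  then obtain n where n: "\<And>j m l. n j \<le> m \<Longrightarrow> norm (sum x {m..<l}) < e j" by metis
  \<comment> \<open>Accumulating the thresholds keeps \<open>N\<close> above each of them, and the
    added 1 makes it strictly increasing.\<close>
  define N where "N j = (\<Sum>i\<le>j. n i + 1)" for j
  have "n j \<le> N j" for j
    using member_le_sum[of j "{..j}" "\<lambda>i. n i + 1"] by (simp add: N_def)
  then have "(\<Sum>k\<in>{N j..<m}. x k) \<le> e j" for j m
    using n[of j "N j" m] by simp
  moreover have "strict_mono N" by (rule strict_monoI_Suc) (simp add: N_def)
  then have "mono N" "filterlim N at_top sequentially"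
    by (auto intro: strict_mono_mono filterlim_subseq)
  ultimately show ?thesis by blast
qed

text \<open>Along a subsequence with fast decaying tails the blocks of the series have summable L1
  norms. Their sum is integrable, hence finite almost everywhere: this gives the limit and the
  majorant \<open>D\<close> together.\<close>

lemma circ_integrable_limit_dominated:
  fixes a :: "nat \<Rightarrow> complex"
  assumes sm: "summable (\<lambda>k. (cmod (a k))\<^sup>2)"
  obtains N D \<Phi> where "filterlim N at_top sequentially" "circ_integrable D"
    "\<Phi> \<in> borel_measurable lborel" "\<And>t. 0 \<le> \<Phi> t"
    "\<And>j. AE t in lborel. t \<in> {0..2*pi} \<longrightarrow> cmod (\<Sum>k<N j. a k * cis t ^ k) \<le> D t"
    "AE t in lborel. t \<in> {0..2*pi} \<longrightarrow> (\<lambda>j. cmod (\<Sum>k<N j. a k * cis t ^ k)) \<longlonglongrightarrow> \<Phi> t"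
proof -
  obtain N where N: "mono N" "filterlim N at_top sequentially"
    "\<And>j m. (\<Sum>k\<in>{N j..<m}. (cmod (a k))\<^sup>2) \<le> (1/4) ^ j"
    using fast_subsequence[OF sm, of "\<lambda>j. (1/4) ^ j"] by auto
  define S where "S j t = (\<Sum>k<N j. a k * cis t ^ k)" for j t
  define d where "d j t = (\<Sum>k\<in>{N j..<N (Suc j)}. a k * cis t ^ k)" for j t
  define G where "G j t = indicator {0..2*pi} t *\<^sub>R cmod (d j t)" for j t
  have G0: "0 \<le> G j t" for j t by (simp add: G_def)
  have S_Suc: "S j t = S 0 t + (\<Sum>i<j. d i t)" for j t
  proof (induction j)
    case (Suc j)
    have "N j \<le> N (Suc j)" by (rule monoD[OF N(1)]) simp
    then have "S (Suc j) t = S j t + d j t"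
      unfolding S_def d_def lessThan_atLeast0 by (rule sum.atLeastLessThan_concat[OF le0, symmetric])
    then show ?case using Suc by (simp add: add.assoc)
  qed simp
  have ci_d: "circ_integrable (\<lambda>t. cmod (d j t))" "circ_integrable (\<lambda>t. (cmod (d j t))\<^sup>2)" for j
    unfolding d_def by (intro circ_integrable_continuous continuous_intros)+
  have int_G: "integrable lborel (G j)" for j
    using ci_d(1) unfolding set_integrable_def G_def .
  have G_le: "(\<integral>t. G j t \<partial>lborel) \<le> 2 * pi * (1/2) ^ j" for j
  proof -
    have ci: "circ_integrable (\<lambda>t. (1/2) ^ j / 2 + 2 ^ j / 2 * (cmod (d j t))\<^sup>2)"
      by (intro set_integral_add set_integrable_mult_right ci_d circ_integrable_const)
    have "(\<integral>t. G j t \<partial>lborel) = (LINT t:{0..2*pi}|lborel. cmod (d j t))"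
      by (simp add: G_def set_lebesgue_integral_def)
    also have "\<dots> \<le> (LINT t:{0..2*pi}|lborel. (1/2) ^ j / 2 + 2 ^ j / 2 * (cmod (d j t))\<^sup>2)"
    proof (rule set_integral_mono[OF ci_d(1) ci])
      fix t
      \<comment> \<open>A substitute for Cauchy-Schwarz. With \<open>x = 2 ^ j\<close> it balances a
        constant of order \<open>(1/2) ^ j\<close> against the squared norm of the block, of order
        \<open>(1/4) ^ j\<close>.\<close>
      have "y \<le> (1 / x) / 2 + x / 2 * y\<^sup>2" if "0 < x" for x y :: real
      proof -
        have "0 \<le> (1 - x * y)\<^sup>2 / (2 * x)" using that by simp
        also have "\<dots> = (1 / x) / 2 + x / 2 * y\<^sup>2 - y"
          using that by (simp add: power2_eq_square field_simps)
        finally show ?thesis by simp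
      qed
      from this[of "2 ^ j" "cmod (d j t)"]
      show "cmod (d j t) \<le> (1/2) ^ j / 2 + 2 ^ j / 2 * (cmod (d j t))\<^sup>2"
        by (simp only: power_one_over zero_less_power zero_less_numeral)
    qed
    also have "\<dots> = (LINT t:{0..2*pi}|lborel. (1/2) ^ j / 2) + 2 ^ j / 2 * (LINT t:{0..2*pi}|lborel. (cmod (d j t))\<^sup>2)"
      by (subst set_integral_add(2)) (auto intro!: set_integrable_mult_right ci_d circ_integrable_const)
    also have "(LINT t:{0..2*pi}|lborel. (cmod (d j t))\<^sup>2) = 2 * pi * (\<Sum>k\<in>{N j..<N (Suc j)}. (cmod (a k))\<^sup>2)"
      unfolding d_def by (rule trig_poly_norm) simp
    also have "(LINT t:{0..2*pi}|lborel. (1/2) ^ j / 2) = 2 * pi * ((1/2) ^ j / 2 :: real)"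
      by (simp add: set_lebesgue_integral_def)
    also have "2 ^ j / 2 * (2 * pi * (\<Sum>k\<in>{N j..<N (Suc j)}. (cmod (a k))\<^sup>2)) \<le> 2 ^ j / 2 * (2 * pi * (1/4) ^ j)"
      by (intro mult_left_mono N(3)) auto
    also have "2 ^ j / 2 * (2 * pi * (1/4) ^ j) = 2 * pi * ((1/2) ^ j / 2 :: real)"
    proof -
      have "(2::real) ^ j * (1/4) ^ j = (2 * (1/4)) ^ j" by (rule power_mult_distrib[symmetric])
      also have "2 * (1/4) = (1/2 :: real)" by simp
      finally have e: "(2::real) ^ j * (1/4) ^ j = (1/2) ^ j" .
      have "2 ^ j / 2 * (2 * pi * (1/4) ^ j) = pi * (2 ^ j * (1/4) ^ j)" by simp
      also have "\<dots> = 2 * pi * ((1/2) ^ j / 2)" unfolding e by simp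
      finally show ?thesis .
    qed
    finally show ?thesis by simp
  qed
  have geo: "summable (\<lambda>j. 2 * pi * (1/2) ^ j :: real)" by (intro summable_mult summable_geometric) simp
  have int0: "0 \<le> (\<integral>t. G j t \<partial>lborel)" for j by (rule integral_nonneg_AE) (simp add: G0)
  have sum_int: "summable (\<lambda>j. \<integral>t. G j t \<partial>lborel)"
    by (rule summable_comparison_test'[OF geo, of 0]) (use G_le int0 in auto)
  have AE_sum: "AE t in lborel. summable (\<lambda>j. G j t)"
  proof -
    have "(\<integral>\<^sup>+t. suminf (\<lambda>j. ennreal (G j t)) \<partial>lborel) = suminf (\<lambda>j. \<integral>\<^sup>+t. ennreal (G j t) \<partial>lborel)"
      using int_G by (intro nn_integral_suminf) auto
    also have "\<dots> = suminf (\<lambda>j. ennreal (\<integral>t. G j t \<partial>lborel))"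
      by (intro suminf_cong nn_integral_eq_integral int_G) (simp add: G0)
    also have "\<dots> = ennreal (suminf (\<lambda>j. \<integral>t. G j t \<partial>lborel))"
      by (rule suminf_ennreal2[OF int0 sum_int])
    finally have "(\<integral>\<^sup>+t. suminf (\<lambda>j. ennreal (G j t)) \<partial>lborel) \<noteq> \<infinity>" by simp
    then have "AE t in lborel. suminf (\<lambda>j. ennreal (G j t)) \<noteq> \<infinity>"
      using int_G by (intro nn_integral_PInf_AE) (auto intro!: borel_measurable_suminf_order)
    then show ?thesis
    proof eventually_elim
      case (elim t)
      then show ?case using G0 by (intro summable_suminf_not_top) auto
    qed
  qed
  define H where "H t = suminf (\<lambda>j. G j t)" for t
  have int_H: "integrable lborel H"
    unfolding H_def using AE_sum sum_int G0 by (intro integrable_suminf int_G) auto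
  define D where "D t = cmod (S 0 t) + H t" for t
  \<comment> \<open>The absolute value keeps \<open>\<Phi>\<close> nonnegative also where the limit
    does not exist.\<close>
  define \<Phi> where "\<Phi> t = \<bar>lim (\<lambda>j. cmod (S j t))\<bar>" for t
  have Sm: "S j \<in> borel_measurable lborel" for j
    unfolding S_def by (auto intro!: borel_measurable_continuous_onI continuous_intros)
  show ?thesis
  proof (rule that[of N D \<Phi>])
    show "filterlim N at_top sequentially" by (rule N(2))
    show "circ_integrable D"
      unfolding D_def
    proof (intro set_integral_add(1))
      show "circ_integrable (\<lambda>t. cmod (S 0 t))"
        unfolding S_def by (intro circ_integrable_continuous continuous_intros)
      show "circ_integrable H" unfolding set_integrable_def by (intro integrable_mult_indicator int_H) simp
    qed
    show "\<Phi> \<in> borel_measurable lborel"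
      unfolding \<Phi>_def using Sm by (intro borel_measurable_abs borel_measurable_lim_metric borel_measurable_norm) auto
    show "0 \<le> \<Phi> t" for t by (simp add: \<Phi>_def)
    show "AE t in lborel. t \<in> {0..2*pi} \<longrightarrow> cmod (\<Sum>k<N j. a k * cis t ^ k) \<le> D t" for j
      using AE_sum
    proof eventually_elim
      case (elim t)
      show ?case
      proof
        assume t: "t \<in> {0..2*pi}"
        have "cmod (S j t) \<le> cmod (S 0 t) + cmod (\<Sum>i<j. d i t)"
          unfolding S_Suc[of j] by (rule norm_triangle_ineq)
        also have "cmod (\<Sum>i<j. d i t) \<le> (\<Sum>i<j. G i t)"
          using norm_sum[of "\<lambda>i. d i t" "{..<j}"] t by (simp add: G_def)
        also have "\<dots> \<le> H t" unfolding H_def by (intro sum_le_suminf elim) (auto simp: G0)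
        finally show "cmod (\<Sum>k<N j. a k * cis t ^ k) \<le> D t" by (simp add: S_def D_def)
      qed
    qed
    show "AE t in lborel. t \<in> {0..2*pi} \<longrightarrow> (\<lambda>j. cmod (\<Sum>k<N j. a k * cis t ^ k)) \<longlonglongrightarrow> \<Phi> t"
      using AE_sum
    proof eventually_elim
      case (elim t)
      show ?case
      proof
        assume t: "t \<in> {0..2*pi}"
        have "summable (\<lambda>i. cmod (d i t))" using elim t by (simp add: G_def)
        then have "summable (\<lambda>i. d i t)" by (rule summable_norm_cancel)
        then have "(\<lambda>j. S 0 t + (\<Sum>i<j. d i t)) \<longlonglongrightarrow> S 0 t + suminf (\<lambda>i. d i t)"
          by (intro tendsto_intros summable_LIMSEQ)
        then have "(\<lambda>j. S j t) \<longlonglongrightarrow> S 0 t + suminf (\<lambda>i. d i t)" unfolding S_Suc[symmetric] .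
        then have L: "(\<lambda>j. cmod (S j t)) \<longlonglongrightarrow> cmod (S 0 t + suminf (\<lambda>i. d i t))" by (rule tendsto_norm)
        then have "\<Phi> t = cmod (S 0 t + suminf (\<lambda>i. d i t))" by (simp add: \<Phi>_def limI)
        with L show "(\<lambda>j. cmod (\<Sum>k<N j. a k * cis t ^ k)) \<longlonglongrightarrow> \<Phi> t" by (simp add: S_def)
      qed
    qed
  qed
qed

lemma Fatou_circ:
  assumes ci: "\<And>j. circ_integrable (u j)" and pos: "\<And>j t. 0 \<le> u j t"
    and le: "\<And>j. (LINT t:{0..2*pi}|lborel. u j t) \<le> B"
    and lim: "AE t in lborel. t \<in> {0..2*pi} \<longrightarrow> (\<lambda>j. u j t) \<longlonglongrightarrow> v t"
    and v: "v \<in> borel_measurable lborel" "\<And>t. 0 \<le> v t"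
  shows "circ_integrable v" "(LINT t:{0..2*pi}|lborel. v t) \<le> B"
proof -
  define U where "U j t = indicator {0..2*pi} t *\<^sub>R u j t" for j t
  define V where "V t = indicator {0..2*pi} t *\<^sub>R v t" for t
  have U: "integrable lborel (U j)" for j using ci unfolding set_integrable_def U_def .
  have U0: "0 \<le> U j t" and V0: "0 \<le> V t" for j t using pos v(2) by (auto simp: U_def V_def)
  have Vm: "V \<in> borel_measurable lborel" using v(1) unfolding V_def by measurable
  have UB: "(\<integral>t. U j t \<partial>lborel) \<le> B" for j using le unfolding U_def set_lebesgue_integral_def .
  have "0 \<le> (\<integral>t. U 0 t \<partial>lborel)" by (rule integral_nonneg_AE) (simp add: U0)
  then have B0: "0 \<le> B" using UB[of 0] by linarith
  have "(\<integral>\<^sup>+t. V t \<partial>lborel) = (\<integral>\<^sup>+t. liminf (\<lambda>j. ennreal (U j t)) \<partial>lborel)"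
  proof (rule nn_integral_cong_AE)
    show "AE t in lborel. ennreal (V t) = liminf (\<lambda>j. ennreal (U j t))"
      using lim
    proof eventually_elim
      case (elim t)
      then have "(\<lambda>j. U j t) \<longlonglongrightarrow> V t" by (auto simp: U_def V_def indicator_def)
      then have "(\<lambda>j. ennreal (U j t)) \<longlonglongrightarrow> ennreal (V t)" by (rule tendsto_ennrealI)
      then show ?case by (intro lim_imp_Liminf[symmetric]) auto
    qed
  qed
  also have "\<dots> \<le> liminf (\<lambda>j. \<integral>\<^sup>+t. U j t \<partial>lborel)"
    using U by (intro nn_integral_liminf) auto
  also have "\<dots> \<le> liminf (\<lambda>j. ennreal B)"
  proof (rule Liminf_mono, intro always_eventually allI)
    show "(\<integral>\<^sup>+t. U j t \<partial>lborel) \<le> ennreal B" for j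
      using nn_integral_eq_integral[OF U[of j]] U0 UB[of j] B0 by (simp add: ennreal_leI)
  qed
  also have "\<dots> = ennreal B" by (simp add: Liminf_const)
  finally have VB: "(\<integral>\<^sup>+t. V t \<partial>lborel) \<le> ennreal B" .
  then have "(\<integral>\<^sup>+t. norm (V t) \<partial>lborel) < \<infinity>"
    using V0 by (simp add: le_less_trans[OF _ ennreal_less_top])
  then have iV: "integrable lborel V" using Vm by (intro integrableI_bounded)
  then show "circ_integrable v" unfolding set_integrable_def V_def .
  have "ennreal (\<integral>t. V t \<partial>lborel) \<le> ennreal B"
    using VB nn_integral_eq_integral[OF iV] V0 by simp
  then have "(\<integral>t. V t \<partial>lborel) \<le> B" using B0 by (simp add: ennreal_le_iff)
  then show "(LINT t:{0..2*pi}|lborel. v t) \<le> B" unfolding V_def set_lebesgue_integral_def .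
qed

lemma circ_integrable_cong_AE:
  assumes "circ_integrable u" "v \<in> borel_measurable lborel" "u \<in> borel_measurable lborel"
    "AE t in lborel. t \<in> {0..2*pi} \<longrightarrow> u t = v t"
  shows "circ_integrable v" "(LINT t:{0..2*pi}|lborel. u t) = (LINT t:{0..2*pi}|lborel. v t)"
proof -
  have *: "AE t in lborel. indicator {0..2*pi} t *\<^sub>R u t = indicator {0..2*pi} t *\<^sub>R v t"
    using assms(4) by eventually_elim (auto simp: indicator_def)
  show "circ_integrable v" unfolding set_integrable_def
    by (rule integrable_cong_AE_imp[OF assms(1)[unfolded set_integrable_def]])
      (use assms(2) * in \<open>auto elim: eventually_mono\<close>)
  show "(LINT t:{0..2*pi}|lborel. u t) = (LINT t:{0..2*pi}|lborel. v t)"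
    unfolding set_lebesgue_integral_def by (rule integral_cong_AE) (use assms(2,3) * in auto)
qed

lemma abs_ln_add_le:
  fixes x \<epsilon> :: real
  assumes "0 \<le> x" "0 < \<epsilon>" shows "\<bar>ln (x + \<epsilon>)\<bar> \<le> \<bar>ln \<epsilon>\<bar> + 1 / \<epsilon> * x"
proof -
  have "ln \<epsilon> \<le> ln (x + \<epsilon>)" using assms by simp
  moreover have "ln (x + \<epsilon>) \<le> ln \<epsilon> + 1 / \<epsilon> * x"
  proof -
    have "x + \<epsilon> = \<epsilon> * (1 + x / \<epsilon>)" using assms by (simp add: field_simps)
    moreover have "0 < 1 + x / \<epsilon>" using assms by (intro add_pos_nonneg) auto
    ultimately have "ln (x + \<epsilon>) = ln \<epsilon> + ln (1 + x / \<epsilon>)"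
      using assms by (simp only: ln_mult_pos)
    also have "ln (1 + x / \<epsilon>) \<le> x / \<epsilon>" using assms by (intro ln_add_one_self_le_self) auto
    finally show ?thesis by simp
  qed
  moreover have "0 \<le> 1 / \<epsilon> * x" using assms by simp
  ultimately show ?thesis by linarith
qed

text \<open>Apply \<open>log_modulus_le_Poisson\<close> to Taylor polynomials, let them tend to f
  with \<open>\<epsilon>\<close> fixed, which keeps the logarithms dominated, and only then let
  \<open>\<epsilon>\<close> tend to 0. The second limit needs an integrable logarithm. Here
  \<open>f z0 \<noteq> 0\<close> enters: it bounds the Poisson integrals of
  \<open>ln (\<Phi> t + \<epsilon>)\<close> at \<open>z0\<close> from below, uniformly in
  \<open>\<epsilon>\<close>.\<close>

lemma boundary_modulus:
  assumes f: "f holomorphic_on ball 0 1" "l2 (tay f)" and z0: "cmod z0 < 1" "f z0 \<noteq> 0"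
  obtains \<phi> where "\<phi> \<in> borel_measurable lborel" "\<And>t. 0 < \<phi> t" "circ_integrable (\<lambda>t. ln (\<phi> t))"
    "circ_integrable (\<lambda>t. (\<phi> t)\<^sup>2)" "(LINT t:{0..2*pi}|lborel. (\<phi> t)\<^sup>2) \<le> 2 * pi * sq (tay f)"
    "\<And>z. cmod z < 1 \<Longrightarrow> cmod (f z) \<le> exp (Re (herg (\<lambda>t. ln (\<phi> t)) z))"
proof -
  define a where "a k = (deriv ^^ k) f 0 / fact k" for k :: nat
  have aty: "tay f (int k) = a k" for k by (simp add: tay_def a_def)
  have a_hs: "((\<lambda>k. (cmod (a k))\<^sup>2) has_sum sq (tay f)) UNIV"
  proof -
    have "((\<lambda>n. (cmod (tay f n))\<^sup>2) has_sum sq (tay f)) UNIV" using f(2) by (simp add: l2_summable sq_def)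
    then show ?thesis by (subst (asm) has_sum_int_nat) (auto simp: aty tay_neg)
  qed
  then have sm: "summable (\<lambda>k. (cmod (a k))\<^sup>2)" by (metis has_sum_imp_sums sums_summable)
  have a_le: "(\<Sum>k<n. (cmod (a k))\<^sup>2) \<le> sq (tay f)" for n
    by (rule finite_sum_le_has_sum[OF a_hs]) auto
  have s_lim: "(\<lambda>n. \<Sum>k<n. a k * z ^ k) \<longlonglongrightarrow> f z" if "cmod z < 1" for z
    using holomorphic_power_series[OF f(1), of z] that by (simp add: sums_def a_def)
  obtain N D \<Phi> where N: "filterlim N at_top sequentially" and D: "circ_integrable D"
    and \<Phi>: "\<Phi> \<in> borel_measurable lborel" "\<And>t. 0 \<le> \<Phi> t"
    and D_le: "\<And>j. AE t in lborel. t \<in> {0..2*pi} \<longrightarrow> cmod (\<Sum>k<N j. a k * cis t ^ k) \<le> D t"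
    and \<Phi>_lim: "AE t in lborel. t \<in> {0..2*pi} \<longrightarrow> (\<lambda>j. cmod (\<Sum>k<N j. a k * cis t ^ k)) \<longlonglongrightarrow> \<Phi> t"
    by (rule circ_integrable_limit_dominated[OF sm]) (rule that; assumption)
  define S where "S j z = (\<Sum>k<N j. a k * z ^ k)" for j and z :: complex
  have S_meas: "(\<lambda>t. cmod (S j (cis t))) \<in> borel_measurable lborel" for j
    unfolding S_def by (auto intro!: borel_measurable_continuous_onI continuous_intros)
  have \<Phi>_ci: "circ_integrable \<Phi>"
    by (rule herg_dominated(2)[OF D, of 0 "\<lambda>j t. cmod (S j (cis t))" \<Phi>])
      (use S_meas \<Phi> D_le \<Phi>_lim in \<open>auto simp: S_def\<close>)
  have \<Phi>2: "circ_integrable (\<lambda>t. (\<Phi> t)\<^sup>2)" "(LINT t:{0..2*pi}|lborel. (\<Phi> t)\<^sup>2) \<le> 2 * pi * sq (tay f)"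
  proof -
    have 1: "circ_integrable (\<lambda>t. (cmod (S j (cis t)))\<^sup>2)" for j
      unfolding S_def by (intro circ_integrable_continuous continuous_intros)
    have 2: "(LINT t:{0..2*pi}|lborel. (cmod (S j (cis t)))\<^sup>2) \<le> 2 * pi * sq (tay f)" for j
      unfolding S_def by (subst trig_poly_norm) (auto simp: a_le)
    have 3: "AE t in lborel. t \<in> {0..2*pi} \<longrightarrow> (\<lambda>j. (cmod (S j (cis t)))\<^sup>2) \<longlonglongrightarrow> (\<Phi> t)\<^sup>2"
      using \<Phi>_lim by eventually_elim (auto simp: S_def intro!: tendsto_intros)
    have 4: "(\<lambda>t. (\<Phi> t)\<^sup>2) \<in> borel_measurable lborel" using \<Phi>(1) by measurable
    show "circ_integrable (\<lambda>t. (\<Phi> t)\<^sup>2)" "(LINT t:{0..2*pi}|lborel. (\<Phi> t)\<^sup>2) \<le> 2 * pi * sq (tay f)"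
      by (rule Fatou_circ[OF 1 _ 2 3 4]; simp)+
  qed
  define L where "L \<epsilon> t = ln (\<Phi> t + \<epsilon>)" for \<epsilon> t
  have L_meas: "L \<epsilon> \<in> borel_measurable lborel" for \<epsilon> unfolding L_def using \<Phi>(1) by measurable
  have L_ci: "circ_integrable (L \<epsilon>)" and f_le_L: "cmod z < 1 \<Longrightarrow> cmod (f z) \<le> exp (Re (herg (L \<epsilon>) z))"
    if \<epsilon>: "0 < \<epsilon>" for \<epsilon> z
  proof -
    define D' where "D' t = \<bar>ln \<epsilon>\<bar> + 1 / \<epsilon> * D t" for t
    have D': "circ_integrable D'"
      unfolding D'_def by (intro set_integral_add(1) set_integrable_mult_right D circ_integrable_const)
    have m: "(\<lambda>t. ln (cmod (S j (cis t)) + \<epsilon>)) \<in> borel_measurable lborel" for j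
      using S_meas[of j] by measurable
    have le: "AE t in lborel. t \<in> {0..2*pi} \<longrightarrow> \<bar>ln (cmod (S j (cis t)) + \<epsilon>)\<bar> \<le> D' t" for j
      using D_le[of j]
    proof eventually_elim
      case (elim t)
      show ?case
      proof
        assume "t \<in> {0..2*pi}"
        then have "1 / \<epsilon> * cmod (S j (cis t)) \<le> 1 / \<epsilon> * D t"
          using elim \<epsilon> by (intro mult_left_mono) (auto simp: S_def)
        then show "\<bar>ln (cmod (S j (cis t)) + \<epsilon>)\<bar> \<le> D' t"
          using abs_ln_add_le[OF norm_ge_zero \<epsilon>, of "S j (cis t)"] unfolding D'_def by linarith
      qed
    qed
    have lim: "AE t in lborel. t \<in> {0..2*pi} \<longrightarrow> (\<lambda>j. ln (cmod (S j (cis t)) + \<epsilon>)) \<longlonglongrightarrow> L \<epsilon> t"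
      using \<Phi>_lim
    proof eventually_elim
      case (elim t)
      have "\<Phi> t + \<epsilon> \<noteq> 0" using \<Phi>(2)[of t] \<epsilon> by linarith
      then show ?case using elim unfolding L_def S_def by (auto intro!: tendsto_intros)
    qed
    show "circ_integrable (L \<epsilon>)"
      by (rule herg_dominated(2)[OF D', of 0]) (use m L_meas le lim in auto)
    assume z: "cmod z < 1"
    have "cmod (S j z) \<le> exp (Re (herg (\<lambda>t. ln (cmod (S j (cis t)) + \<epsilon>)) z))" for j
    proof (rule log_modulus_le_Poisson[OF _ \<epsilon> z])
      show "S j holomorphic_on UNIV" unfolding S_def by (intro holomorphic_intros)
    qed
    moreover have "(\<lambda>j. cmod (S j z)) \<longlonglongrightarrow> cmod (f z)"
      using filterlim_compose[OF s_lim[OF z] N] unfolding S_def by (rule tendsto_norm)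
    moreover have "(\<lambda>j. exp (Re (herg (\<lambda>t. ln (cmod (S j (cis t)) + \<epsilon>)) z))) \<longlonglongrightarrow> exp (Re (herg (L \<epsilon>) z))"
      by (intro tendsto_exp herg_dominated(3)[OF D' z m L_meas le lim])
    ultimately show "cmod (f z) \<le> exp (Re (herg (L \<epsilon>) z))"
      by (intro LIMSEQ_le) auto
  qed
  define \<epsilon> where "\<epsilon> n = 1 / (real n + 1)" for n :: nat
  have \<epsilon>: "0 < \<epsilon> n" "\<epsilon> n \<le> 1" for n by (auto simp: \<epsilon>_def)
  have \<epsilon>_lim: "\<epsilon> \<longlonglongrightarrow> 0" unfolding \<epsilon>_def by real_asymp
  \<comment> \<open>Nonnegative because \<open>\<epsilon> n \<le> 1\<close>. Hence the bound on its
    Poisson integral at \<open>z0\<close> is a bound on its integral, and Fatou's lemma applies to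
    the limit.\<close>
  define h where "h n t = L 1 t - L (\<epsilon> n) t" for n t
  have h0: "0 \<le> h n t" for n t using \<epsilon>[of n] \<Phi>(2)[of t] by (simp add: h_def L_def add_nonneg_pos)
  have h_ci: "circ_integrable (h n)" for n
    unfolding h_def by (intro set_integral_diff(1) L_ci \<epsilon>) auto
  define c where "c = (1 - (cmod z0)\<^sup>2) / 4"
  have c: "0 < c" using z0 by (simp add: c_def power_less_one_iff)
  define B where "B = 2 * pi * (Re (herg (L 1) z0) - ln (cmod (f z0))) / c"
  have h_B: "(LINT t:{0..2*pi}|lborel. h n t) \<le> B" for n
  proof -
    have "(\<lambda>t. h n t + L (\<epsilon> n) t) = L 1" by (simp add: h_def fun_eq_iff)
    then have "Re (herg (L 1) z0) = Re (herg (h n) z0) + Re (herg (L (\<epsilon> n)) z0)"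
      using herg_add[OF h_ci L_ci[OF \<epsilon>(1)] z0(1), of n n] by simp
    moreover have "ln (cmod (f z0)) \<le> Re (herg (L (\<epsilon> n)) z0)"
    proof -
      have "ln (cmod (f z0)) \<le> ln (exp (Re (herg (L (\<epsilon> n)) z0)))"
        using f_le_L[OF \<epsilon>(1) z0(1), of n] z0(2) by (subst ln_le_cancel_iff) auto
      then show ?thesis by simp
    qed
    ultimately have "Re (herg (h n) z0) \<le> Re (herg (L 1) z0) - ln (cmod (f z0))" by linarith
    then have "2 * pi * Re (herg (h n) z0) \<le> 2 * pi * (Re (herg (L 1) z0) - ln (cmod (f z0)))"
      by (intro mult_left_mono) auto
    with integral_le_Re_herg[OF h_ci z0(1) h0, of n]
    have "c * (LINT t:{0..2*pi}|lborel. h n t) \<le> 2 * pi * (Re (herg (L 1) z0) - ln (cmod (f z0)))"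
      unfolding c_def by linarith
    then show ?thesis using c by (simp add: B_def field_simps)
  qed
  \<comment> \<open>On \<open>Z\<close> the function \<open>h n\<close> equals
    \<open>ln (real n + 1)\<close>, which is unbounded in \<open>n\<close>, whereas the integrals of
    all \<open>h n\<close> are at most \<open>B\<close>; so \<open>Z\<close> is a null set.\<close>
  define Z where "Z = {t \<in> {0..2*pi}. \<Phi> t = 0}"
  have Zm: "Z \<in> sets lborel"
  proof -
    have "Z = {0..2*pi} \<inter> (\<Phi> -` {0} \<inter> space lborel)" by (auto simp: Z_def)
    also have "\<dots> \<in> sets lborel" using measurable_sets[OF \<Phi>(1), of "{0}"] by (intro sets.Int) auto
    finally show ?thesis .
  qed
  have Zfin: "emeasure lborel Z < \<infinity>"
  proof -
    have "emeasure lborel Z \<le> emeasure lborel {0..2*pi}" by (intro emeasure_mono) (auto simp: Z_def)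
    also have "\<dots> < \<infinity>" by simp
    finally show ?thesis .
  qed
  have "measure lborel Z = 0"
  proof -
    have iZ: "integrable lborel (indicator Z :: real \<Rightarrow> real)" using Zm Zfin by (simp add: integrable_indicator_iff)
    have "ln (real n + 1) * measure lborel Z \<le> B" for n
    proof -
      have "ln (real n + 1) * measure lborel Z = (\<integral>t. ln (real n + 1) * indicator Z t \<partial>lborel)"
        using Zm by simp
      also have "\<dots> \<le> (\<integral>t. indicator {0..2*pi} t *\<^sub>R h n t \<partial>lborel)"
      proof (rule integral_mono)
        show "integrable lborel (\<lambda>t. ln (real n + 1) * indicator Z t :: real)" using iZ by (rule integrable_mult_right)
        show "integrable lborel (\<lambda>t. indicator {0..2*pi} t *\<^sub>R h n t)" using h_ci unfolding set_integrable_def .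
        show "ln (real n + 1) * indicator Z t \<le> indicator {0..2*pi} t *\<^sub>R h n t" for t
        proof (cases "t \<in> Z")
          case True
          then have "h n t = ln (real n + 1)" by (simp add: h_def L_def Z_def \<epsilon>_def ln_div)
          then show ?thesis using True by (simp add: Z_def)
        next
          case False
          then show ?thesis using h0[of n t] by (simp add: indicator_def)
        qed
      qed
      also have "\<dots> \<le> B" using h_B[of n] unfolding set_lebesgue_integral_def .
      finally show ?thesis .
    qed
    moreover have "filterlim (\<lambda>n::nat. ln (real n + 1)) at_top sequentially" by real_asymp
    ultimately show ?thesis
    proof (rule_tac ccontr)
      assume bd: "\<And>n. ln (real n + 1) * measure lborel Z \<le> B"
        and inf: "filterlim (\<lambda>n::nat. ln (real n + 1)) at_top sequentially" and "measure lborel Z \<noteq> 0"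
      then have "0 < measure lborel Z" by (simp add: zero_less_measure_iff)
      then have "filterlim (\<lambda>n. ln (real n + 1) * measure lborel Z) at_top sequentially"
        by (intro filterlim_at_top_mult_tendsto_pos[OF tendsto_const] inf)
      then have "\<forall>\<^sub>F n in sequentially. B < ln (real n + 1) * measure lborel Z"
        by (simp add: filterlim_at_top_dense)
      then obtain n where "B < ln (real n + 1) * measure lborel Z" by (auto simp: eventually_sequentially)
      then show False using bd[of n] by linarith
    qed
  qed
  then have "emeasure lborel Z = 0" using Zfin by (auto simp: measure_def enn2real_eq_0_iff)
  then have "AE t in lborel. t \<notin> Z" using Zm by (intro AE_not_in null_setsI) auto
  then have pos: "AE t in lborel. t \<in> {0..2*pi} \<longrightarrow> 0 < \<Phi> t"
    by eventually_elim (use \<Phi>(2) in \<open>auto simp: Z_def less_le\<close>)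
  \<comment> \<open>\<open>outer_disk\<close> asks for positivity at every \<open>t\<close>; within
    the interval this changes \<open>\<Phi>\<close> only on a null set.\<close>
  define \<phi> where "\<phi> t = (if 0 < \<Phi> t then \<Phi> t else 1)" for t
  have \<phi>m: "\<phi> \<in> borel_measurable lborel" unfolding \<phi>_def using \<Phi>(1) by measurable
  have \<phi>0: "0 < \<phi> t" for t by (simp add: \<phi>_def)
  have \<phi>_eq: "AE t in lborel. t \<in> {0..2*pi} \<longrightarrow> \<Phi> t = \<phi> t"
    using pos by eventually_elim (auto simp: \<phi>_def)
  define h' where "h' t = ln (\<phi> t + 1) - ln (\<phi> t)" for t
  have h'_ci: "circ_integrable h'"
  proof (rule Fatou_circ(1)[OF h_ci h0 h_B])
    show "AE t in lborel. t \<in> {0..2*pi} \<longrightarrow> (\<lambda>n. h n t) \<longlonglongrightarrow> h' t"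
      using \<phi>_eq
    proof eventually_elim
      case (elim t)
      show ?case
      proof
        assume "t \<in> {0..2*pi}"
        then have "\<Phi> t = \<phi> t" using elim by simp
        have "(\<lambda>n. ln (\<phi> t + 1) - ln (\<phi> t + \<epsilon> n)) \<longlonglongrightarrow> ln (\<phi> t + 1) - ln (\<phi> t + 0)"
          using \<phi>0[of t] by (intro tendsto_intros \<epsilon>_lim) auto
        then show "(\<lambda>n. h n t) \<longlonglongrightarrow> h' t" unfolding h_def L_def h'_def \<open>\<Phi> t = \<phi> t\<close> by simp
      qed
    qed
    show "h' \<in> borel_measurable lborel" unfolding h'_def using \<phi>m by measurable
    show "0 \<le> h' t" for t using \<phi>0[of t] by (simp add: h'_def)
  qed
  have l1_ci: "circ_integrable (\<lambda>t. ln (\<phi> t + 1))"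
    by (rule circ_integrable_cong_AE(1)[OF L_ci[OF zero_less_one] _ L_meas])
      (use \<phi>m \<phi>_eq in \<open>auto simp: L_def elim: eventually_mono\<close>)
  have ln_ci: "circ_integrable (\<lambda>t. ln (\<phi> t))"
    using set_integral_diff(1)[OF l1_ci h'_ci] by (simp add: h'_def)
  show ?thesis
  proof (rule that[of \<phi>])
    show "\<phi> \<in> borel_measurable lborel" "\<And>t. 0 < \<phi> t" "circ_integrable (\<lambda>t. ln (\<phi> t))" by fact+
    have e2: "AE t in lborel. t \<in> {0..2*pi} \<longrightarrow> (\<Phi> t)\<^sup>2 = (\<phi> t)\<^sup>2"
      using \<phi>_eq by eventually_elim auto
    have m2: "(\<lambda>t. (\<phi> t)\<^sup>2) \<in> borel_measurable lborel" "(\<lambda>t. (\<Phi> t)\<^sup>2) \<in> borel_measurable lborel"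
      using \<phi>m \<Phi>(1) by measurable
    show "circ_integrable (\<lambda>t. (\<phi> t)\<^sup>2)" by (rule circ_integrable_cong_AE(1)[OF \<Phi>2(1) m2 e2])
    show "(LINT t:{0..2*pi}|lborel. (\<phi> t)\<^sup>2) \<le> 2 * pi * sq (tay f)"
      using \<Phi>2(2) unfolding circ_integrable_cong_AE(2)[OF \<Phi>2(1) m2 e2] .
    show "cmod (f z) \<le> exp (Re (herg (\<lambda>t. ln (\<phi> t)) z))" if z: "cmod z < 1" for z
    proof -
      define D' where "D' t = \<bar>ln (\<phi> t)\<bar> + \<bar>ln (\<phi> t + 1)\<bar>" for t
      have D': "circ_integrable D'"
        unfolding D'_def by (intro set_integral_add(1) set_integrable_abs ln_ci l1_ci)
      have lm: "(\<lambda>t. ln (\<phi> t)) \<in> borel_measurable lborel" using \<phi>m by measurable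
      have le: "AE t in lborel. t \<in> {0..2*pi} \<longrightarrow> \<bar>L (\<epsilon> n) t\<bar> \<le> D' t" for n
        using \<phi>_eq
      proof eventually_elim
        case (elim t)
        have "ln (\<phi> t) \<le> ln (\<phi> t + \<epsilon> n)" "ln (\<phi> t + \<epsilon> n) \<le> ln (\<phi> t + 1)"
          using \<phi>0[of t] \<epsilon>[of n] by (auto simp: add_pos_pos)
        then show ?case using elim unfolding L_def D'_def by auto
      qed
      have lim: "AE t in lborel. t \<in> {0..2*pi} \<longrightarrow> (\<lambda>n. L (\<epsilon> n) t) \<longlonglongrightarrow> ln (\<phi> t)"
        using \<phi>_eq
      proof eventually_elim
        case (elim t)
        have "(\<lambda>n. ln (\<phi> t + \<epsilon> n)) \<longlonglongrightarrow> ln (\<phi> t + 0)"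
          using \<phi>0[of t] by (intro tendsto_intros \<epsilon>_lim) auto
        then show ?case using elim by (simp add: L_def)
      qed
      have "(\<lambda>n. exp (Re (herg (L (\<epsilon> n)) z))) \<longlonglongrightarrow> exp (Re (herg (\<lambda>t. ln (\<phi> t)) z))"
        by (intro tendsto_exp herg_dominated(3)[OF D' z L_meas lm le lim])
      then show ?thesis by (rule LIMSEQ_le_const) (use f_le_L[OF \<epsilon>(1) z] in auto)
    qed
  qed
qed

section \<open>Free outer functions in the Hardy space of the disk are outer\<close>

text \<open>Apply \<open>Abel_l2\<close> to the square roots of \<open>cmod (d n)\<close>: the
  modulus of the difference of the two sums is at most the loss in the sum of the moduli.\<close>

lemma Abel_has_sum:
  fixes d :: "int \<Rightarrow> complex" and s :: complex
  assumes d: "(\<lambda>n. cmod (d n)) summable_on UNIV" and neg: "\<And>n. n < 0 \<Longrightarrow> d n = 0"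
    and s: "\<And>\<rho>. r < \<rho> \<Longrightarrow> \<rho> < 1 \<Longrightarrow> ((\<lambda>n. d n * of_real (\<rho> powi (2 * n))) has_sum m \<rho>) UNIV" and r: "0 < r" "r < 1"
  shows "(m \<longlongrightarrow> (\<Sum>\<^sub>\<infinity>n. d n)) (at_left 1)"
proof (rule tendstoI)
  fix e :: real assume e: "0 < e"
  define c where "c n = complex_of_real (sqrt (cmod (d n)))" for n
  have c2: "(cmod (c n))\<^sup>2 = cmod (d n)" for n by (simp add: c_def)
  have c: "l2 c" using d by (simp add: l2_summable c2)
  have "\<forall>\<^sub>F \<rho> in at_left 1. 0 < \<rho> \<and> \<rho> < 1 \<and> (\<lambda>n. (cmod (c n))\<^sup>2 * \<rho> powi (2 * n)) summable_on UNIV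
     \<and> sq c - e < (\<Sum>\<^sub>\<infinity>n. (cmod (c n))\<^sup>2 * \<rho> powi (2 * n))"
    by (rule Abel_l2[OF c _ e]) (simp add: c_def neg)
  moreover have "\<forall>\<^sub>F \<rho> in at_left 1. \<rho> \<in> {r<..<1}"
    by (rule eventually_at_left_real) (use r in simp)
  ultimately show "\<forall>\<^sub>F \<rho> in at_left 1. dist (m \<rho>) (\<Sum>\<^sub>\<infinity>n. d n) < e"
  proof eventually_elim
    case (elim \<rho>)
    then have \<rho>: "0 < \<rho>" "\<rho> < 1" "r < \<rho>" by auto
    have D: "((\<lambda>n. cmod (d n)) has_sum sq c) UNIV"
      using c by (simp add: l2_summable sq_def c2)
    have R: "((\<lambda>n. cmod (d n) * \<rho> powi (2 * n)) has_sum (\<Sum>\<^sub>\<infinity>n. (cmod (c n))\<^sup>2 * \<rho> powi (2 * n))) UNIV"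
      using elim by (simp add: c2)
    have "((\<lambda>n. d n * of_real (\<rho> powi (2 * n)) + - d n) has_sum (m \<rho> + - (\<Sum>\<^sub>\<infinity>n. d n))) UNIV"
      by (intro has_sum_add s \<rho> has_sum_uminus[THEN iffD2]) (simp add: abs_summable_summable[OF d])
    moreover have "((\<lambda>n. cmod (d n * of_real (\<rho> powi (2 * n)) + - d n)) has_sum
        (sq c + - (\<Sum>\<^sub>\<infinity>n. (cmod (c n))\<^sup>2 * \<rho> powi (2 * n)))) UNIV"
    proof -
      have "cmod (d n * of_real (\<rho> powi (2 * n)) + - d n) = cmod (d n) + - (cmod (d n) * \<rho> powi (2 * n))" for n
      proof (cases "n < 0")
        case False
        then have le: "\<rho> powi (2 * n) \<le> 1" using \<rho> by (intro powi_le_one_nonneg) auto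
        have "d n * of_real (\<rho> powi (2 * n)) + - d n = d n * of_real (\<rho> powi (2 * n) - 1)" by (simp add: algebra_simps)
        then have "cmod (d n * of_real (\<rho> powi (2 * n)) + - d n) = cmod (d n) * \<bar>\<rho> powi (2 * n) - 1\<bar>"
          by (simp only: norm_mult norm_of_real)
        then show ?thesis using le by (simp add: algebra_simps)
      qed (simp add: neg)
      moreover have "((\<lambda>n. - (cmod (d n) * \<rho> powi (2 * n))) has_sum - (\<Sum>\<^sub>\<infinity>n. (cmod (c n))\<^sup>2 * \<rho> powi (2 * n))) UNIV"
        using R by (simp add: has_sum_uminus)
      ultimately show ?thesis using has_sum_add[OF D] by (simp only:)
    qed
    ultimately have "norm (m \<rho> + - (\<Sum>\<^sub>\<infinity>n. d n)) \<le> sq c + - (\<Sum>\<^sub>\<infinity>n. (cmod (c n))\<^sup>2 * \<rho> powi (2 * n))"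
      by (intro norm_has_sum_bound)
    then show ?case using elim by (simp add: dist_norm)
  qed
qed

text \<open>For negative n the bound \<open>\<rho> powi (2 * n) \<le> weight r n\<close> holds
  because \<open>\<rho> > r\<close>, for the others because \<open>\<rho> < 1\<close>. It bounds the
  circle means of a product with a multiplier uniformly in the radius.\<close>

lemma weighted_norm_on_circle:
  assumes r: "0 < r" "r < \<rho>" "\<rho> < 1" and b: "wl2 (weight r) b"
    and s: "((\<lambda>n. (cmod (b n))\<^sup>2 * \<rho> powi (2 * n)) has_sum s) UNIV"
  shows "s \<le> (\<Sum>\<^sub>\<infinity>n. weight r n * (cmod (b n))\<^sup>2)"
proof (rule has_sum_mono[OF s])
  show "((\<lambda>n. weight r n * (cmod (b n))\<^sup>2) has_sum (\<Sum>\<^sub>\<infinity>n. weight r n * (cmod (b n))\<^sup>2)) UNIV"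
    using b by (simp add: wl2_def)
  show "(cmod (b n))\<^sup>2 * \<rho> powi (2 * n) \<le> weight r n * (cmod (b n))\<^sup>2" for n
  proof -
    have "\<rho> powi (2 * n) \<le> weight r n"
    proof (cases "n < 0")
      case True
      define k where "k = nat (- n)"
      have k: "n = - int k" using True by (simp add: k_def)
      have "inverse (\<rho> ^ (2 * k)) \<le> inverse (r ^ (2 * k))"
        using r by (intro le_imp_inverse_le power_mono) auto
      moreover have "2 * n = - int (2 * k)" by (simp add: k)
      ultimately show ?thesis using True by (simp only: weight_def power_int_minus power_int_of_nat if_True)
    next
      case False
      then show ?thesis using r powi_le_one_nonneg[of \<rho> "2 * n"] by (simp add: weight_def)
    qed
    from mult_right_mono[OF this, of "(cmod (b n))\<^sup>2"] show ?thesis by (simp add: mult.commute)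
  qed
qed

text \<open>Factor v^2 - u^2, bound v + u by 2 v, apply the arithmetic-geometric mean inequality
  with parameter \<open>\<eta>\<close>, and use (v - u)^2 \<le> v^2 - u^2. The point is that
  \<open>x\<close>, the modulus of a multiplier, survives only in the product
  \<open>x * v\<close>.\<close>

lemma modulus_diff_le:
  fixes x u v :: real
  assumes "0 \<le> x" "0 \<le> u" "u \<le> v" "0 < \<eta>"
  shows "x * (v\<^sup>2 - u\<^sup>2) \<le> \<eta> * (x * v)\<^sup>2 + (v\<^sup>2 - u\<^sup>2) / \<eta>"
proof -
  have "x * (v\<^sup>2 - u\<^sup>2) = (x * (v + u)) * (v - u)" by (simp add: power2_eq_square algebra_simps)
  also have "\<dots> \<le> (x * (2 * v)) * (v - u)"
    using assms by (intro mult_right_mono mult_left_mono) auto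
  also have "\<dots> \<le> \<eta> * (x * v)\<^sup>2 + (v - u)\<^sup>2 / \<eta>"
  proof -
    have "0 \<le> (\<eta> * (x * v) - (v - u))\<^sup>2 / \<eta>" using assms by simp
    also have "\<dots> = \<eta> * (x * v)\<^sup>2 + (v - u)\<^sup>2 / \<eta> - (x * (2 * v)) * (v - u)"
      using assms by (simp add: power2_eq_square field_simps)
    finally show ?thesis by simp
  qed
  also have "(v - u)\<^sup>2 \<le> v\<^sup>2 - u\<^sup>2"
  proof -
    have "u * u \<le> u * v" using assms by (intro mult_left_mono) auto
    then show ?thesis by (simp add: power2_eq_square algebra_simps)
  qed
  finally show ?thesis using assms by (simp add: divide_right_mono)
qed

text \<open>Since \<open>cmod F\<^sup>2 - cmod f\<^sup>2\<close> is nonnegative and its circle means tend to \<open>0\<close>, no boundary values of \<open>F\<close>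
  are needed. The multiplier, whose boundedness is not known here, is controlled through the norm of \<open>\<phi> F\<close>.\<close>

theorem dominating_same_norm_in_Eset:
  assumes r: "0 < r" "r < 1" and f: "f \<in> hardy_disk" and F: "F \<in> hardy_disk"
    and le: "\<And>z. cmod z < 1 \<Longrightarrow> cmod (f z) \<le> cmod (F z)" and nF: "sq (tay F) \<le> sq (tay f)"
  shows "F \<in> Eset r f"
proof -
  have fh: "f holomorphic_on ball 0 1" "l2 (tay f)" and Fh: "F holomorphic_on ball 0 1" "l2 (tay F)"
    using f F by (auto simp: hardy_disk_iff)
  have "Pfun r F \<phi> = Pfun r f \<phi>" if \<phi>: "\<phi> \<in> Mult r" for \<phi>
  proof -
    define mean where "mean h \<rho> = integral {0..2*pi} (\<lambda>t. h (of_real \<rho> * cis t)) / (2 * of_real pi)"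
      for h :: "complex \<Rightarrow> complex" and \<rho>
    have P: "(mean (\<lambda>z. \<phi> z * g z * cnj (g z)) \<longlongrightarrow> Pfun r g \<phi>) (at_left 1)"
      and I: "\<And>\<rho>. r < \<rho> \<Longrightarrow> \<rho> < 1 \<Longrightarrow> (\<lambda>t. \<phi> (of_real \<rho> * cis t) * g (of_real \<rho> * cis t) * cnj (g (of_real \<rho> * cis t))) integrable_on {0..2*pi}"
      if g: "g \<in> hardy_disk" for g
    proof -
      have gh: "g holomorphic_on ball 0 1" "l2 (tay g)" using g by (auto simp: hardy_disk_iff)
      have gH: "(\<lambda>z. \<phi> z * g z) \<in> H2_annulus r" using \<phi> hardy_disk_H2(1)[OF r g] by (simp add: Mult_def)
      define b where "b = laurent_coeffs r (\<lambda>z. \<phi> z * g z)"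
      have bl: "wl2 (weight r) b" unfolding b_def by (rule H2D(2)[OF r gH])
      have circ: "laurent_on_circle \<rho> (\<lambda>z. \<phi> z * g z) b" if "r < \<rho>" "\<rho> < 1" for \<rho>
        unfolding b_def using H2D(1)[OF r gH] that by (rule is_laurent_circle)
      have Pf: "Pfun r g \<phi> = (\<Sum>\<^sub>\<infinity>n. b n * cnj (tay g n))"
      proof -
        have "Pfun r g \<phi> = wip (weight r) b (tay g)"
          by (simp add: Pfun_def H2_inner_eq[OF r] hardy_disk_H2(2)[OF r g] b_def)
        also have "\<dots> = wip (\<lambda>_. 1) b (tay g)" by (rule wip_weight_nonneg[OF r]) (simp add: tay_neg)
        finally show ?thesis by (simp add: wip_def)
      qed
      have "(\<lambda>n. of_real (weight r n) * b n * cnj (tay g n)) summable_on UNIV"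
        using weight_pos[OF r(1)] hardy_disk_H2[OF r g] H2D(2)[OF r, of g]
        by (intro wip_summable bl) (auto simp: less_imp_le)
      moreover have "of_real (weight r n) * b n * cnj (tay g n) = b n * cnj (tay g n)" for n
        by (simp add: weight_def tay_neg)
      ultimately have "(\<lambda>n. b n * cnj (tay g n)) summable_on UNIV" by simp
      then have s: "(\<lambda>n. cmod (b n * cnj (tay g n))) summable_on UNIV"
        by (simp add: summable_on_iff_abs_summable_on_complex[symmetric])
      show "(mean (\<lambda>z. \<phi> z * g z * cnj (g z)) \<longlongrightarrow> Pfun r g \<phi>) (at_left 1)"
        unfolding Pf
      proof (rule Abel_has_sum[OF s _ _ r])
        show "((\<lambda>n. b n * cnj (tay g n) * of_real (\<rho> powi (2 * n))) has_sum mean (\<lambda>z. \<phi> z * g z * cnj (g z)) \<rho>) UNIV"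
          if "r < \<rho>" "\<rho> < 1" for \<rho>
          unfolding mean_def using circle_parseval(2)[OF _ circ[OF that] tay_circle[OF gh(1) that(2)]] that r by simp
      qed (simp add: tay_neg)
      show "(\<lambda>t. \<phi> (of_real \<rho> * cis t) * g (of_real \<rho> * cis t) * cnj (g (of_real \<rho> * cis t))) integrable_on {0..2*pi}"
        if "r < \<rho>" "\<rho> < 1" for \<rho>
        using circle_parseval(1)[OF _ circ[OF that] tay_circle[OF gh(1) that(2)]] that r by simp
    qed
    have FH: "(\<lambda>z. \<phi> z * F z) \<in> H2_annulus r" using \<phi> hardy_disk_H2(1)[OF r F] by (simp add: Mult_def)
    define b where "b = laurent_coeffs r (\<lambda>z. \<phi> z * F z)"
    define K where "K = (\<Sum>\<^sub>\<infinity>n. weight r n * (cmod (b n))\<^sup>2)"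
    define msq where "msq h \<rho> = integral {0..2*pi} (\<lambda>t. (cmod (h (of_real \<rho> * cis t)))\<^sup>2) / (2 * pi)"
      for h :: "complex \<Rightarrow> complex" and \<rho>
    define E where "E \<rho> = mean (\<lambda>z. \<phi> z * F z * cnj (F z)) \<rho> - mean (\<lambda>z. \<phi> z * f z * cnj (f z)) \<rho>" for \<rho>
    have E_lim: "(E \<longlongrightarrow> Pfun r F \<phi> - Pfun r f \<phi>) (at_left 1)"
      unfolding E_def by (intro tendsto_diff P f F)
    \<comment> \<open>The first term is bounded by the annulus norm of \<open>\<phi> F\<close> times
      \<open>\<eta>\<close>; for fixed \<open>\<eta>\<close> the second one vanishes as
      \<open>\<rho>\<close> tends to 1. Afterwards \<open>\<eta>\<close> tends to 0.\<close>
    have E_le: "cmod (E \<rho>) \<le> \<eta> * K + (msq F \<rho> - msq f \<rho>) / \<eta>" if \<rho>: "r < \<rho>" "\<rho> < 1" and \<eta>: "0 < \<eta>" for \<rho> \<eta>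
    proof -
      have \<rho>0: "0 < \<rho>" using r \<rho> by simp
      define w where "w t = of_real \<rho> * cis t" for t
      have wlt: "cmod (w t) < 1" for t using \<rho> \<rho>0 by (simp add: w_def norm_mult)
      have circ: "laurent_on_circle \<rho> (\<lambda>z. \<phi> z * F z) b"
        unfolding b_def using H2D(1)[OF r FH] \<rho> by (rule is_laurent_circle)
      note N1 = circle_norm_parseval[OF \<rho>0 circ]
      note N2 = circle_norm_parseval[OF \<rho>0 tay_circle[OF Fh(1) \<rho>(2)]]
      note N3 = circle_norm_parseval[OF \<rho>0 tay_circle[OF fh(1) \<rho>(2)]]
      have K1: "msq (\<lambda>z. \<phi> z * F z) \<rho> \<le> K"
        unfolding msq_def K_def by (rule weighted_norm_on_circle[OF r(1) \<rho> _ N1(2)]) (unfold b_def, rule H2D(2)[OF r FH])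
      have "E \<rho> = integral {0..2*pi} (\<lambda>t. \<phi> (w t) * F (w t) * cnj (F (w t)) - \<phi> (w t) * f (w t) * cnj (f (w t))) / (2 * of_real pi)"
        unfolding E_def mean_def w_def
        by (subst Henstock_Kurzweil_Integration.integral_diff[OF I[OF F \<rho>] I[OF f \<rho>]]) (simp add: diff_divide_distrib)
      then have "cmod (E \<rho>) = cmod (integral {0..2*pi} (\<lambda>t. \<phi> (w t) * F (w t) * cnj (F (w t)) - \<phi> (w t) * f (w t) * cnj (f (w t)))) / (2 * pi)"
        by (simp add: norm_divide)
      also have "\<dots> \<le> integral {0..2*pi} (\<lambda>t. \<eta> * (cmod (\<phi> (w t) * F (w t)))\<^sup>2 + ((cmod (F (w t)))\<^sup>2 - (cmod (f (w t)))\<^sup>2) / \<eta>) / (2 * pi)"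
      proof (intro divide_right_mono integral_norm_bound_integral)
        show "(\<lambda>t. \<phi> (w t) * F (w t) * cnj (F (w t)) - \<phi> (w t) * f (w t) * cnj (f (w t))) integrable_on {0..2*pi}"
          unfolding w_def by (intro integrable_diff I F f \<rho>)
        show "(\<lambda>t. \<eta> * (cmod (\<phi> (w t) * F (w t)))\<^sup>2 + ((cmod (F (w t)))\<^sup>2 - (cmod (f (w t)))\<^sup>2) / \<eta>) integrable_on {0..2*pi}"
          unfolding w_def by (intro integrable_add integrable_on_mult_right integrable_on_divide integrable_diff N1(1) N2(1) N3(1))
        show "cmod (\<phi> (w t) * F (w t) * cnj (F (w t)) - \<phi> (w t) * f (w t) * cnj (f (w t)))
          \<le> \<eta> * (cmod (\<phi> (w t) * F (w t)))\<^sup>2 + ((cmod (F (w t)))\<^sup>2 - (cmod (f (w t)))\<^sup>2) / \<eta>" for t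
        proof -
          have "\<phi> (w t) * F (w t) * cnj (F (w t)) - \<phi> (w t) * f (w t) * cnj (f (w t))
            = \<phi> (w t) * (F (w t) * cnj (F (w t)) - f (w t) * cnj (f (w t)))" by (simp add: algebra_simps)
          also have "\<dots> = \<phi> (w t) * of_real ((cmod (F (w t)))\<^sup>2 - (cmod (f (w t)))\<^sup>2)"
            by (simp only: complex_norm_square[symmetric] of_real_diff)
          finally have "cmod (\<phi> (w t) * F (w t) * cnj (F (w t)) - \<phi> (w t) * f (w t) * cnj (f (w t)))
            = cmod (\<phi> (w t)) * \<bar>(cmod (F (w t)))\<^sup>2 - (cmod (f (w t)))\<^sup>2\<bar>"
            by (simp only: norm_mult norm_of_real)
          also have "\<bar>(cmod (F (w t)))\<^sup>2 - (cmod (f (w t)))\<^sup>2\<bar> = (cmod (F (w t)))\<^sup>2 - (cmod (f (w t)))\<^sup>2"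
            using power_mono[OF le[OF wlt[of t]] norm_ge_zero, of 2] by simp
          also have "cmod (\<phi> (w t)) * ((cmod (F (w t)))\<^sup>2 - (cmod (f (w t)))\<^sup>2)
            \<le> \<eta> * (cmod (\<phi> (w t)) * cmod (F (w t)))\<^sup>2 + ((cmod (F (w t)))\<^sup>2 - (cmod (f (w t)))\<^sup>2) / \<eta>"
            by (rule modulus_diff_le[OF norm_ge_zero norm_ge_zero le[OF wlt] \<eta>])
          finally show ?thesis by (simp only: norm_mult)
        qed
      qed simp
      also have "integral {0..2*pi} (\<lambda>t. \<eta> * (cmod (\<phi> (w t) * F (w t)))\<^sup>2 + ((cmod (F (w t)))\<^sup>2 - (cmod (f (w t)))\<^sup>2) / \<eta>)
        = \<eta> * integral {0..2*pi} (\<lambda>t. (cmod (\<phi> (w t) * F (w t)))\<^sup>2) + (integral {0..2*pi} (\<lambda>t. (cmod (F (w t)))\<^sup>2) - integral {0..2*pi} (\<lambda>t. (cmod (f (w t)))\<^sup>2)) / \<eta>"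
        unfolding w_def
        by (rule integral_unique, intro has_integral_add has_integral_mult_right has_integral_divide has_integral_diff integrable_integral N1(1) N2(1) N3(1))
      also have "\<dots> / (2 * pi) = \<eta> * msq (\<lambda>z. \<phi> z * F z) \<rho> + (msq F \<rho> - msq f \<rho>) / \<eta>"
        unfolding msq_def w_def by (simp add: add_divide_distrib diff_divide_distrib mult.commute)
      also have "\<dots> \<le> \<eta> * K + (msq F \<rho> - msq f \<rho>) / \<eta>"
        using K1 \<eta> by (intro add_right_mono mult_left_mono) auto
      finally show ?thesis .
    qed
    have lim_le: "cmod (Pfun r F \<phi> - Pfun r f \<phi>) \<le> \<eta> * (K + 1)" if \<eta>: "0 < \<eta>" for \<eta>
    proof -
      have "\<forall>\<^sub>F \<rho> in at_left 1. 0 < \<rho> \<and> \<rho> < 1 \<and> (\<lambda>n. (cmod (tay f n))\<^sup>2 * \<rho> powi (2 * n)) summable_on UNIV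
        \<and> sq (tay f) - \<eta> * \<eta> < (\<Sum>\<^sub>\<infinity>n. (cmod (tay f n))\<^sup>2 * \<rho> powi (2 * n))"
        using \<eta> by (intro Abel_l2[OF fh(2) tay_neg]) auto
      moreover have "\<forall>\<^sub>F \<rho> in at_left 1. \<rho> \<in> {r<..<1}"
        by (rule eventually_at_left_real) (use r in simp)
      ultimately have "\<forall>\<^sub>F \<rho> in at_left 1. cmod (E \<rho>) \<le> \<eta> * (K + 1)"
      proof eventually_elim
        case (elim \<rho>)
        then have \<rho>: "r < \<rho>" "\<rho> < 1" "0 < \<rho>" by auto
        have "msq F \<rho> \<le> sq (tay F)" unfolding msq_def sq_def by (rule hardy_mean_le[OF Fh \<rho>(3,2)])
        moreover have "msq f \<rho> = (\<Sum>\<^sub>\<infinity>n. (cmod (tay f n))\<^sup>2 * \<rho> powi (2 * n))"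
          unfolding msq_def by (rule infsumI[OF circle_norm_parseval(2)[OF \<rho>(3) tay_circle[OF fh(1) \<rho>(2)]], symmetric])
        \<comment> \<open>\<open>\<rho>\<close> was chosen with an error of
          \<open>\<eta> * \<eta>\<close> because \<open>E_le\<close> divides by
          \<open>\<eta>\<close>.\<close>
        ultimately have "msq F \<rho> - msq f \<rho> \<le> \<eta> * \<eta>" using elim nF by linarith
        then have "(msq F \<rho> - msq f \<rho>) / \<eta> \<le> \<eta>" using \<eta> by (simp add: divide_le_eq)
        then show ?case using E_le[OF \<rho>(1,2) \<eta>] by (simp add: distrib_left)
      qed
      then show ?thesis
        by (intro tendsto_upperbound[OF tendsto_norm[OF E_lim]]) (auto simp: trivial_limit_at_left_real)
    qed
    have "((\<lambda>\<eta>. \<eta> * (K + 1)) \<longlongrightarrow> 0 * (K + 1)) (at_right 0)" by (intro tendsto_intros)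
    moreover have "\<forall>\<^sub>F \<eta> in at_right 0. cmod (Pfun r F \<phi> - Pfun r f \<phi>) \<le> \<eta> * (K + 1)"
      using eventually_at_right_less[of 0] by eventually_elim (rule lim_le)
    ultimately have "cmod (Pfun r F \<phi> - Pfun r f \<phi>) \<le> 0 * (K + 1)"
      by (intro tendsto_lowerbound) auto
    then show ?thesis by simp
  qed
  then show ?thesis using hardy_disk_H2(1)[OF r F] by (simp add: Eset_def)
qed

theorem free_outer_imp_outer_disk:
  assumes r: "0 < r" "r < 1" and w: "w \<in> annulus r" and f: "f \<in> hardy_disk"
    and nz: "\<exists>z\<in>ball 0 1. f z \<noteq> 0" and fo: "free_outer r w f"
  shows "outer_disk f"
proof -
  have fh: "f holomorphic_on ball 0 1" "l2 (tay f)" using f by (auto simp: hardy_disk_iff)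
  obtain z1 where z1: "cmod z1 < 1" "f z1 \<noteq> 0" using nz by auto
  obtain \<phi> where \<phi>: "\<phi> \<in> borel_measurable lborel" "\<And>t. 0 < \<phi> t" and ln_ci: "circ_integrable (\<lambda>t. ln (\<phi> t))"
    and sq_ci: "circ_integrable (\<lambda>t. (\<phi> t)\<^sup>2)"
    and sq_le: "(LINT t:{0..2*pi}|lborel. (\<phi> t)\<^sup>2) \<le> 2 * pi * sq (tay f)"
    and f_le: "\<And>z. cmod z < 1 \<Longrightarrow> cmod (f z) \<le> exp (Re (herg (\<lambda>t. ln (\<phi> t)) z))"
    using boundary_modulus[OF fh z1] by blast
  define F where "F z = exp (herg (\<lambda>t. ln (\<phi> t)) z)" for z
  have F0: "F z \<noteq> 0" for z by (simp add: F_def)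
  have Fh: "F holomorphic_on ball 0 1"
    unfolding F_def by (intro holomorphic_intros herg_holomorphic ln_ci)
  have le: "cmod (f z) \<le> cmod (F z)" if "cmod z < 1" for z
    using f_le[OF that] by (simp add: F_def)
  define G where "G = herg (\<lambda>t. (\<phi> t)\<^sup>2)"
  have Gh: "G holomorphic_on ball 0 1" unfolding G_def by (rule herg_holomorphic[OF sq_ci])
  \<comment> \<open>The square of \<open>cmod (F z)\<close> is the exponential of the Poisson
    integral of the logarithm of the squared \<open>\<phi>\<close>, so Jensen bounds it by the
    harmonic function \<open>Re (G z)\<close>. Circle means of that are its value at 0, which
    \<open>sq_le\<close> bounds by the norm of f.\<close>
  have FG: "(cmod (F z))\<^sup>2 \<le> Re (G z)" if z: "cmod z < 1" for z
  proof -
    have e: "exp (2 * ln (\<phi> t)) = (\<phi> t)\<^sup>2" for t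
      using \<phi>(2)[of t] exp_of_nat_mult[of 2 "ln (\<phi> t)"] by simp
    have "circ_integrable (\<lambda>t. 2 * ln (\<phi> t))" by (intro set_integrable_mult_right ln_ci)
    from Poisson_Jensen[OF this _ z] have "exp (Re (herg (\<lambda>t. 2 * ln (\<phi> t)) z)) \<le> Re (G z)"
      unfolding e G_def using sq_ci by simp
    moreover have "herg (\<lambda>t. 2 * ln (\<phi> t)) z = 2 * herg (\<lambda>t. ln (\<phi> t)) z"
      using herg_mult[of 2] by simp
    moreover have "(cmod (F z))\<^sup>2 = exp (2 * Re (herg (\<lambda>t. ln (\<phi> t)) z))"
      using exp_of_nat_mult[of 2 "Re (herg (\<lambda>t. ln (\<phi> t)) z)"] by (simp add: F_def)
    ultimately show ?thesis by simp
  qed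
  have G0: "Re (G 0) \<le> sq (tay f)"
    using sq_le by (simp add: G_def herg_at_0 field_simps)
  have mean: "integral {0..2*pi} (\<lambda>t. (cmod (F (of_real \<rho> * cis t)))\<^sup>2) / (2 * pi) \<le> sq (tay f)"
    if \<rho>: "0 < \<rho>" "\<rho> < 1" for \<rho>
  proof -
    have "integral {0..2*pi} (\<lambda>t. (cmod (F (of_real \<rho> * cis t)))\<^sup>2) \<le> integral {0..2*pi} (\<lambda>t. Re (G (of_real \<rho> * cis t)))"
      using \<rho> by (intro integral_le circle_norm_parseval(1)[OF \<rho>(1) tay_circle[OF Fh \<rho>(2)]]
          holomorphic_mean_value(1)[OF Gh \<rho>] FG) (simp add: norm_mult)
    then have "integral {0..2*pi} (\<lambda>t. (cmod (F (of_real \<rho> * cis t)))\<^sup>2) / (2 * pi)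
       \<le> integral {0..2*pi} (\<lambda>t. Re (G (of_real \<rho> * cis t))) / (2 * pi)" by (rule divide_right_mono) simp
    also have "\<dots> = Re (G 0)" by (rule holomorphic_mean_value(2)[OF Gh \<rho>])
    finally show ?thesis using G0 by linarith
  qed
  have Fl2: "l2 (tay F)" and Fsq: "sq (tay F) \<le> sq (tay f)"
    unfolding sq_def[of "tay F"] by (rule hardy_norm_le[OF Fh mean]; assumption)+
  have FH: "F \<in> hardy_disk" using Fh Fl2 by (simp add: hardy_disk_iff)
  have "F \<in> Eset r f" by (rule dominating_same_norm_in_Eset[OF r f FH le Fsq])
  then have Fw: "cmod (F w) \<le> cmod (f w)"
    using fo free_outer_iff[OF r w hardy_disk_H2(1)[OF r f]] by blast
  define Q where "Q z = f z / F z" for z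
  have Qh: "Q holomorphic_on ball 0 1" unfolding Q_def by (intro holomorphic_intros fh Fh) (simp add: F0)
  have Q_le: "cmod (Q z) \<le> 1" if "cmod z < 1" for z
    using le[OF that] F0[of z] by (simp add: Q_def norm_divide divide_le_eq)
  have w1: "cmod w < 1" using w by (simp add: annulus_def)
  have Qw: "cmod (Q w) = 1"
    using Q_le[OF w1] Fw F0[of w] by (simp add: Q_def norm_divide divide_le_eq le_divide_eq antisym)
  have "Q constant_on ball 0 1"
    by (rule maximum_modulus_principle[OF Qh _ _ open_ball order_refl, of w]) (use Q_le w1 Qw in auto)
  then have Qc: "Q z = Q w" if "cmod z < 1" for z
    using that w1 unfolding constant_on_def by (metis mem_ball_0)
  have fF: "f z = Q w * F z" if "cmod z < 1" for z
    using Qc[OF that] F0[of z] by (simp add: Q_def[of z] divide_eq_eq)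
  show ?thesis
    unfolding outer_disk_def
  proof (intro conjI exI[of _ "Q w"] exI[of _ \<phi>] allI ballI)
    show "f z = Q w * exp (1 / (2 * of_real pi) *
        (LINT t:{0..2*pi}|lborel. (cis t + z) / (cis t - z) * of_real (ln (\<phi> t))))" if "z \<in> ball 0 1" for z
      using fF[of z] that by (simp add: F_def herg_def herg_kernel_def)
  qed (use f Qw \<phi> ln_ci in auto)
qed

theorem outer_disk_iff_free_outer:
  assumes r: "0 < r" "r < 1" and w: "w \<in> annulus r" and f: "f \<in> hardy_disk" and nz: "\<exists>z\<in>ball 0 1. f z \<noteq> 0"
  shows "outer_disk f \<longleftrightarrow> free_outer r w f"
  using outer_disk_imp_free_outer[OF r w] free_outer_imp_outer_disk[OF r w f nz] by blast

section \<open>The reflection exchanging the boundary circles\<close>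

definition refl :: "real \<Rightarrow> (complex \<Rightarrow> complex) \<Rightarrow> complex \<Rightarrow> complex" where
  "refl r f z = f (of_real r / z)"

context
  fixes r :: real assumes r: "0 < r" "r < 1"
begin

lemma refl_refl: "refl r (refl r f) = f"
proof
  fix z show "refl r (refl r f) z = f z"
    \<comment> \<open>Division by 0 gives 0, so the reflection is an involution on total functions,
      including the point 0.\<close>
    using r by (cases "z = 0") (auto simp: refl_def)
qed

lemma annulus_refl: "z \<in> annulus r \<Longrightarrow> of_real r / z \<in> annulus r"
proof -
  assume "z \<in> annulus r"
  then have "r < cmod z" "cmod z < 1" "0 < cmod z" using r by (auto simp: annulus_def)
  then show ?thesis using r by (simp add: annulus_def norm_divide pos_less_divide_eq pos_divide_less_eq)
qed

lemma is_laurent_refl: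
  assumes "is_laurent r f c"
  shows "is_laurent r (refl r f) (\<lambda>n. c (- n) * of_real (r powi (- n)))"
  unfolding is_laurent_def
proof
  fix z assume z: "z \<in> annulus r"
  have b: "bij (uminus :: int \<Rightarrow> int)" by (rule bij_uminus)
  have "((\<lambda>n. c n * (of_real r / z) powi n) has_sum refl r f z) UNIV"
    using assms annulus_refl[OF z] by (simp add: is_laurent_def refl_def)
  then have "((\<lambda>n. c (- n) * (of_real r / z) powi (- n)) has_sum refl r f z) UNIV"
    using has_sum_reindex_bij_betw[OF b, of "\<lambda>n. c n * (of_real r / z) powi n"] by simp
  moreover have "c (- n) * (of_real r / z) powi (- n) = c (- n) * of_real (r powi (- n)) * z powi n" for n
    unfolding power_int_divide_distrib power_int_minus[of z] by (simp add: divide_inverse)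
  ultimately show "((\<lambda>n. c (- n) * of_real (r powi (- n)) * z powi n) has_sum refl r f z) UNIV" by simp
qed

text \<open>The isometry on monomials: reflection sends z^n to r^n z^(-n).\<close>

lemma weight_refl: "weight r n * (r powi (- n))\<^sup>2 = weight r (- n)"
proof -
  have "(r powi m)\<^sup>2 = r powi (2 * m)" for m by (simp add: mult.commute[of 2] power_int_mult)
  from this[of "- n"] have 1: "(r powi (- n))\<^sup>2 = r powi (- 2 * n)" by simp
  have 2: "r powi (2 * n) * r powi (- 2 * n) = 1" using r by (simp flip: power_int_add)
  show ?thesis unfolding 1 using 2 by (auto simp: weight_def)
qed

lemma wl2_refl:
  assumes "wl2 (weight r) c" shows "wl2 (weight r) (\<lambda>n. c (- n) * of_real (r powi (- n)))"
proof -
  have b: "bij (uminus :: int \<Rightarrow> int)" by (rule bij_uminus)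
  have "(\<lambda>n. weight r (- n) * (cmod (c (- n)))\<^sup>2) summable_on UNIV"
    using assms summable_on_reindex_bij_betw[OF b, of "\<lambda>n. weight r n * (cmod (c n))\<^sup>2"] by (simp add: wl2_def)
  moreover have "weight r (- n) * (cmod (c (- n)))\<^sup>2 = weight r n * (cmod (c (- n) * of_real (r powi (- n))))\<^sup>2" for n
    unfolding weight_refl[symmetric] norm_mult norm_of_real power_mult_distrib power2_abs by (simp only: mult_ac)
  ultimately show ?thesis unfolding wl2_def by simp
qed

lemma H2_refl:
  assumes "f \<in> H2_annulus r"
  shows "refl r f \<in> H2_annulus r"
    and "laurent_coeffs r (refl r f) = (\<lambda>n. laurent_coeffs r f (- n) * of_real (r powi (- n)))"
proof -
  note f = H2D[OF r assms]
  have "(f \<circ> (\<lambda>z. of_real r / z)) holomorphic_on annulus r"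
    using r annulus_refl by (intro holomorphic_on_compose_gen[OF _ f(3)] holomorphic_intros) (auto simp: annulus_def)
  then have "refl r f holomorphic_on annulus r" by (simp add: o_def refl_def[abs_def])
  then show "refl r f \<in> H2_annulus r"
    by (rule H2I[OF r _ is_laurent_refl[OF f(1)] wl2_refl[OF f(2)]])
  show "laurent_coeffs r (refl r f) = (\<lambda>n. laurent_coeffs r f (- n) * of_real (r powi (- n)))"
    by (rule laurent_coeffs_eq[OF r is_laurent_refl[OF f(1)]])
qed

lemma H2_inner_refl:
  assumes "f \<in> H2_annulus r" "g \<in> H2_annulus r"
  shows "H2_inner r (refl r f) (refl r g) = H2_inner r f g"
proof -
  have b: "bij (uminus :: int \<Rightarrow> int)" by (rule bij_uminus)
  have "H2_inner r (refl r f) (refl r g)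
    = (\<Sum>\<^sub>\<infinity>n. of_real (weight r n * (r powi (- n))\<^sup>2) * laurent_coeffs r f (- n) * cnj (laurent_coeffs r g (- n)))"
    unfolding H2_inner_def H2_refl(2)[OF assms(1)] H2_refl(2)[OF assms(2)]
    by (intro infsum_cong) (simp add: power2_eq_square)
  also have "\<dots> = H2_inner r f g"
    unfolding weight_refl H2_inner_def
    using infsum_reindex_bij_betw[OF b, of "\<lambda>n. of_real (weight r n) * laurent_coeffs r f n * cnj (laurent_coeffs r g n)"] by simp
  finally show ?thesis .
qed

lemma refl_mult: "(\<lambda>z. refl r f z * refl r g z) = refl r (\<lambda>z. f z * g z)"
  by (simp add: refl_def fun_eq_iff)

lemma Mult_refl: assumes "\<phi> \<in> Mult r" shows "refl r \<phi> \<in> Mult r"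
  unfolding Mult_def
proof (intro CollectI ballI)
  fix h assume "h \<in> H2_annulus r"
  then have "(\<lambda>z. \<phi> z * refl r h z) \<in> H2_annulus r" using assms H2_refl(1) by (auto simp: Mult_def)
  then have "refl r (\<lambda>z. \<phi> z * refl r h z) \<in> H2_annulus r" by (rule H2_refl(1))
  then show "(\<lambda>z. refl r \<phi> z * h z) \<in> H2_annulus r"
    unfolding refl_mult[symmetric] refl_refl .
qed

lemma Pfun_refl:
  assumes "f \<in> H2_annulus r" "\<phi> \<in> Mult r"
  shows "Pfun r (refl r f) (refl r \<phi>) = Pfun r f \<phi>"
  unfolding Pfun_def refl_mult using assms by (intro H2_inner_refl) (auto simp: Mult_def)

lemma Eset_refl:
  assumes f: "f \<in> H2_annulus r" and g: "g \<in> Eset r f" shows "refl r g \<in> Eset r (refl r f)"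
proof -
  have gH: "g \<in> H2_annulus r" using g by (simp add: Eset_def)
  have "Pfun r (refl r g) \<phi> = Pfun r (refl r f) \<phi>" if "\<phi> \<in> Mult r" for \<phi>
    using Pfun_refl[OF gH Mult_refl[OF that]] Pfun_refl[OF f Mult_refl[OF that]] g Mult_refl[OF that]
    unfolding refl_refl by (simp add: Eset_def)
  then show ?thesis using H2_refl(1)[OF gH] by (simp add: Eset_def)
qed

lemma free_outer_refl:
  assumes w: "w \<in> annulus r" and f: "free_outer r w f"
  shows "free_outer r (of_real r / w) (refl r f)"
proof -
  have fH: "f \<in> H2_annulus r" using f by (simp add: free_outer_def)
  have w0: "w \<noteq> 0" using w r by (auto simp: annulus_def)
  have val: "refl r g (of_real r / w) = g w" for g using w0 r by (simp add: refl_def)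
  have "cmod (g (of_real r / w)) \<le> cmod (refl r f (of_real r / w))" if g: "g \<in> Eset r (refl r f)" for g
  proof -
    have "refl r g \<in> Eset r f" using Eset_refl[OF H2_refl(1)[OF fH] g] unfolding refl_refl .
    then have "cmod (refl r g w) \<le> cmod (f w)" using f free_outer_iff[OF r w fH] by blast
    then show ?thesis unfolding val by (simp add: refl_def)
  qed
  then show ?thesis using free_outer_iff[OF r annulus_refl[OF w] H2_refl(1)[OF fH]] by blast
qed

text \<open>Needed because the function on the disk that represents a reflected exterior function
  agrees with \<open>refl r f\<close> only away from 0.\<close>

lemma free_outer_cong:
  assumes eq: "\<And>z. z \<in> annulus r \<Longrightarrow> f z = g z" and w: "w \<in> annulus r"
  shows "free_outer r w f \<longleftrightarrow> free_outer r w g"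
proof -
  have lau: "laurent_coeffs r u = laurent_coeffs r v" and H: "u \<in> H2_annulus r \<longleftrightarrow> v \<in> H2_annulus r"
    if "\<And>z. z \<in> annulus r \<Longrightarrow> u z = v z" for u v
  proof -
    have "is_laurent r u = is_laurent r v" using that by (simp add: is_laurent_def fun_eq_iff)
    moreover have "u holomorphic_on annulus r \<longleftrightarrow> v holomorphic_on annulus r"
      using that by (intro holomorphic_cong) auto
    ultimately show "laurent_coeffs r u = laurent_coeffs r v" "u \<in> H2_annulus r \<longleftrightarrow> v \<in> H2_annulus r"
      by (simp_all add: laurent_coeffs_def H2_annulus_def)
  qed
  have "Pfun r f \<phi> = Pfun r g \<phi>" for \<phi>
    using lau[of "\<lambda>z. \<phi> z * f z" "\<lambda>z. \<phi> z * g z"] lau[of f g] eq by (simp add: Pfun_def H2_inner_def)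
  then have "Eset r f = Eset r g" by (simp add: Eset_def)
  then show ?thesis using H[of f g] eq[of w] eq w by (simp add: free_outer_def)
qed

lemma free_outer_refl_iff:
  assumes "w \<in> annulus r"
  shows "free_outer r w f \<longleftrightarrow> free_outer r (of_real r / w) (refl r f)"
proof
  assume "free_outer r (of_real r / w) (refl r f)"
  from free_outer_refl[OF annulus_refl[OF assms] this]
  show "free_outer r w f" using assms r unfolding refl_refl by (auto simp: annulus_def)
qed (rule free_outer_refl[OF assms])

section \<open>Transfer to the exterior domain\<close>

lemma hardy_ext_refl:
  assumes f: "f \<in> hardy_ext r"
  obtains g where "g \<in> hardy_disk" "\<And>z. cmod z < 1 \<Longrightarrow> z \<noteq> 0 \<Longrightarrow> g z = f (of_real r / z)"
proof -
  obtain c where c: "\<And>z. r < cmod z \<Longrightarrow> ((\<lambda>n. c n * z powi n) has_sum f z) {..0::int}"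
    and c2: "(\<lambda>n. r powi (2 * n) * (cmod (c n))\<^sup>2) summable_on {..0::int}"
    using f by (auto simp: hardy_ext_def)
  define b where "b n = c (- int n) * of_real (r powi (- int n))" for n
  \<comment> \<open>At 0 the formula \<open>f (of_real r / z)\<close> would give the meaningless
    value \<open>f 0\<close>; the right one is the value at infinity, the coefficient
    \<open>c 0\<close>.\<close>
  define g where "g z = (if z = 0 then c 0 else f (of_real r / z))" for z
  have bij: "bij_betw (\<lambda>n. - int n) UNIV {..0}"
    by (rule bij_betwI[of _ _ _ "\<lambda>n. nat (- n)"]) auto
  have gs: "((\<lambda>n. b n * z ^ n) has_sum g z) UNIV" if z: "cmod z < 1" for z
  proof (cases "z = 0")
    case True
    have "((\<lambda>n. b n * z ^ n) has_sum c 0) {0}"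
      by (rule has_sum_finiteI) (auto simp: b_def)
    then have "((\<lambda>n. b n * z ^ n) has_sum c 0) UNIV"
      by (rule has_sum_cong_neutral[THEN iffD1, rotated -1]) (auto simp: True)
    then show ?thesis by (simp add: g_def True)
  next
    case False
    have "r < cmod (of_real r / z)" using z False r by (simp add: norm_divide field_simps)
    from c[OF this] have "((\<lambda>n. c (- int n) * (of_real r / z) powi (- int n)) has_sum f (of_real r / z)) UNIV"
      using has_sum_reindex_bij_betw[OF bij, of "\<lambda>n. c n * (of_real r / z) powi n"] by simp
    moreover have "c (- int n) * (of_real r / z) powi (- int n) = b n * z ^ n" for n
      using False r unfolding b_def power_int_minus power_int_of_nat power_divide by (simp add: field_simps)
    ultimately show ?thesis using False by (simp add: g_def)
  qed
  have hol: "g holomorphic_on ball 0 1"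
    by (rule power_series_holomorphic[where a = b]) (use gs in \<open>auto intro: has_sum_imp_sums\<close>)
  have "laurent_on_circle (1/2) g (\<lambda>n. if n < 0 then 0 else b (nat n))"
    unfolding laurent_on_circle_def
  proof (intro allI impI)
    fix z :: complex assume "cmod z = 1 / 2"
    then show "((\<lambda>n. (if n < 0 then 0 else b (nat n)) * z powi n) has_sum g z) UNIV"
      using gs[of z] by (subst has_sum_int_nat) auto
  qed
  then have tg: "tay g = (\<lambda>n. if n < 0 then 0 else b (nat n))"
    by (intro tay_unique[OF hol, of "1/2"]) auto
  have "(\<lambda>n. r powi (2 * (- int n)) * (cmod (c (- int n)))\<^sup>2) summable_on UNIV"
    using c2 summable_on_reindex_bij_betw[OF bij, of "\<lambda>n. r powi (2 * n) * (cmod (c n))\<^sup>2"] by simp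
  moreover have "r powi (2 * (- int n)) * (cmod (c (- int n)))\<^sup>2 = (cmod (b n))\<^sup>2" for n
  proof -
    have "r powi (2 * (- int n)) = (r powi (- int n))\<^sup>2"
      unfolding mult.commute[of 2] power_int_mult by simp
    then show ?thesis unfolding b_def norm_mult norm_of_real power_mult_distrib power2_abs by simp
  qed
  ultimately have "(\<lambda>n. (cmod (b n))\<^sup>2) summable_on UNIV" by simp
  then have "l2 (tay g)" unfolding l2_summable tg by (subst summable_on_int_nat) auto
  then have "g \<in> hardy_disk" using hol by (simp add: hardy_disk_iff)
  then show ?thesis by (rule that) (simp add: g_def)
qed

text \<open>The reflection says nothing about the point 0. Both functions are holomorphic, so their
  coefficients, and with them their values at 0, are determined on the circle of radius 1/2.\<close>

lemma outer_disk_cong: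
  assumes g: "g \<in> hardy_disk" and h: "outer_disk h" and eq: "\<And>z. cmod z < 1 \<Longrightarrow> z \<noteq> 0 \<Longrightarrow> g z = h z"
  shows "outer_disk g"
proof -
  have gh: "g holomorphic_on ball 0 1" using g by (simp add: hardy_disk_def)
  have hh: "h holomorphic_on ball 0 1" using h by (simp add: outer_disk_def hardy_disk_def)
  have "laurent_on_circle (1/2) g (tay h)"
    unfolding laurent_on_circle_def
  proof (intro allI impI)
    fix z :: complex assume z: "cmod z = 1 / 2"
    then have "z \<noteq> 0" by auto
    then show "((\<lambda>n. tay h n * z powi n) has_sum g z) UNIV"
      using tay_has_sum[OF hh, of z] eq[of z] z by simp
  qed
  then have "tay g = tay h" by (intro tay_unique[OF gh, of "1/2"]) auto
  then have "tay g 0 = tay h 0" by simp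
  then have "g z = h z" if "cmod z < 1" for z using eq[OF that] by (cases "z = 0") (auto simp: tay_def)
  then show ?thesis using g h unfolding outer_disk_def by auto
qed

theorem outer_ext_iff_free_outer:
  assumes w: "w \<in> annulus r" and f: "f \<in> hardy_ext r" and nz: "\<exists>z. r < cmod z \<and> f z \<noteq> 0"
  shows "outer_ext r f \<longleftrightarrow> free_outer r w f"
proof -
  obtain g where g: "g \<in> hardy_disk" and gf: "\<And>z. cmod z < 1 \<Longrightarrow> z \<noteq> 0 \<Longrightarrow> g z = f (of_real r / z)"
    using hardy_ext_refl[OF f] by blast
  have dom: "cmod (of_real r / z) < 1" "of_real r / z \<noteq> 0" if "r < cmod z" for z :: complex
    using that r by (auto simp: norm_divide divide_less_eq)
  have fg: "f z = g (of_real r / z)" if "r < cmod z" for z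
    using gf[OF dom[OF that]] that r by auto
  have ext: "outer_ext r f \<longleftrightarrow> outer_disk g"
  proof
    assume "outer_ext r f"
    then obtain h where h: "outer_disk h" "\<And>z. r < cmod z \<Longrightarrow> f z = h (of_real r / z)"
      by (auto simp: outer_ext_def)
    show "outer_disk g"
    proof (rule outer_disk_cong[OF g h(1)])
      fix z :: complex assume z: "cmod z < 1" "z \<noteq> 0"
      then have "r < cmod (of_real r / z)" using r by (simp add: norm_divide field_simps)
      then show "g z = h z" using gf[OF z] h(2) z r by simp
    qed
  next
    assume "outer_disk g"
    then show "outer_ext r f" using fg by (auto simp: outer_ext_def)
  qed
  obtain z where z: "r < cmod z" "f z \<noteq> 0" using nz by blast
  have "\<exists>z\<in>ball 0 1. g z \<noteq> 0"
    using dom(1)[OF z(1)] fg[OF z(1)] z(2) by (intro bexI[of _ "of_real r / z"]) auto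
  from outer_disk_iff_free_outer[OF r annulus_refl[OF w] g this]
  have "outer_disk g \<longleftrightarrow> free_outer r (of_real r / w) g" .
  also have "\<dots> \<longleftrightarrow> free_outer r (of_real r / w) (refl r f)"
  proof (rule free_outer_cong[OF _ annulus_refl[OF w]])
    fix z assume z: "z \<in> annulus r"
    then have "z \<noteq> 0" using r by (auto simp: annulus_def)
    then show "g z = refl r f z" using gf[of z] z by (simp add: annulus_def refl_def)
  qed
  also have "\<dots> \<longleftrightarrow> free_outer r w f" by (rule free_outer_refl_iff[OF w, symmetric])
  finally show ?thesis using ext by simp
qed

end

theorem theorem3p5:
  fixes r :: real and z\<^sub>0 :: complex
  assumes "0 < r" and "r < 1" and "z\<^sub>0 \<in> annulus r"
  shows "(\<forall>f. f \<in> hardy_disk \<and> (\<exists>z\<in>ball 0 1. f z \<noteq> 0) \<longrightarrow>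
             (outer_disk f \<longleftrightarrow> free_outer r z\<^sub>0 f)) \<and>
         (\<forall>f. f \<in> hardy_ext r \<and> (\<exists>z. r < cmod z \<and> f z \<noteq> 0) \<longrightarrow>
             (outer_ext r f \<longleftrightarrow> free_outer r z\<^sub>0 f))"
  using outer_disk_iff_free_outer[OF assms] outer_ext_iff_free_outer[OF assms] by blast

end
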